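(* In the affine B-web category $\mathcal B^\bullet$, for every $m\in\mathbb N=\{0,1,2,\ldots\}$ the bubbles satisfy $$\Delta_{2m+1}=\sum_{k=0}^m(-1)^k(2k)!\,G_{2k+2}\binom{x-2m+2k}{2k+2}\binom{x-2m+2k-1}{2k}\Delta_{2m-2k},$$ where $G_{2k}$ ($k\ge1$) are the unsigned Genocchi numbers.
   Context: The affine B-web category. Let $\mathbb J'=\{f\in\mathbb Q[x]: f(n)\in\mathbb Z[\tfrac12]\ \text{for all } n\in\mathbb Z\}$. The affine B-web category $\mathcal B^\bullet$ is the strict $\mathbb J'$-linear monoidal category with unit object $\mathbf 1$, generating objects $a\in\mathbb Z_{\ge1}$, and generating morphisms (for $a,b\ge1$): merges $m_{a,b}:a\otimes b\to a+b$, splits $s_{a,b}:a+b\to a\otimes b$, crossings $c_{a,b}:a\otimes b\to b\otimes a$, cups $\cup_a:\mathbf 1\to a\otimes a$, caps $\cap_a:a\otimes a\to\mathbf 1$, dots $d_a:a\to a$. Composition is written $fg=f\circ g$, and $1_a$ is the identity of $a$. Strands of thickness $0$ are omitted: the object $0$ is $\mathbf 1$, and $m_{0,a},m_{a,0},s_{0,a},s_{a,0},c_{0,a},c_{a,0}$ are $1_a$, while $\cup_0,\cap_0,d_0$ are $1_{\mathbf 1}$. The relations are, for all positive labels: (W1) $m_{a+b,c}(m_{a,b}\otimes1_c)=m_{a,b+c}(1_a\otimes m_{b,c})$ and $(s_{a,b}\otimes1_c)s_{a+b,c}=(1_a\otimes s_{b,c})s_{a,b+c}$. (W2) $m_{a,b}s_{a,b}=\binom{a+b}{a}1_{a+b}$;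 and, for $a+c=b+d$, $s_{b,d}m_{a,c}=\sum(m_{s,c-t}\otimes m_{a-s,t})(1_s\otimes c_{a-s,c-t}\otimes1_t)(s_{s,a-s}\otimes s_{c-t,t})$, summed over $0\le s\le\min(a,b)$, $0\le t\le\min(c,d)$ with $t-s=d-a$. (W3) $(\cap_a\otimes1_a)(1_a\otimes\cup_a)=1_a=(1_a\otimes\cap_a)(\cup_a\otimes1_a)$; $(\cap_a\otimes1_b)(1_a\otimes c_{b,a})=(1_b\otimes\cap_a)(c_{a,b}\otimes1_a)$; $(c_{b,a}\otimes1_a)(1_b\otimes\cup_a)=(1_a\otimes c_{a,b})(\cup_a\otimes1_b)$. (W4) $\cap_b(1_b\otimes\cap_a\otimes1_b)(s_{b,a}\otimes1_a\otimes1_b)=\cap_{a+b}(1_{a+b}\otimes m_{a,b})$; $\cap_a(1_a\otimes\cap_b\otimes1_a)(1_a\otimes1_b\otimes s_{b,a})=\cap_{a+b}(m_{a,b}\otimes1_{a+b})$. (W5) $\cap_a\cup_a=\binom xa$; $\cap_as_{a,a}=0$; $\cap_ac_{a,a}=(-1)^a\cap_a$. (A1) $\sum_{t=0}^{\min(a,b)}t!\,(m_{b-t,t}\otimes m_{t,a-t})(1_{b-t}\otimes\cup_t\otimes1_{a-t})(d_{b-t}\otimes1_{a-t})c_{a-t,b-t}(1_{a-t}\otimes\cap_t\otimes1_{b-t})(s_{a-t,t}\otimes s_{t,b-t})=\sum_{t=0}^{\min(a,b)}t!\,(m_{t,b-t}\otimes m_{a-t,t})(1_t\otimes c_{a-t,b-t}\otimes1_t)(1_t\otimes1_{a-t}\otimes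 d_{b-t}\otimes1_t)(s_{t,a-t}\otimes s_{b-t,t})$. (A2) With the lollipops $\ell_{2s}:=2^{-s}\cap_s(d_s\otimes1_s)s_{s,s}:2s\to\mathbf 1$ and $\ell^*_{2s}:=2^{-s}m_{s,s}(d_s\otimes1_s)\cup_s:\mathbf 1\to2s$: $s_{a,b}d_{a+b}=\sum_{s=0}^{\min(a,b)}s!\,(m_{a-s,s}\otimes m_{s,b-s})(1_{a-s}\otimes\cup_s\otimes1_{b-s})(d_{a-s}\otimes d_{b-s})s_{a-s,b-s}(\ell_{2s}\otimes1_{a+b-2s})s_{2s,a+b-2s}$, $d_{a+b}m_{a,b}=\sum_{s=0}^{\min(a,b)}s!\,m_{2s,a+b-2s}(\ell^*_{2s}\otimes1_{a+b-2s})m_{a-s,b-s}(d_{a-s}\otimes d_{b-s})(1_{a-s}\otimes\cap_s\otimes1_{b-s})(s_{a-s,s}\otimes s_{s,b-s})$. (A3) $\cap_a(d_a\otimes1_a)=(-1)^a\cap_a(1_a\otimes d_a)$ and $(d_a\otimes1_a)\cup_a=(-1)^a(1_a\otimes d_a)\cup_a$. Bubbles. $\Delta_a:=\cap_a(d_a\otimes1_a)\cup_a\in\mathrm{End}_{\mathcal B^\bullet}(\mathbf 1)$ for $a\ge1$, and $\Delta_0:=1$. Genocchi numbers. $G_{2n}$ ($n\ge1$) are determined by $\sum_{n\ge1}(-1)^nG_{2n}\frac{t^{2n}}{(2n)!}=-t\tanh(t/2)$; so $(G_2,G_4,G_6,G_8,\ldots)=(1,1,3,17,\ldots)$. *)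

theory Defs
  imports "HOL-Computational_Algebra.Computational_Algebra"
begin

section \<open>The coefficient ring\<close>

text \<open>The subring \<open>\<int>[1/2]\<close> of the rationals.\<close>

definition dyadic :: "rat set" where
  "dyadic = {of_int a / 2 ^ k | a k. True}"

lemma dyadicI: "q = of_int a / 2 ^ k \<Longrightarrow> q \<in> dyadic"
  unfolding dyadic_def by blast

lemma dyadic_of_int [simp, intro]: "of_int a \<in> dyadic"
  by (rule dyadicI[of _ a 0]) simp

lemma dyadic_0 [simp, intro]: "0 \<in> dyadic" and dyadic_1 [simp, intro]: "1 \<in> dyadic"
  using dyadic_of_int[of 0] dyadic_of_int[of 1] by simp_all

lemma dyadic_half [simp, intro]: "1 / 2 \<in> dyadic"
  by (rule dyadicI[of _ 1 1]) simp

lemma dyadic_add [intro]: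
  assumes "p \<in> dyadic" "q \<in> dyadic" shows "p + q \<in> dyadic"
proof -
  obtain a k b l where "p = of_int a / 2 ^ k" "q = of_int b / 2 ^ l"
    using assms unfolding dyadic_def by blast
  then have "p + q = of_int (a * 2 ^ l + b * 2 ^ k) / 2 ^ (k + l)"
    by (simp add: add_divide_distrib power_add)
  then show ?thesis by (rule dyadicI)
qed

lemma dyadic_mult [intro]:
  assumes "p \<in> dyadic" "q \<in> dyadic" shows "p * q \<in> dyadic"
proof -
  obtain a k b l where "p = of_int a / 2 ^ k" "q = of_int b / 2 ^ l"
    using assms unfolding dyadic_def by blast
  then have "p * q = of_int (a * b) / 2 ^ (k + l)"
    by (simp add: power_add)
  then show ?thesis by (rule dyadicI)
qed

lemma dyadic_uminus [intro]: "p \<in> dyadic \<Longrightarrow> - p \<in> dyadic"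
  using dyadic_mult[OF dyadic_of_int[of "-1"]] by simp

lemma dyadic_diff [intro]: "p \<in> dyadic \<Longrightarrow> q \<in> dyadic \<Longrightarrow> p - q \<in> dyadic"
  using dyadic_add[of p "- q"] by auto

lemma dyadic_sum: "(\<And>i. i \<in> A \<Longrightarrow> f i \<in> dyadic) \<Longrightarrow> sum f A \<in> dyadic"
  by (induction A rule: infinite_finite_induct) auto

typedef jring = "{f :: rat poly. \<forall>n::int. poly f (of_int n) \<in> dyadic}"
  by (rule exI[of _ 0]) simp

setup_lifting type_definition_jring

instantiation jring :: comm_ring_1
begin

lift_definition zero_jring :: jring is 0 by simp
lift_definition one_jring :: jring is 1 by simp
lift_definition plus_jring :: "jring \<Rightarrow> jring \<Rightarrow> jring" is "(+)" by auto
lift_definition minus_jring :: "jring \<Rightarrow> jring \<Rightarrow> jring" is "(-)" by auto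
lift_definition uminus_jring :: "jring \<Rightarrow> jring" is uminus by auto
lift_definition times_jring :: "jring \<Rightarrow> jring \<Rightarrow> jring" is "(*)" by auto

instance
  by standard (transfer; simp add: algebra_simps)+

end

lift_definition half :: jring is "[:1 / 2:] :: rat poly" by simp

text \<open>\<open>xbinom c k\<close> is the binomial coefficient \<open>x + c\<close> over \<open>k\<close>, a polynomial in \<open>x\<close>.\<close>

lemma xbinom_integer_valued:
  "poly (smult (1 / fact k) (\<Prod>i<k. [:of_int c - of_nat i, 1:])) (of_int n :: rat) \<in> dyadic"
proof -
  have "poly (smult (1 / fact k) (\<Prod>i<k. [:of_int c - of_nat i, 1:])) (of_int n :: rat)
      = of_int (c + n) gchoose k"
    by (simp add: gbinomial_prod_rev poly_prod atLeast0LessThan algebra_simps)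
  then show ?thesis
    by (simp only: of_int_gbinomial[symmetric] dyadic_of_int)
qed

lift_definition xbinom :: "int \<Rightarrow> nat \<Rightarrow> jring"
  is "\<lambda>c k. smult (1 / fact k) (\<Prod>i<k. [:of_int c - of_nat i, 1:])"
  by (simp only: xbinom_integer_valued simp_thms)


section \<open>Genocchi numbers\<close>

text \<open>The power series of \<open>tanh (t / 2)\<close>.\<close>

definition tanh_half :: "rat fps" where
  "tanh_half = (fps_exp (1/2) - fps_exp (-1/2)) / (fps_exp (1/2) + fps_exp (-1/2))"

text \<open>
  For even \<open>n > 0\<close>, \<open>genocchi n\<close> is the unsigned Genocchi number \<open>G\<^sub>n\<close>. The rounding has no effect:
  the argument of floor is an integer, and the lemma \<open>genocchi_generating_function\<close> below is the
  defining identity.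
\<close>

definition genocchi :: "nat \<Rightarrow> int" where
  "genocchi n = \<lfloor>(-1) ^ (n div 2) * fact n * fps_nth (- fps_X * tanh_half) n\<rfloor>"

lemma tanh_half_deriv: "fps_deriv tanh_half = fps_const (1/2) * (1 - tanh_half ^ 2)"
proof -
  let ?C = "fps_exp (1/2) + fps_exp (-1/2) :: rat fps"
  let ?S = "fps_exp (1/2) - fps_exp (-1/2) :: rat fps"
  have C0: "fps_nth ?C 0 \<noteq> 0" by simp
  then have nz: "?C \<noteq> 0" and sd: "subdegree ?C = 0" by (metis fps_zero_nth) simp
  have TC: "tanh_half * ?C = ?S"
    unfolding tanh_half_def using nz sd by (intro fps_times_divide_eq) simp_all
  have m: "fps_const (-1/2) = - fps_const (1/2 :: rat)" by simp
  have dC: "fps_deriv ?C = fps_const (1/2) * ?S" and dS: "fps_deriv ?S = fps_const (1/2) * ?C"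
    by (simp_all only: fps_deriv_add fps_deriv_sub fps_exp_deriv m) (simp_all only: algebra_simps minus_mult_right[symmetric] mult.commute[of "fps_exp (-1/2)"] add.right_inverse add_0_left add_0_right)
  have "fps_deriv tanh_half * ?C + tanh_half * fps_deriv ?C = fps_deriv ?S"
    using arg_cong[OF TC, of fps_deriv] by (simp only: fps_deriv_mult add.commute mult.commute)
  then have "fps_deriv tanh_half * ?C
      = fps_const (1/2) * ?C - tanh_half * (fps_const (1/2) * (tanh_half * ?C))"
    unfolding dC dS TC by (simp add: eq_diff_eq)
  also have "\<dots> = (fps_const (1/2) * (1 - tanh_half ^ 2)) * ?C"
    by (simp only: power2_eq_square) (simp only: algebra_simps mult_1_left)
  finally show ?thesis using nz by (metis mult_right_cancel)
qed

lemma tanh_half_0: "fps_nth tanh_half 0 = 0"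
proof -
  let ?C = "fps_exp (1/2) + fps_exp (-1/2) :: rat fps"
  have "subdegree ?C = 0" by simp
  then show ?thesis
    unfolding tanh_half_def by (simp add: fps_divide_unit)
qed

lemma tanh_half_Suc:
  "of_nat (Suc n) * fps_nth tanh_half (Suc n)
    = 1/2 * ((if n = 0 then 1 else 0) - (\<Sum>i\<le>n. fps_nth tanh_half i * fps_nth tanh_half (n - i)))"
  using arg_cong[OF tanh_half_deriv, of "\<lambda>f. fps_nth f n"]
  by (simp add: power2_eq_square fps_mult_nth[of tanh_half tanh_half] atLeast0AtMost del: of_nat_Suc)

lemma tanh_half_even: "even n \<Longrightarrow> fps_nth tanh_half n = 0"
proof (induction n rule: less_induct)
  case (less n)
  show ?case
  proof (cases n)
    case 0 then show ?thesis by (simp add: tanh_half_0)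
  next
    case (Suc k)
    have "fps_nth tanh_half i * fps_nth tanh_half (k - i) = 0" if "i \<le> k" for i
      using less.IH[of i] less.IH[of "k - i"] less.prems that Suc by (cases "even i") auto
    then have "(\<Sum>i\<le>k. fps_nth tanh_half i * fps_nth tanh_half (k - i)) = 0"
      by (intro sum.neutral) auto
    moreover have "k \<noteq> 0" using less.prems Suc by (cases k) auto
    ultimately have "of_nat (Suc k) * fps_nth tanh_half (Suc k) = 0"
      by (simp only: tanh_half_Suc) simp
    then show ?thesis by (simp add: Suc del: of_nat_Suc)
  qed
qed

lemma fact_mult_sum:
  "fact n * (\<Sum>i\<le>n. f i * f (n - i)) = (\<Sum>i\<le>n. of_nat (n choose i) * (fact i * f i) * (fact (n - i) * f (n - i)))"
  for f :: "nat \<Rightarrow> rat"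
  unfolding sum_distrib_left
proof (rule sum.cong)
  fix i assume "i \<in> {..n}"
  then have "fact i * fact (n - i) * (n choose i) = fact n"
    by (intro binomial_fact_lemma) simp
  then have "(fact n :: rat) = of_nat (fact i * fact (n - i) * (n choose i))"
    by (metis of_nat_fact)
  then have "(fact n :: rat) = fact i * fact (n - i) * of_nat (n choose i)"
    by simp
  then show "fact n * (f i * f (n - i)) = of_nat (n choose i) * (fact i * f i) * (fact (n - i) * f (n - i))"
    by (simp only: mult.assoc mult.left_commute mult.commute)
qed simp

lemma dyadic_of_nat: "of_nat n \<in> dyadic"
  using dyadic_of_int[of "int n"] by simp

lemma tanh_half_dyadic: "fact n * fps_nth tanh_half n \<in> dyadic"
proof (induction n rule: less_induct)
  case (less n)
  show ?case
  proof (cases n)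
    case 0 then show ?thesis by (simp add: tanh_half_0)
  next
    case (Suc k)
    have "fact n * fps_nth tanh_half n = fact k * (of_nat (Suc k) * fps_nth tanh_half (Suc k))"
      by (simp add: Suc)
    also have "\<dots> = 1/2 * ((if k = 0 then 1 else 0) - fact k * (\<Sum>i\<le>k. fps_nth tanh_half i * fps_nth tanh_half (k - i)))"
      unfolding tanh_half_Suc by (auto simp: algebra_simps)
    also have "\<dots> \<in> dyadic"
    proof -
      have "of_nat (k choose i) * (fact i * fps_nth tanh_half i)
          * (fact (k - i) * fps_nth tanh_half (k - i)) \<in> dyadic" if "i \<le> k" for i
        using that Suc by (intro dyadic_mult[OF dyadic_mult] less.IH dyadic_of_nat) auto
      then show ?thesis
        unfolding fact_mult_sum by (intro dyadic_mult[OF dyadic_half] dyadic_diff dyadic_sum) auto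
    qed
    finally show ?thesis .
  qed
qed

lemma tanh_half_X:
  "fps_X * fps_deriv (fps_X * tanh_half)
    = fps_X * tanh_half + fps_const (1/2) * (fps_X ^ 2 - (fps_X * tanh_half) ^ 2)"
proof -
  have "fps_X * fps_deriv (fps_X * tanh_half)
      = fps_X * (fps_X * (fps_const (1/2) * (1 - tanh_half ^ 2)) + tanh_half)"
    by (simp only: fps_deriv_mult fps_deriv_fps_X tanh_half_deriv mult_1_left)
  also have "\<dots> = fps_X * tanh_half + fps_const (1/2) * (fps_X ^ 2 - (fps_X * tanh_half) ^ 2)"
    unfolding power2_eq_square by (simp only: algebra_simps mult_1_left)
  finally show ?thesis .
qed

lemma even_symmetric_sum:
  fixes f :: "nat \<Rightarrow> int"
  assumes sym: "\<And>i. i \<le> 2 * p \<Longrightarrow> f (2 * p - i) = f i" and mid: "even (f p)"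
  shows "even (\<Sum>i\<le>2 * p. f i)"
proof -
  have "{..2 * p} = {..<p} \<union> {p} \<union> {p<..2 * p}" by auto
  then have "(\<Sum>i\<le>2 * p. f i) = (\<Sum>i<p. f i) + f p + (\<Sum>i\<in>{p<..2 * p}. f i)"
    by (simp add: sum.union_disjoint disjoint_iff)
  also have "(\<Sum>i\<in>{p<..2 * p}. f i) = (\<Sum>i<p. f i)"
    by (rule sum.reindex_bij_witness[of _ "\<lambda>i. 2 * p - i" "\<lambda>i. 2 * p - i"]) (auto simp: sym)
  finally show ?thesis using mid by simp
qed

lemma odd_mult_dyadic:
  assumes "h \<in> dyadic" "of_nat m * h = of_int z" "odd m"
  shows "\<exists>a. h = of_int a"
proof -
  obtain a k where h: "h = of_int a / 2 ^ k"
    using assms unfolding dyadic_def by blast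
  then have "of_int (int m * a) = (of_int (z * 2 ^ k) :: rat)"
    using arg_cong[OF assms(2), of "\<lambda>q. q * 2 ^ k"] by (simp add: mult.commute)
  then have "int m * a = z * 2 ^ k" by (simp only: of_int_eq_iff)
  then have "2 ^ k dvd int m * a" by simp
  moreover have "coprime (2 ^ k) (int m)" using assms(3) by simp
  ultimately have "2 ^ k dvd a" by (simp add: coprime_dvd_mult_right_iff)
  then obtain b where "a = 2 ^ k * b" by (elim dvdE)
  then show ?thesis using h by (intro exI[of _ b]) simp
qed

lemma genocchi_integral: "\<exists>a. fact n * fps_nth (fps_X * tanh_half) n = of_int a"
proof (induction n rule: less_induct)
  case (less n)
  define h where "h i = fact i * fps_nth (fps_X * tanh_half) i" for i
  consider "n = 0" | "odd n" | "even n" "n > 0" by blast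
  then show ?case
  proof cases
    case 1 then show ?thesis by (intro exI[of _ 0]) simp
  next
    case 2 then show ?thesis by (intro exI[of _ 0]) (simp add: tanh_half_even)
  next
    case 3
    then obtain p where p: "n = 2 * p" "p > 0" by auto
    have "\<forall>i. \<exists>a. i < n \<longrightarrow> h i = of_int a" using less.IH by (auto simp: h_def)
    then obtain a where a: "h i = of_int (a i)" if "i < n" for i by metis
    define b where "b i = (if i = 0 \<or> i = n then 0 else a i)" for i
    define f where "f i = int (n choose i) * b i * b (n - i)" for i
    have h0: "h 0 = 0" by (simp add: h_def)
    have "of_nat n * fps_nth (fps_X * tanh_half) n
        = fps_nth (fps_X * tanh_half) n + 1/2 * ((if n = 2 then 1 else 0)
          - (\<Sum>i\<le>n. fps_nth (fps_X * tanh_half) i * fps_nth (fps_X * tanh_half) (n - i)))"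
    proof -
      define H where "H = fps_X * tanh_half"
      have "fps_nth (fps_X * fps_deriv H) n = fps_nth (H + fps_const (1/2) * (fps_X ^ 2 - H * H)) n"
        using tanh_half_X by (simp only: H_def power2_eq_square)
      moreover have "fps_nth (fps_X * fps_deriv H) n = of_nat n * fps_nth H n"
        using p by (simp del: of_nat_Suc)
      moreover have "fps_nth (H + fps_const (1/2) * (fps_X ^ 2 - H * H)) n
        = fps_nth H n + 1/2 * ((if n = 2 then 1 else 0) - (\<Sum>i\<le>n. fps_nth H i * fps_nth H (n - i)))"
        by (simp add: fps_mult_nth[of H H] fps_X_power_nth atLeast0AtMost)
      ultimately show ?thesis by (simp only: H_def)
    qed
    then have "fact n * (of_nat n * fps_nth (fps_X * tanh_half) n) =
        fact n * (fps_nth (fps_X * tanh_half) n + 1/2 * ((if n = 2 then 1 else 0)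
          - (\<Sum>i\<le>n. fps_nth (fps_X * tanh_half) i * fps_nth (fps_X * tanh_half) (n - i))))"
      by simp
    also have "\<dots> = h n + 1/2 * ((if n = 2 then 2 else 0)
        - fact n * (\<Sum>i\<le>n. fps_nth (fps_X * tanh_half) i * fps_nth (fps_X * tanh_half) (n - i)))"
      unfolding h_def by (auto simp: algebra_simps fact_numeral)
    also have "fact n * (\<Sum>i\<le>n. fps_nth (fps_X * tanh_half) i * fps_nth (fps_X * tanh_half) (n - i))
        = (\<Sum>i\<le>n. of_nat (n choose i) * h i * h (n - i))"
      unfolding h_def by (rule fact_mult_sum)
    also have "\<dots> = of_int (\<Sum>i\<le>n. f i)"
      unfolding of_int_sum
    proof (rule sum.cong)
      fix i assume "i \<in> {..n}"
      then show "of_nat (n choose i) * h i * h (n - i) = of_int (f i)"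
        using h0 a[of i] a[of "n - i"] by (cases "i = 0 \<or> i = n") (auto simp: f_def b_def)
    qed simp
    finally have eq: "of_nat n * h n = h n + 1/2 * ((if n = 2 then 2 else 0) - of_int (\<Sum>i\<le>n. f i))"
      by (simp add: h_def algebra_simps)
    have "even (n choose p)"
    proof -
      obtain q where q: "p = Suc q" using p by (cases p) auto
      have "(2 * p) choose p = ((2 * q + 1) choose q) + ((2 * q + 1) choose (Suc q))"
        by (simp add: q)
      moreover have "(2 * q + 1) choose (Suc q) = (2 * q + 1) choose q"
        using binomial_symmetric[of q "2 * q + 1"] by simp
      ultimately show ?thesis using p by simp
    qed
    then have "even (f p)" by (simp add: f_def)
    moreover have "f (2 * p - i) = f i" if "i \<le> 2 * p" for i
      using that binomial_symmetric[of i n] by (simp add: f_def p)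
    ultimately have "even (\<Sum>i\<le>n. f i)" unfolding p by (intro even_symmetric_sum)
    then obtain z where z: "(\<Sum>i\<le>n. f i) = 2 * z" by blast
    have "of_nat (n - 1) * h n = of_int ((if n = 2 then 1 else 0) - z)"
      using eq 3 unfolding z by (auto simp: of_nat_diff algebra_simps)
    moreover have "h n \<in> dyadic"
    proof -
      have "h n = of_nat n * (fact (n - 1) * fps_nth tanh_half (n - 1))"
        using 3 by (simp add: h_def fact_reduce)
      then show ?thesis using dyadic_mult[OF dyadic_of_nat tanh_half_dyadic] by simp
    qed
    moreover have "odd (n - 1)" using 3 by simp
    ultimately have "\<exists>a. h n = of_int a" by (intro odd_mult_dyadic)
    then show ?thesis by (simp only: h_def)
  qed
qed

lemma genocchi_generating_function:
  "Abs_fps (\<lambda>n. if n > 0 \<and> even n then (-1) ^ (n div 2) * of_int (genocchi n) / fact n else 0)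
    = - fps_X * tanh_half"
proof (rule fps_ext)
  fix n
  obtain a where a: "fact n * fps_nth (fps_X * tanh_half) n = of_int a"
    using genocchi_integral by blast
  have "(-1) ^ (n div 2) * fact n * fps_nth (- fps_X * tanh_half) n
      = of_int ((-1) ^ (n div 2) * - a)"
    using a by (simp add: mult.assoc)
  then have g: "genocchi n = (-1) ^ (n div 2) * - a"
    unfolding genocchi_def by (simp only: floor_of_int)
  have "(-1) ^ (n div 2) * of_int (genocchi n) = - (of_int a :: rat)"
    unfolding g by (simp flip: power_add mult.assoc)
  moreover have "- (of_int a) / fact n = fps_nth (- fps_X * tanh_half) n"
    using a[symmetric] by simp
  moreover have "fps_nth (- fps_X * tanh_half) n = 0" if "n = 0 \<or> odd n"
    using that by (auto simp: tanh_half_even)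
  ultimately show "fps_nth (Abs_fps (\<lambda>n. if n > 0 \<and> even n
      then (-1) ^ (n div 2) * of_int (genocchi n) / fact n else 0)) n
    = fps_nth (- fps_X * tanh_half) n"
    by auto
qed


section \<open>The affine B-web category\<close>

text \<open>
  The category is presented by generators and relations. An object is a word in the positive
  integers, so \<open>[]\<close> is the unit object and concatenation is the tensor product of objects.
  Morphisms are equivalence classes of formal expressions in the generators, the identities, and the
  operations of a linear monoidal category. The product \<open>f \<cdot> g\<close> means \<open>f\<close> after \<open>g\<close>.
\<close>

datatype web =
    Ident "nat list"
  | Merge nat nat | Split nat nat | Cross nat nat | Cup nat | Cap nat | Dot nat
  | Comp web web  (infixr \<open>\<cdot>\<close> 65)
  | Tens web web  (infixr \<open>\<otimes>\<close> 70)
  | Zero "nat list" "nat list"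
  | Add web web
  | Scale jring web

primrec src :: "web \<Rightarrow> nat list" where
  "src (Ident X) = X"
| "src (Merge a b) = [a, b]"
| "src (Split a b) = [a + b]"
| "src (Cross a b) = [a, b]"
| "src (Cup a) = []"
| "src (Cap a) = [a, a]"
| "src (Dot a) = [a]"
| "src (f \<cdot> g) = src g"
| "src (f \<otimes> g) = src f @ src g"
| "src (Zero X Y) = X"
| "src (Add f g) = src f"
| "src (Scale r f) = src f"

primrec tgt :: "web \<Rightarrow> nat list" where
  "tgt (Ident X) = X"
| "tgt (Merge a b) = [a + b]"
| "tgt (Split a b) = [a, b]"
| "tgt (Cross a b) = [b, a]"
| "tgt (Cup a) = [a, a]"
| "tgt (Cap a) = []"
| "tgt (Dot a) = [a]"
| "tgt (f \<cdot> g) = tgt f"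
| "tgt (f \<otimes> g) = tgt f @ tgt g"
| "tgt (Zero X Y) = Y"
| "tgt (Add f g) = tgt f"
| "tgt (Scale r f) = tgt f"

primrec wf_web :: "web \<Rightarrow> bool" where
  "wf_web (Ident X) \<longleftrightarrow> 0 \<notin> set X"
| "wf_web (Merge a b) \<longleftrightarrow> a > 0 \<and> b > 0"
| "wf_web (Split a b) \<longleftrightarrow> a > 0 \<and> b > 0"
| "wf_web (Cross a b) \<longleftrightarrow> a > 0 \<and> b > 0"
| "wf_web (Cup a) \<longleftrightarrow> a > 0"
| "wf_web (Cap a) \<longleftrightarrow> a > 0"
| "wf_web (Dot a) \<longleftrightarrow> a > 0"
| "wf_web (f \<cdot> g) \<longleftrightarrow> wf_web f \<and> wf_web g \<and> src f = tgt g"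
| "wf_web (f \<otimes> g) \<longleftrightarrow> wf_web f \<and> wf_web g"
| "wf_web (Zero X Y) \<longleftrightarrow> 0 \<notin> set X \<and> 0 \<notin> set Y"
| "wf_web (Add f g) \<longleftrightarrow> wf_web f \<and> wf_web g \<and> src f = src g \<and> tgt f = tgt g"
| "wf_web (Scale r f) \<longleftrightarrow> wf_web f"

text \<open>
  Variants of the generators for labels in \<open>\<nat>\<close>, following the convention that strands of
  thickness \<open>0\<close> are omitted.
\<close>

definition strand :: "nat \<Rightarrow> nat list" where
  "strand a = (if a = 0 then [] else [a])"

definition idn :: "nat \<Rightarrow> web" where
  "idn a = Ident (strand a)"

definition mrg :: "nat \<Rightarrow> nat \<Rightarrow> web" where
  "mrg a b = (if a = 0 \<or> b = 0 then idn (a + b) else Merge a b)"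

definition spl :: "nat \<Rightarrow> nat \<Rightarrow> web" where
  "spl a b = (if a = 0 \<or> b = 0 then idn (a + b) else Split a b)"

definition crs :: "nat \<Rightarrow> nat \<Rightarrow> web" where
  "crs a b = (if a = 0 \<or> b = 0 then idn (a + b) else Cross a b)"

definition cup :: "nat \<Rightarrow> web" where
  "cup a = (if a = 0 then Ident [] else Cup a)"

definition cap :: "nat \<Rightarrow> web" where
  "cap a = (if a = 0 then Ident [] else Cap a)"

definition dot :: "nat \<Rightarrow> web" where
  "dot a = (if a = 0 then Ident [] else Dot a)"

text \<open>The lollipops of thickness \<open>2 * s\<close>.\<close>

definition lol :: "nat \<Rightarrow> web" where
  "lol s = Scale (half ^ s) (cap s \<cdot> (dot s \<otimes> idn s) \<cdot> spl s s)"

definition colol :: "nat \<Rightarrow> web" where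
  "colol s = Scale (half ^ s) (mrg s s \<cdot> (dot s \<otimes> idn s) \<cdot> cup s)"

text \<open>\<open>web_sum X Y fs\<close> is the sum of the list \<open>fs\<close> of morphisms from \<open>X\<close> to \<open>Y\<close>.\<close>

definition web_sum :: "nat list \<Rightarrow> nat list \<Rightarrow> web list \<Rightarrow> web" where
  "web_sum X Y fs = foldr Add fs (Zero X Y)"

text \<open>The defining relations. All labels \<open>a, b, c, d\<close> are positive.\<close>

inductive bweb_rel :: "web \<Rightarrow> web \<Rightarrow> bool" where
  merge_assoc: "\<lbrakk>a > 0; b > 0; c > 0\<rbrakk> \<Longrightarrow>
    bweb_rel (mrg (a + b) c \<cdot> (mrg a b \<otimes> idn c)) (mrg a (b + c) \<cdot> (idn a \<otimes> mrg b c))"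
| split_coassoc: "\<lbrakk>a > 0; b > 0; c > 0\<rbrakk> \<Longrightarrow>
    bweb_rel ((spl a b \<otimes> idn c) \<cdot> spl (a + b) c) ((idn a \<otimes> spl b c) \<cdot> spl a (b + c))"
| merge_split: "\<lbrakk>a > 0; b > 0\<rbrakk> \<Longrightarrow>
    bweb_rel (mrg a b \<cdot> spl a b) (Scale (of_nat ((a + b) choose a)) (idn (a + b)))"
| split_merge: "\<lbrakk>a > 0; b > 0; c > 0; d > 0; a + c = b + d\<rbrakk> \<Longrightarrow>
    bweb_rel (spl b d \<cdot> mrg a c)
      (web_sum [a, c] [b, d]
        [(mrg s (c - t) \<otimes> mrg (a - s) t) \<cdot> (idn s \<otimes> crs (a - s) (c - t) \<otimes> idn t)
            \<cdot> (spl s (a - s) \<otimes> spl (c - t) t).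
          s \<leftarrow> [0..<Suc (min a b)], t \<leftarrow> [0..<Suc (min c d)], int t - int s = int d - int a])"
| zigzag_left: "a > 0 \<Longrightarrow> bweb_rel ((cap a \<otimes> idn a) \<cdot> (idn a \<otimes> cup a)) (idn a)"
| zigzag_right: "a > 0 \<Longrightarrow> bweb_rel ((idn a \<otimes> cap a) \<cdot> (cup a \<otimes> idn a)) (idn a)"
| cap_slide: "\<lbrakk>a > 0; b > 0\<rbrakk> \<Longrightarrow>
    bweb_rel ((cap a \<otimes> idn b) \<cdot> (idn a \<otimes> crs b a)) ((idn b \<otimes> cap a) \<cdot> (crs a b \<otimes> idn a))"
| cup_slide: "\<lbrakk>a > 0; b > 0\<rbrakk> \<Longrightarrow>
    bweb_rel ((crs b a \<otimes> idn a) \<cdot> (idn b \<otimes> cup a)) ((idn a \<otimes> crs a b) \<cdot> (cup a \<otimes> idn b))"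
| cap_split_left: "\<lbrakk>a > 0; b > 0\<rbrakk> \<Longrightarrow>
    bweb_rel (cap b \<cdot> (idn b \<otimes> cap a \<otimes> idn b) \<cdot> (spl b a \<otimes> idn a \<otimes> idn b))
      (cap (a + b) \<cdot> (idn (a + b) \<otimes> mrg a b))"
| cap_split_right: "\<lbrakk>a > 0; b > 0\<rbrakk> \<Longrightarrow>
    bweb_rel (cap a \<cdot> (idn a \<otimes> cap b \<otimes> idn a) \<cdot> (idn a \<otimes> idn b \<otimes> spl b a))
      (cap (a + b) \<cdot> (mrg a b \<otimes> idn (a + b)))"
| circle: "a > 0 \<Longrightarrow> bweb_rel (cap a \<cdot> cup a) (Scale (xbinom 0 a) (Ident []))"
| cap_split: "a > 0 \<Longrightarrow> bweb_rel (cap a \<cdot> spl a a) (Zero [2 * a] [])"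
| cap_cross: "a > 0 \<Longrightarrow> bweb_rel (cap a \<cdot> crs a a) (Scale ((-1) ^ a) (cap a))"
| dot_cross: "\<lbrakk>a > 0; b > 0\<rbrakk> \<Longrightarrow>
    bweb_rel
      (web_sum [a, b] [b, a]
        [Scale (of_nat (fact t))
          ((mrg (b - t) t \<otimes> mrg t (a - t)) \<cdot> (idn (b - t) \<otimes> cup t \<otimes> idn (a - t))
            \<cdot> (dot (b - t) \<otimes> idn (a - t)) \<cdot> crs (a - t) (b - t)
            \<cdot> (idn (a - t) \<otimes> cap t \<otimes> idn (b - t)) \<cdot> (spl (a - t) t \<otimes> spl t (b - t))).
          t \<leftarrow> [0..<Suc (min a b)]])
      (web_sum [a, b] [b, a]
        [Scale (of_nat (fact t))
          ((mrg t (b - t) \<otimes> mrg (a - t) t) \<cdot> (idn t \<otimes> crs (a - t) (b - t) \<otimes> idn t)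
            \<cdot> (idn t \<otimes> idn (a - t) \<otimes> dot (b - t) \<otimes> idn t) \<cdot> (spl t (a - t) \<otimes> spl (b - t) t)).
          t \<leftarrow> [0..<Suc (min a b)]])"
| split_dot: "\<lbrakk>a > 0; b > 0\<rbrakk> \<Longrightarrow>
    bweb_rel (spl a b \<cdot> dot (a + b))
      (web_sum [a + b] [a, b]
        [Scale (of_nat (fact s))
          ((mrg (a - s) s \<otimes> mrg s (b - s)) \<cdot> (idn (a - s) \<otimes> cup s \<otimes> idn (b - s))
            \<cdot> (dot (a - s) \<otimes> dot (b - s)) \<cdot> spl (a - s) (b - s)
            \<cdot> (lol s \<otimes> idn (a + b - 2 * s)) \<cdot> spl (2 * s) (a + b - 2 * s)).
          s \<leftarrow> [0..<Suc (min a b)]])"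
| dot_merge: "\<lbrakk>a > 0; b > 0\<rbrakk> \<Longrightarrow>
    bweb_rel (dot (a + b) \<cdot> mrg a b)
      (web_sum [a, b] [a + b]
        [Scale (of_nat (fact s))
          (mrg (2 * s) (a + b - 2 * s) \<cdot> (colol s \<otimes> idn (a + b - 2 * s))
            \<cdot> mrg (a - s) (b - s) \<cdot> (dot (a - s) \<otimes> dot (b - s))
            \<cdot> (idn (a - s) \<otimes> cap s \<otimes> idn (b - s)) \<cdot> (spl (a - s) s \<otimes> spl s (b - s))).
          s \<leftarrow> [0..<Suc (min a b)]])"
| cap_dot: "a > 0 \<Longrightarrow>
    bweb_rel (cap a \<cdot> (dot a \<otimes> idn a)) (Scale ((-1) ^ a) (cap a \<cdot> (idn a \<otimes> dot a)))"
| cup_dot: "a > 0 \<Longrightarrow>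
    bweb_rel ((dot a \<otimes> idn a) \<cdot> cup a) (Scale ((-1) ^ a) ((idn a \<otimes> dot a) \<cdot> cup a))"

text \<open>
  Equality of morphisms: the congruence generated by the axioms of a strict linear monoidal category
  and the defining relations.
\<close>

inductive web_eq :: "web \<Rightarrow> web \<Rightarrow> bool"  (infix \<open>\<approx>\<close> 50) where
  refl: "wf_web f \<Longrightarrow> f \<approx> f"
| sym: "f \<approx> g \<Longrightarrow> g \<approx> f"
| trans: "f \<approx> g \<Longrightarrow> g \<approx> h \<Longrightarrow> f \<approx> h"
| comp_cong: "f \<approx> f' \<Longrightarrow> g \<approx> g' \<Longrightarrow> src f = tgt g \<Longrightarrow> f \<cdot> g \<approx> f' \<cdot> g'"
| tens_cong: "f \<approx> f' \<Longrightarrow> g \<approx> g' \<Longrightarrow> f \<otimes> g \<approx> f' \<otimes> g'"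
| add_cong: "f \<approx> f' \<Longrightarrow> g \<approx> g' \<Longrightarrow> src f = src g \<Longrightarrow> tgt f = tgt g \<Longrightarrow> Add f g \<approx> Add f' g'"
| scale_cong: "f \<approx> f' \<Longrightarrow> Scale r f \<approx> Scale r f'"
| comp_assoc: "wf_web ((f \<cdot> g) \<cdot> h) \<Longrightarrow> (f \<cdot> g) \<cdot> h \<approx> f \<cdot> (g \<cdot> h)"
| comp_id_left: "wf_web f \<Longrightarrow> Ident (tgt f) \<cdot> f \<approx> f"
| comp_id_right: "wf_web f \<Longrightarrow> f \<cdot> Ident (src f) \<approx> f"
| tens_assoc: "wf_web ((f \<otimes> g) \<otimes> h) \<Longrightarrow> (f \<otimes> g) \<otimes> h \<approx> f \<otimes> (g \<otimes> h)"
| tens_unit_left: "wf_web f \<Longrightarrow> Ident [] \<otimes> f \<approx> f"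
| tens_unit_right: "wf_web f \<Longrightarrow> f \<otimes> Ident [] \<approx> f"
| tens_id: "wf_web (Ident X \<otimes> Ident Y) \<Longrightarrow> Ident X \<otimes> Ident Y \<approx> Ident (X @ Y)"
| interchange: "wf_web ((f \<cdot> g) \<otimes> (f' \<cdot> g')) \<Longrightarrow> (f \<cdot> g) \<otimes> (f' \<cdot> g') \<approx> (f \<otimes> f') \<cdot> (g \<otimes> g')"
| add_assoc: "wf_web (Add (Add f g) h) \<Longrightarrow> Add (Add f g) h \<approx> Add f (Add g h)"
| add_comm: "wf_web (Add f g) \<Longrightarrow> Add f g \<approx> Add g f"
| add_zero: "wf_web f \<Longrightarrow> Add (Zero (src f) (tgt f)) f \<approx> f"
| add_inverse: "wf_web f \<Longrightarrow> Add (Scale (-1) f) f \<approx> Zero (src f) (tgt f)"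
| scale_one: "wf_web f \<Longrightarrow> Scale 1 f \<approx> f"
| scale_scale: "wf_web f \<Longrightarrow> Scale r (Scale r' f) \<approx> Scale (r * r') f"
| scale_add: "wf_web (Add f g) \<Longrightarrow> Scale r (Add f g) \<approx> Add (Scale r f) (Scale r g)"
| add_scale: "wf_web f \<Longrightarrow> Scale (r + r') f \<approx> Add (Scale r f) (Scale r' f)"
| comp_add_left: "wf_web (Add f g \<cdot> h) \<Longrightarrow> Add f g \<cdot> h \<approx> Add (f \<cdot> h) (g \<cdot> h)"
| comp_add_right: "wf_web (h \<cdot> Add f g) \<Longrightarrow> h \<cdot> Add f g \<approx> Add (h \<cdot> f) (h \<cdot> g)"
| comp_scale_left: "wf_web (Scale r f \<cdot> g) \<Longrightarrow> Scale r f \<cdot> g \<approx> Scale r (f \<cdot> g)"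
| comp_scale_right: "wf_web (f \<cdot> Scale r g) \<Longrightarrow> f \<cdot> Scale r g \<approx> Scale r (f \<cdot> g)"
| tens_add_left: "wf_web (Add f g \<otimes> h) \<Longrightarrow> Add f g \<otimes> h \<approx> Add (f \<otimes> h) (g \<otimes> h)"
| tens_add_right: "wf_web (h \<otimes> Add f g) \<Longrightarrow> h \<otimes> Add f g \<approx> Add (h \<otimes> f) (h \<otimes> g)"
| tens_scale_left: "wf_web (Scale r f \<otimes> g) \<Longrightarrow> Scale r f \<otimes> g \<approx> Scale r (f \<otimes> g)"
| tens_scale_right: "wf_web (f \<otimes> Scale r g) \<Longrightarrow> f \<otimes> Scale r g \<approx> Scale r (f \<otimes> g)"
| rel: "bweb_rel f g \<Longrightarrow> f \<approx> g"

lemmas small_web_defs = strand_def idn_def mrg_def spl_def crs_def cup_def cap_def dot_def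

lemma strand_pos: "a > 0 \<Longrightarrow> strand a = [a]"
  by (simp add: strand_def)

lemma src_small [simp]:
  "src (idn a) = strand a" "src (mrg a b) = strand a @ strand b" "src (spl a b) = strand (a + b)"
  "src (crs a b) = strand a @ strand b" "src (cup a) = []" "src (cap a) = strand a @ strand a"
  "src (dot a) = strand a"
  by (auto simp: small_web_defs)

lemma tgt_small [simp]:
  "tgt (idn a) = strand a" "tgt (mrg a b) = strand (a + b)" "tgt (spl a b) = strand a @ strand b"
  "tgt (crs a b) = strand b @ strand a" "tgt (cup a) = strand a @ strand a" "tgt (cap a) = []"
  "tgt (dot a) = strand a"
  by (auto simp: small_web_defs)

lemma wf_small [simp]:
  "wf_web (idn a)" "wf_web (mrg a b)" "wf_web (spl a b)" "wf_web (crs a b)"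
  "wf_web (cup a)" "wf_web (cap a)" "wf_web (dot a)"
  by (auto simp: small_web_defs)

lemma typed_lol [simp]:
  "src (lol s) = strand (2 * s)" "tgt (lol s) = []" "wf_web (lol s)"
  "src (colol s) = []" "tgt (colol s) = strand (2 * s)" "wf_web (colol s)"
  by (simp_all add: lol_def colol_def mult_2)

lemma typed_web_sum:
  assumes "0 \<notin> set X" "0 \<notin> set Y" "\<And>f. f \<in> set fs \<Longrightarrow> wf_web f \<and> src f = X \<and> tgt f = Y"
  shows "wf_web (web_sum X Y fs) \<and> src (web_sum X Y fs) = X \<and> tgt (web_sum X Y fs) = Y"
  using assms(3) by (induction fs) (auto simp: web_sum_def assms(1,2))

lemma typed_web_sum_upt:
  assumes "0 \<notin> set X" "0 \<notin> set Y"
    "\<And>t. t \<le> n \<Longrightarrow> wf_web (f t) \<and> src (f t) = X \<and> tgt (f t) = Y"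
  shows "wf_web (web_sum X Y (map f [0..<Suc n])) \<and> src (web_sum X Y (map f [0..<Suc n])) = X \<and>
    tgt (web_sum X Y (map f [0..<Suc n])) = Y"
proof (rule typed_web_sum[OF assms(1,2)])
  show "wf_web g \<and> src g = X \<and> tgt g = Y" if "g \<in> set (map f [0..<Suc n])" for g
    using that assms(3) by (auto simp: less_Suc_eq_le simp del: upt_Suc)
qed

lemma parallelI:
  "\<lbrakk>wf_web f \<and> src f = X \<and> tgt f = Y; wf_web g \<and> src g = X \<and> tgt g = Y\<rbrakk> \<Longrightarrow>
    wf_web f \<and> wf_web g \<and> src f = src g \<and> tgt f = tgt g"
  by simp

lemma parallel_web_sums:
  assumes "0 \<notin> set X" "0 \<notin> set Y"
    "\<And>t. t \<le> n \<Longrightarrow> wf_web (f t) \<and> src (f t) = X \<and> tgt (f t) = Y"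
    "\<And>t. t \<le> n \<Longrightarrow> wf_web (g t) \<and> src (g t) = X \<and> tgt (g t) = Y"
  shows "wf_web (web_sum X Y (map f [0..<Suc n])) \<and> wf_web (web_sum X Y (map g [0..<Suc n])) \<and>
    src (web_sum X Y (map f [0..<Suc n])) = src (web_sum X Y (map g [0..<Suc n])) \<and>
    tgt (web_sum X Y (map f [0..<Suc n])) = tgt (web_sum X Y (map g [0..<Suc n]))"
  by (rule parallelI[OF typed_web_sum_upt typed_web_sum_upt]) (fact assms)+

lemma parallel_web_sum:
  assumes "0 \<notin> set X" "0 \<notin> set Y" "wf_web h \<and> src h = X \<and> tgt h = Y"
    "\<And>t. t \<le> n \<Longrightarrow> wf_web (f t) \<and> src (f t) = X \<and> tgt (f t) = Y"
  shows "wf_web h \<and> wf_web (web_sum X Y (map f [0..<Suc n])) \<and>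
    src h = src (web_sum X Y (map f [0..<Suc n])) \<and> tgt h = tgt (web_sum X Y (map f [0..<Suc n]))"
  by (rule parallelI[OF assms(3) typed_web_sum_upt]) (fact assms)+

text \<open>Both sides of every defining relation are well-formed and parallel.\<close>

lemma bweb_rel_typed: "bweb_rel f g \<Longrightarrow> wf_web f \<and> wf_web g \<and> src f = src g \<and> tgt f = tgt g"
proof (induction rule: bweb_rel.induct)
  case (split_merge a b c d)
  let ?fs = "[(mrg s (c - t) \<otimes> mrg (a - s) t) \<cdot> (idn s \<otimes> crs (a - s) (c - t) \<otimes> idn t)
            \<cdot> (spl s (a - s) \<otimes> spl (c - t) t).
          s \<leftarrow> [0..<Suc (min a b)], t \<leftarrow> [0..<Suc (min c d)], int t - int s = int d - int a]"
  have fs: "wf_web f \<and> src f = [a, c] \<and> tgt f = [b, d]" if f_in: "f \<in> set ?fs" for f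
  proof -
    obtain s t where f: "f = (mrg s (c - t) \<otimes> mrg (a - s) t) \<cdot> (idn s \<otimes> crs (a - s) (c - t) \<otimes> idn t)
            \<cdot> (spl s (a - s) \<otimes> spl (c - t) t)"
      and st: "s \<le> a" "t \<le> c" "int t - int s = int d - int a"
      using f_in by (auto simp del: upt_Suc)
    have e: "s + (a - s) = a" "c - t + t = c" "s + (c - t) = b" "a - s + t = d"
      using st split_merge by auto
    show ?thesis
      unfolding f using split_merge by (simp add: e strand_pos)
  qed
  have "wf_web (spl b d \<cdot> mrg a c) \<and> src (spl b d \<cdot> mrg a c) = [a, c] \<and>
      tgt (spl b d \<cdot> mrg a c) = [b, d]"
    using split_merge by (simp add: strand_pos)
  moreover have "wf_web (web_sum [a, c] [b, d] ?fs) \<and> src (web_sum [a, c] [b, d] ?fs) = [a, c] \<and>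
      tgt (web_sum [a, c] [b, d] ?fs) = [b, d]"
    by (rule typed_web_sum[OF _ _ fs]) (use split_merge in simp_all)
  ultimately show ?case by (rule parallelI)
next
  case (dot_cross a b)
  have e: "b - t + t = b" "t + (a - t) = a" "a - t + t = a" "t + (b - t) = b" if "t \<le> min a b" for t
    using that by auto
  show ?case
    by (rule parallel_web_sums) (use dot_cross e in \<open>simp_all add: strand_pos\<close>)
next
  case (split_dot a b)
  have e: "b - s + s = b" "s + (b - s) = b" "a - s + s = a" "s + (a - s) = a"
      "a - s + (b - s) = a + b - 2 * s" "2 * s + (a + b - 2 * s) = a + b" if "s \<le> min a b" for s
    using that by auto
  show ?case
    by (rule parallel_web_sum) (use split_dot e in \<open>simp_all add: strand_pos\<close>)
next
  case (dot_merge a b)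
  have e: "b - s + s = b" "s + (b - s) = b" "a - s + s = a" "s + (a - s) = a"
      "a - s + (b - s) = a + b - 2 * s" "2 * s + (a + b - 2 * s) = a + b" if "s \<le> min a b" for s
    using that by auto
  show ?case
    by (rule parallel_web_sum) (use dot_merge e in \<open>simp_all add: strand_pos\<close>)
qed (simp_all add: strand_pos add_ac mult_2)

lemma wf_web_positive: "wf_web f \<Longrightarrow> 0 \<notin> set (src f) \<and> 0 \<notin> set (tgt f)"
  by (induction f) auto

lemma web_eq_typed: "f \<approx> g \<Longrightarrow> wf_web f \<and> wf_web g \<and> src f = src g \<and> tgt f = tgt g"
  by (induction rule: web_eq.induct) (auto dest: bweb_rel_typed wf_web_positive)


section \<open>Endomorphisms of the unit object\<close>

definition endo_eq :: "web \<Rightarrow> web \<Rightarrow> bool" where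
  "endo_eq f g \<longleftrightarrow> f \<approx> g \<and> src f = [] \<and> tgt f = []"

lemma endo_eqD: "endo_eq f g \<Longrightarrow> f \<approx> g \<and> wf_web f \<and> wf_web g \<and>
    src f = [] \<and> tgt f = [] \<and> src g = [] \<and> tgt g = []"
  unfolding endo_eq_def using web_eq_typed by metis

lemma endo_eq_refl: "wf_web f \<Longrightarrow> src f = [] \<Longrightarrow> tgt f = [] \<Longrightarrow> endo_eq f f"
  unfolding endo_eq_def by (intro conjI web_eq.refl)

lemma endo_eq_Add:
  assumes "endo_eq f f'" "endo_eq g g'" shows "endo_eq (Add f g) (Add f' g')"
proof -
  note D = assms[THEN endo_eqD]
  then have "Add f g \<approx> Add f' g'" by (intro web_eq.add_cong) simp_all
  then show ?thesis using D by (simp add: endo_eq_def)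
qed

lemma endo_eq_Scale:
  assumes "endo_eq f f'" shows "endo_eq (Scale r f) (Scale r f')"
proof -
  note D = assms[THEN endo_eqD]
  then have "Scale r f \<approx> Scale r f'" by (intro web_eq.scale_cong) simp
  then show ?thesis using D by (simp add: endo_eq_def)
qed

lemma endo_eq_add_assoc:
  assumes "endo_eq f f" "endo_eq g g" "endo_eq h h"
  shows "endo_eq (Add (Add f g) h) (Add f (Add g h))"
  using assms[THEN endo_eqD] web_eq.add_assoc[of f g h] unfolding endo_eq_def by simp

lemma endo_eq_add_comm:
  assumes "endo_eq f f" "endo_eq g g"
  shows "endo_eq (Add f g) (Add g f)"
  using assms[THEN endo_eqD] web_eq.add_comm[of f g] unfolding endo_eq_def by simp

lemma endo_eq_add_zero:
  assumes "endo_eq f f"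
  shows "endo_eq (Add (Zero [] []) f) f"
  using assms[THEN endo_eqD] web_eq.add_zero[of f] unfolding endo_eq_def by simp

lemma endo_eq_add_inverse:
  assumes "endo_eq f f"
  shows "endo_eq (Add (Scale (-1) f) f) (Zero [] [])"
  using assms[THEN endo_eqD] web_eq.add_inverse[of f] unfolding endo_eq_def by simp

quotient_type endo_unit = web / partial: endo_eq
proof (rule part_equivpI)
  show "\<exists>f. endo_eq f f"
    by (rule exI[of _ "Ident []"]) (simp add: endo_eq_refl)
  show "symp endo_eq"
    unfolding endo_eq_def by (rule sympI) (metis web_eq.sym web_eq_typed)
  show "transp endo_eq"
    by (rule transpI) (auto simp: endo_eq_def intro: web_eq.trans)
qed

instantiation endo_unit :: ab_group_add
begin

lift_definition zero_endo_unit :: endo_unit is "Zero [] []"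
  by (simp add: endo_eq_refl)

lift_definition plus_endo_unit :: "endo_unit \<Rightarrow> endo_unit \<Rightarrow> endo_unit" is Add
  by (rule endo_eq_Add)

lift_definition uminus_endo_unit :: "endo_unit \<Rightarrow> endo_unit" is "Scale (-1)"
  by (rule endo_eq_Scale)

definition minus_endo_unit :: "endo_unit \<Rightarrow> endo_unit \<Rightarrow> endo_unit" where
  "minus_endo_unit f g = f + - g"

instance
proof
  fix f g h :: endo_unit
  show "f + g + h = f + (g + h)" by transfer (rule endo_eq_add_assoc)
  show "f + g = g + f" by transfer (rule endo_eq_add_comm)
  show "0 + f = f" by transfer (rule endo_eq_add_zero)
  show "- f + f = 0" by transfer (rule endo_eq_add_inverse)
  show "f - g = f + - g" by (rule minus_endo_unit_def)
qed

end

lift_definition scale_endo :: "jring \<Rightarrow> endo_unit \<Rightarrow> endo_unit"  (infixr \<open>*\<^sub>J\<close> 75) is Scale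
  by (simp only: endo_eq_Scale)

lift_definition bubble :: "nat \<Rightarrow> endo_unit"
  is "\<lambda>a. if a = 0 then Ident [] else cap a \<cdot> (dot a \<otimes> idn a) \<cdot> cup a"
  by (simp add: endo_eq_refl)

end

theory Submission
  imports Defs
begin

text \<open>\<open>trace\<close> puts its argument on the right leg of a cup and a cap, so the
  leftmost strand of the argument is the innermost one. Caps nest, and an undotted innermost strand
  closes up to a scalar. In \<open>dotted b t\<close> the innermost strand carries the dot; hence it
  has to change places with its neighbour before anything can be evaluated. The exchange splits a
  strand \<open>r\<close> off the dotted one, so a trace of thickness \<open>b + t\<close> becomes a
  combination of traces of thickness \<open>b\<close>; the thicknesses split off in turn are the
  parts of the compositions. Crossings are absorbed by one device: compose the expansion of a split
  after a merge with a morphism that simplifies the unexpanded side. All summands but one involve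
  smaller crossings, known by induction, and the equation is solved for the remaining one. This
  takes subtraction only. The single division, by 2, occurs at the end. For even \<open>a\<close>
  the two occurrences of the bubble of thickness \<open>a\<close> cancel, whereas for odd
  \<open>a\<close> they add up; the resulting factor 2 is matched by the summand 1 in e^t + 1, which
  doubles the last term of the Genocchi convolutions.\<close>

text \<open>
  Close the relation \<open>dot_cross\<close> with \<open>a = b\<close> by a cap and a cup. On its left-hand side every
  summand is a bubble \<open>\<Delta>\<^sub>b\<close>, with \<open>b = a - t\<close>, times the square of the partial trace
  of \<open>spl t b \<cdot> mrg t b\<close>, which is the binomial coefficient \<open>x - b\<close> over \<open>t\<close>. On the
  right-hand side the crossing is absorbed by the cap, and what is left is the trace of \<open>mrg b t\<close>
  after a dot on the strand \<open>b\<close> after \<open>spl b t\<close>. Sandwiching \<open>dot_cross\<close> between a merge and a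
  split moves the undotted strand to the other side of the dot; iterating this expands that trace in bubbles,
  with coefficients counting compositions, whose alternating sum collapses to two terms:
  \<open>\<Sum>\<^sub>b (-1)\<^sup>b (a - b)! (x - b choose a - b)\<^sup>2 \<Delta>\<^sub>b = \<Delta>\<^sub>a + (x - a + 1) \<Delta>\<^sub>a\<^sub>-\<^sub>1\<close>.
  For odd \<open>a\<close> this determines \<open>2 \<Delta>\<^sub>a\<close> by the earlier bubbles, and the claimed solution reduces to
  two convolution identities for Genocchi numbers, read off from \<open>tanh (t/2) (e\<^sup>t + 1) = e\<^sup>t - 1\<close>.
\<close>


section \<open>Evaluation of coefficients\<close>

lift_definition jev :: "jring \<Rightarrow> rat \<Rightarrow> rat" is poly .

text \<open>Polynomials over an infinite field are determined by their values. So identities in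
  \<open>jring\<close> may be checked at rational points, where \<open>xbinom\<close> becomes a
  generalized binomial coefficient.\<close>

lemma jring_eqI: "(\<And>z. jev f z = jev g z) \<Longrightarrow> f = g"
  by transfer (simp add: poly_eq_poly_eq_iff[symmetric] fun_eq_iff)

lemma jev_simps [simp]:
  "jev 0 z = 0" "jev 1 z = 1" "jev (f + g) z = jev f z + jev g z" "jev (f - g) z = jev f z - jev g z"
  "jev (- f) z = - jev f z" "jev (f * g) z = jev f z * jev g z" "jev half z = 1 / 2"
  by (transfer; simp)+

lemma jev_power [simp]: "jev (f ^ n) z = jev f z ^ n"
  by (induction n) auto

lemma jev_sum [simp]: "jev (\<Sum>i\<in>A. f i) z = (\<Sum>i\<in>A. jev (f i) z)"
  by (induction A rule: infinite_finite_induct) auto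

lemma jev_of_nat [simp]: "jev (of_nat n) z = of_nat n"
  by (induction n) auto

lemma jev_of_int [simp]: "jev (of_int n) z = of_int n"
  by (cases n rule: int_diff_cases) auto

lemma jev_xbinom [simp]: "jev (xbinom c k) z = (of_int c + z) gchoose k"
  by transfer (simp add: gbinomial_prod_rev poly_prod atLeast0LessThan algebra_simps)

lemma jev_numeral [simp]: "jev (numeral n) z = numeral n"
  using jev_of_nat[of "numeral n" z] by simp


section \<open>Convolutions of Genocchi numbers\<close>

abbreviation X_tanh :: "rat fps" where "X_tanh \<equiv> fps_X * tanh_half"

lemma tanh_half_times_exp: "tanh_half * (fps_exp 1 + 1) = fps_exp 1 - 1"
proof -
  let ?C = "fps_exp (1/2) + fps_exp (-1/2) :: rat fps"
  let ?S = "fps_exp (1/2) - fps_exp (-1/2) :: rat fps"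
  have "fps_nth ?C 0 \<noteq> 0" by simp
  then have nz: "?C \<noteq> 0" and sd: "subdegree ?C = 0" by (metis fps_zero_nth) simp
  have "tanh_half * ?C = ?S"
    unfolding tanh_half_def using nz sd by (intro fps_times_divide_eq) simp_all
  moreover have e: "fps_exp (1/2) * fps_exp (1/2) = (fps_exp 1 :: rat fps)" "fps_exp (1/2) * fps_exp (-1/2) = (1 :: rat fps)"
    by (simp_all add: fps_exp_add_mult[symmetric])
  ultimately have "tanh_half * (fps_exp (1/2) * ?C) = fps_exp (1/2) * ?S"
    by (metis mult.left_commute)
  then show ?thesis by (simp only: distrib_left right_diff_distrib e)
qed

lemma X_tanh_times_exp: "X_tanh * (fps_exp 1 + 1) = fps_X * (fps_exp 1 - 1)"
  by (simp only: mult.assoc tanh_half_times_exp)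

text \<open>Passing from f to t f' - f multiplies the coefficient of t^i by i - 1, which produces
  the weights \<open>2 * k + 1\<close> in \<open>genocchi_weighted_sum\<close>. With T = tanh (t/2),
  the series t T becomes t^2 (1 - T^2) / 2, and (1 - T)(e^t + 1) = 2 removes the factor 1 -
  T.\<close>

lemma X_tanh_deriv_times_exp:
  "(fps_X * fps_deriv X_tanh - X_tanh) * (fps_exp 1 + 1) = fps_X ^ 2 * (1 + tanh_half)"
proof -
  let ?E = "fps_exp 1 + 1 :: rat fps"
  have 1: "(1 - tanh_half) * ?E = 2"
    using tanh_half_times_exp by (simp add: left_diff_distrib)
  have "(fps_X * fps_deriv X_tanh - X_tanh) * ?E = fps_const (1/2) * (fps_X ^ 2 * ((1 - tanh_half) * ?E) * (1 + tanh_half))"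
    unfolding tanh_half_X by (simp add: algebra_simps power2_eq_square)
  also have "\<dots> = fps_const (1/2) * 2 * (fps_X ^ 2 * (1 + tanh_half))"
    unfolding 1 by (simp only: mult_ac)
  also have "fps_const (1/2) * 2 = (1 :: rat fps)"
    by (simp add: fps_numeral_fps_const)
  finally show ?thesis by simp
qed

text \<open>These are the exponential coefficients of t tanh (t/2); shifting the index by one
  absorbs the minus sign of the generating function.\<close>

definition sgenocchi :: "nat \<Rightarrow> rat" where
  "sgenocchi k = (-1) ^ k * of_int (genocchi (2 * k + 2))"

lemma X_tanh_even: "fps_nth X_tanh (2 * k + 2) = sgenocchi k / fact (2 * k + 2)"
  using arg_cong[OF genocchi_generating_function, of "\<lambda>f. fps_nth f (2 * k + 2)"]
  by (simp add: sgenocchi_def)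

lemma X_tanh_odd: "odd n \<Longrightarrow> fps_nth X_tanh n = 0"
  by (simp add: tanh_half_even)

lemma sum_even_indices:
  fixes f :: "nat \<Rightarrow> 'a :: comm_monoid_add"
  assumes "f 0 = 0" "\<And>i. odd i \<Longrightarrow> f i = 0"
  shows "(\<Sum>i\<le>2 * n + 2. f i) = (\<Sum>k\<le>n. f (2 * k + 2))"
proof (induction n)
  case (Suc n)
  have "(\<Sum>i\<le>2 * Suc n + 2. f i) = (\<Sum>i\<le>2 * n + 2. f i) + f (2 * n + 3) + f (2 * n + 4)"
    by (simp add: numeral_eq_Suc)
  moreover have "f (2 * n + 3) = 0" by (rule assms) simp
  ultimately show ?case by (simp only: Suc sum.atMost_Suc) (simp add: numeral_eq_Suc)
qed (simp add: assms numeral_2_eq_2)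

lemma fps_times_exp_nth:
  "fps_nth (f * (fps_exp 1 + 1)) N = (\<Sum>i\<le>N. fps_nth f i / fact (N - i)) + fps_nth f N" for f :: "rat fps"
proof -
  have "fps_nth (f * fps_exp 1) N = (\<Sum>i\<le>N. fps_nth f i / fact (N - i))"
    by (simp add: fps_mult_nth atLeast0AtMost)
  then show ?thesis by (simp add: distrib_left)
qed

text \<open>Multiplication by e^t gives a binomial convolution of the coefficients, and the summand
  1 repeats its last term.\<close>

lemma even_coeff_sum:
  fixes f :: "rat fps"
  assumes "fps_nth f 0 = 0" "\<And>i. odd i \<Longrightarrow> fps_nth f i = 0"
    and "\<And>k. fps_nth f (2 * k + 2) = c k / fact (2 * k + 2)"
  shows "fact (2 * n + 2) * fps_nth (f * (fps_exp 1 + 1)) (2 * n + 2)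
    = (\<Sum>k\<le>n. c k * of_nat ((2 * n + 2) choose (2 * k + 2))) + c n"
proof -
  have "(\<Sum>i\<le>2 * n + 2. fps_nth f i / fact (2 * n + 2 - i)) = (\<Sum>k\<le>n. fps_nth f (2 * k + 2) / fact (2 * n + 2 - (2 * k + 2)))"
    by (rule sum_even_indices) (simp_all add: assms)
  moreover have "fact (2 * n + 2) * (fps_nth f (2 * k + 2) / fact (2 * n + 2 - (2 * k + 2)))
      = c k * of_nat ((2 * n + 2) choose (2 * k + 2))" if "k \<le> n" for k
    using that unfolding assms(3) by (subst binomial_fact) (simp_all del: fact_Suc)
  ultimately have "fact (2 * n + 2) * (\<Sum>i\<le>2 * n + 2. fps_nth f i / fact (2 * n + 2 - i))
      = (\<Sum>k\<le>n. c k * of_nat ((2 * n + 2) choose (2 * k + 2)))"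
    by (simp only: sum_distrib_left) (rule sum.cong, simp_all only: atMost_iff)
  moreover have "fact (2 * n + 2) * fps_nth f (2 * n + 2) = c n"
    unfolding assms(3) by (simp del: fact_Suc)
  ultimately show ?thesis by (subst fps_times_exp_nth) (simp only: distrib_left)
qed

lemma genocchi_sum: "(\<Sum>k\<le>n. sgenocchi k * of_nat ((2 * n + 2) choose (2 * k + 2))) + sgenocchi n = of_nat (2 * n + 2)"
proof -
  have "(\<Sum>k\<le>n. sgenocchi k * of_nat ((2 * n + 2) choose (2 * k + 2))) + sgenocchi n
      = fact (2 * n + 2) * fps_nth (X_tanh * (fps_exp 1 + 1)) (2 * n + 2)"
    by (rule even_coeff_sum[OF _ X_tanh_odd X_tanh_even, symmetric]) simp
  also have "\<dots> = fact (2 * n + 2) * (1 / fact (2 * n + 1))"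
    unfolding X_tanh_times_exp by (simp del: fact_Suc)
  also have "\<dots> = of_nat (2 * n + 2)"
  proof -
    have f: "(fact (2 * n + 2) :: rat) = of_nat (2 * n + 2) * fact (2 * n + 1)"
      using fact_Suc[of "2 * n + 1", where 'a = rat] by simp
    have c: "u * v * (1 / v) = u" if "v \<noteq> 0" for u v :: rat using that by simp
    show ?thesis unfolding f by (rule c[OF fact_nonzero])
  qed
  finally show ?thesis .
qed

lemma genocchi_weighted_sum:
  assumes "n > 0"
  shows "(\<Sum>k\<le>n. of_nat (2 * k + 1) * sgenocchi k * of_nat ((2 * n + 2) choose (2 * k + 2))) + of_nat (2 * n + 1) * sgenocchi n = 0"
proof -
  let ?f = "fps_X * fps_deriv X_tanh - X_tanh"
  have nth: "fps_nth (fps_X * fps_deriv f - f) i = (of_nat i - 1) * fps_nth f i" for f :: "rat fps" and i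
    by (cases i) (simp_all add: algebra_simps)
  have "(\<Sum>k\<le>n. of_nat (2 * k + 1) * sgenocchi k * of_nat ((2 * n + 2) choose (2 * k + 2))) + of_nat (2 * n + 1) * sgenocchi n
      = fact (2 * n + 2) * fps_nth (?f * (fps_exp 1 + 1)) (2 * n + 2)"
  proof (rule even_coeff_sum[symmetric])
    show "fps_nth ?f (2 * k + 2) = of_nat (2 * k + 1) * sgenocchi k / fact (2 * k + 2)" for k
      unfolding nth X_tanh_even by simp
  qed (unfold nth, simp_all add: tanh_half_even)
  \<comment> \<open>This is the coefficient of t^(2n) in 1 + tanh (t/2), which vanishes because tanh
    is odd and n > 0.\<close>
  also have "fps_nth (?f * (fps_exp 1 + 1)) (2 * n + 2) = 0"
    unfolding X_tanh_deriv_times_exp using assms by (simp add: fps_X_power_mult_nth tanh_half_even)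
  finally show ?thesis by simp
qed

section \<open>Falling factorials and the recursion for the coefficients\<close>

definition ffact :: "rat \<Rightarrow> nat \<Rightarrow> rat" where
  "ffact y m = fact m * (y gchoose m)"

lemma ffact_prod: "ffact y m = (\<Prod>i<m. y - of_nat i)"
  by (simp add: ffact_def gbinomial_prod_rev atLeast0LessThan)

lemma ffact_add: "ffact y (m + n) = ffact y m * ffact (y - of_nat m) n"
  by (induction n) (simp_all add: ffact_prod algebra_simps)

lemma ffact_1: "ffact y (Suc 0) = y"
  by (simp add: ffact_prod)

text \<open>The coefficient in the theorem, evaluated with y = x - 2j, where 2j is the thickness of
  the bubble that it multiplies and k = m - j.\<close>

definition coef_rat :: "rat \<Rightarrow> nat \<Rightarrow> rat" where
  "coef_rat y k = sgenocchi k * fact (2 * k) * (y gchoose (2 * k + 2)) * ((y - 1) gchoose (2 * k))"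

text \<open>Each of the two copies of the squared binomial coefficient continues a falling factorial
  that occurs in \<open>coef_rat y k\<close>; the completed products no longer depend on k. What is
  left over is the linear factor y - (2k + 1), the last one of
  \<open>ffact y (2 * k + 2)\<close>.\<close>

lemma coef_rat_ffact:
  assumes "k \<le> n"
  shows "fact (2 * n - 2 * k) * ((y - of_nat (2 * k + 1)) gchoose (2 * n - 2 * k))\<^sup>2 * coef_rat y k
    = ffact (y - 1) (2 * n) * ffact y (2 * n + 1) / fact (2 * n + 2)
       * (sgenocchi k * (y - of_nat (2 * k + 1)) * of_nat ((2 * n + 2) choose (2 * k + 2)))"
proof -
  define d where "d = 2 * n - 2 * k"
  let ?z = "y - of_nat (2 * k + 1)"
  have d: "2 * n = 2 * k + d" "2 * n + 1 = (2 * k + 1) + d" "2 * n + 2 - (2 * k + 2) = d" using assms by (auto simp: d_def)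
  have 1: "ffact (y - 1) (2 * n) = ffact (y - 1) (2 * k) * ffact ?z d"
    unfolding d(1) ffact_add by (simp add: algebra_simps)
  have 2: "ffact y (2 * n + 1) = ffact y (2 * k + 1) * ffact ?z d"
    unfolding d(2) ffact_add by simp
  have 3: "ffact y (2 * k + 2) = ffact y (2 * k + 1) * ?z"
    using ffact_add[of y "2 * k + 1" 1] by (simp add: ffact_1)
  have g: "y gchoose m = ffact y m / fact m" for y m by (simp add: ffact_def)
  have b: "(of_nat ((2 * n + 2) choose (2 * k + 2)) :: rat) = fact (2 * n + 2) / (fact (2 * k + 2) * fact d)"
    using assms unfolding d(3)[symmetric] by (intro binomial_fact) simp
  have "fact d * (ffact ?z d / fact d)\<^sup>2 * (sgenocchi k * fact (2 * k) * (ffact y (2 * k + 2) / fact (2 * k + 2)) * (ffact (y - 1) (2 * k) / fact (2 * k)))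
    = (ffact (y - 1) (2 * k) * ffact ?z d) * (ffact y (2 * k + 1) * ffact ?z d) / fact (2 * n + 2)
       * (sgenocchi k * ?z * (fact (2 * n + 2) / (fact (2 * k + 2) * fact d)))"
    unfolding 3 by (simp add: power2_eq_square field_simps del: fact_Suc)
  then show ?thesis unfolding coef_rat_def 1 2 b g d_def[symmetric] .
qed

lemma sgenocchi_0: "sgenocchi 0 = 1"
  using genocchi_sum[of 0] by simp

text \<open>This compares the coefficients of the bubble of thickness 2j in the relation for
  thickness 2m + 1, with n = m - j and y = x - 2j. The extra term for n = 0 comes from (x - 2m)
  times the bubble of thickness 2m. Up to the common factor \<open>F\<close> the sum is linear in y:
  the part with y is \<open>genocchi_sum\<close>, the part with 2k + 1 is
  \<open>genocchi_weighted_sum\<close>.\<close>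

lemma coef_rat_recursion:
  "fact (2 * n + 1) * (y gchoose (2 * n + 1))\<^sup>2
    - (\<Sum>k<n. fact (2 * n - 2 * k) * ((y - of_nat (2 * k + 1)) gchoose (2 * n - 2 * k))\<^sup>2 * coef_rat y k)
    - (if n = 0 then y else 0) = 2 * coef_rat y n"
proof (cases "n = 0")
  case True
  then show ?thesis by (simp add: coef_rat_def sgenocchi_0 gbinomial_prod_rev numeral_2_eq_2 field_simps)
next
  case False
  define F where "F = ffact (y - 1) (2 * n) * ffact y (2 * n + 1) / fact (2 * n + 2)"
  let ?b = "\<lambda>k. of_nat ((2 * n + 2) choose (2 * k + 2)) :: rat"
  have last: "coef_rat y n = F * (sgenocchi n * (y - of_nat (2 * n + 1)))"
    using coef_rat_ffact[of n n y] by (simp add: F_def)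
  have sum: "(\<Sum>k\<le>n. fact (2 * n - 2 * k) * ((y - of_nat (2 * k + 1)) gchoose (2 * n - 2 * k))\<^sup>2 * coef_rat y k)
      = F * (\<Sum>k\<le>n. sgenocchi k * (y - of_nat (2 * k + 1)) * ?b k)"
    unfolding sum_distrib_left F_def by (intro sum.cong HOL.refl coef_rat_ffact) simp
  have "(\<Sum>k\<le>n. sgenocchi k * (y - of_nat (2 * k + 1)) * ?b k) + sgenocchi n * (y - of_nat (2 * n + 1))
      = y * ((\<Sum>k\<le>n. sgenocchi k * ?b k) + sgenocchi n) - ((\<Sum>k\<le>n. of_nat (2 * k + 1) * sgenocchi k * ?b k) + of_nat (2 * n + 1) * sgenocchi n)"
    by (simp add: sum_distrib_left sum_subtractf algebra_simps sum.distrib)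
  also have "\<dots> = y * of_nat (2 * n + 2)"
    using False by (simp only: genocchi_sum genocchi_weighted_sum)
  finally have key: "(\<Sum>k\<le>n. sgenocchi k * (y - of_nat (2 * k + 1)) * ?b k) + sgenocchi n * (y - of_nat (2 * n + 1)) = y * of_nat (2 * n + 2)" .
  have sq: "fact (2 * n + 1) * (y gchoose (2 * n + 1))\<^sup>2 = F * (y * of_nat (2 * n + 2))"
  proof -
    have y: "ffact y (2 * n + 1) = y * ffact (y - 1) (2 * n)"
      using ffact_add[of y 1 "2 * n"] by (simp add: ffact_1)
    have f: "(fact (2 * n + 2) :: rat) = of_nat (2 * n + 2) * fact (2 * n + 1)"
      using fact_Suc[of "2 * n + 1", where 'a = rat] by simp
    have "y gchoose (2 * n + 1) = ffact y (2 * n + 1) / fact (2 * n + 1)" by (simp add: ffact_def del: fact_Suc)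
    then have "fact (2 * n + 1) * (y gchoose (2 * n + 1))\<^sup>2 = ffact y (2 * n + 1) * ffact y (2 * n + 1) / fact (2 * n + 1)"
      by (simp add: power2_eq_square del: fact_Suc)
    also have "\<dots> = ffact (y - 1) (2 * n) * ffact y (2 * n + 1) * y / fact (2 * n + 1)"
      by (subst y) (simp add: del: fact_Suc)
    also have "\<dots> = F * (y * of_nat (2 * n + 2))"
      unfolding F_def f by (simp del: fact_Suc of_nat_add of_nat_mult)
    finally show ?thesis .
  qed
  have split: "(\<Sum>k\<le>n. fact (2 * n - 2 * k) * ((y - of_nat (2 * k + 1)) gchoose (2 * n - 2 * k))\<^sup>2 * coef_rat y k)
    = (\<Sum>k<n. fact (2 * n - 2 * k) * ((y - of_nat (2 * k + 1)) gchoose (2 * n - 2 * k))\<^sup>2 * coef_rat y k) + coef_rat y n"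
    by (simp add: lessThan_Suc_atMost[symmetric])
  have "fact (2 * n + 1) * (y gchoose (2 * n + 1))\<^sup>2
    = (\<Sum>k<n. fact (2 * n - 2 * k) * ((y - of_nat (2 * k + 1)) gchoose (2 * n - 2 * k))\<^sup>2 * coef_rat y k) + coef_rat y n + coef_rat y n"
    by (simp only: sq key[symmetric] distrib_left sum[symmetric] last[symmetric] split)
  then show ?thesis using False by simp
qed


section \<open>Morphisms modulo the relations\<close>

text \<open>
  Ill-formed webs are kept, related only to ill-formed webs with the same source and target, so that all operations
  are total and most laws hold without side conditions.
\<close>

definition same_web :: "web \<Rightarrow> web \<Rightarrow> bool" where
  "same_web f g \<longleftrightarrow> src f = src g \<and> tgt f = tgt g \<and> wf_web f = wf_web g \<and> (wf_web f \<longrightarrow> f \<approx> g)"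

quotient_type mor = web / same_web
proof (rule equivpI)
  show "reflp same_web" by (rule reflpI) (auto simp: same_web_def intro: web_eq.refl)
  show "symp same_web" by (rule sympI) (auto simp: same_web_def intro: web_eq.sym)
  show "transp same_web" by (rule transpI) (auto simp: same_web_def intro: web_eq.trans)
qed

lift_definition msrc :: "mor \<Rightarrow> nat list" is src by (simp add: same_web_def)
lift_definition mtgt :: "mor \<Rightarrow> nat list" is tgt by (simp add: same_web_def)
lift_definition wfm :: "mor \<Rightarrow> bool" is wf_web by (simp add: same_web_def)

lift_definition mcomp :: "mor \<Rightarrow> mor \<Rightarrow> mor" (infixr \<open>\<bullet>\<close> 65) is Comp
  by (auto simp: same_web_def intro: web_eq.comp_cong)

lift_definition mtens :: "mor \<Rightarrow> mor \<Rightarrow> mor" (infixr \<open>\<otimes>\<^sub>m\<close> 70) is Tens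
  by (auto simp: same_web_def intro: web_eq.tens_cong)

lift_definition mplus :: "mor \<Rightarrow> mor \<Rightarrow> mor" (infixr \<open>+\<^sub>m\<close> 60) is Add
  by (auto simp: same_web_def intro: web_eq.add_cong)

lift_definition mscale :: "jring \<Rightarrow> mor \<Rightarrow> mor" (infixr \<open>*\<^sub>m\<close> 75) is Scale
  by (auto simp: same_web_def intro: web_eq.scale_cong)
lift_definition mzero :: "nat list \<Rightarrow> nat list \<Rightarrow> mor" is Zero .
lift_definition ident :: "nat list \<Rightarrow> mor" is Ident .
lift_definition mg :: "nat \<Rightarrow> nat \<Rightarrow> mor" is mrg .
lift_definition sp :: "nat \<Rightarrow> nat \<Rightarrow> mor" is spl .
lift_definition cr :: "nat \<Rightarrow> nat \<Rightarrow> mor" is crs .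
lift_definition cu :: "nat \<Rightarrow> mor" is cup .
lift_definition ca :: "nat \<Rightarrow> mor" is cap .
lift_definition dt :: "nat \<Rightarrow> mor" is dot .

abbreviation one :: "nat \<Rightarrow> mor" (\<open>\<one>\<close>) where "one a \<equiv> ident (strand a)"

lemma msrc_simps [simp]:
  "msrc (f \<bullet> g) = msrc g" "msrc (f \<otimes>\<^sub>m g) = msrc f @ msrc g" "msrc (f +\<^sub>m g) = msrc f"
  "msrc (r *\<^sub>m f) = msrc f" "msrc (mzero X Y) = X" "msrc (ident X) = X"
  "msrc (mg a b) = strand a @ strand b" "msrc (sp a b) = strand (a + b)"
  "msrc (cr a b) = strand a @ strand b" "msrc (cu a) = []" "msrc (ca a) = strand a @ strand a"
  "msrc (dt a) = strand a"
  by (transfer; simp)+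

lemma mtgt_simps [simp]:
  "mtgt (f \<bullet> g) = mtgt f" "mtgt (f \<otimes>\<^sub>m g) = mtgt f @ mtgt g" "mtgt (f +\<^sub>m g) = mtgt f"
  "mtgt (r *\<^sub>m f) = mtgt f" "mtgt (mzero X Y) = Y" "mtgt (ident X) = X"
  "mtgt (mg a b) = strand (a + b)" "mtgt (sp a b) = strand a @ strand b"
  "mtgt (cr a b) = strand b @ strand a" "mtgt (cu a) = strand a @ strand a" "mtgt (ca a) = []"
  "mtgt (dt a) = strand a"
  by (transfer; simp)+

lemma zero_notin_strand [simp]: "0 \<notin> set (strand a)"
  by (simp add: strand_def)

lemma wfm_simps [simp]:
  "wfm (f \<bullet> g) \<longleftrightarrow> wfm f \<and> wfm g \<and> msrc f = mtgt g" "wfm (f \<otimes>\<^sub>m g) \<longleftrightarrow> wfm f \<and> wfm g"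
  "wfm (f +\<^sub>m g) \<longleftrightarrow> wfm f \<and> wfm g \<and> msrc f = msrc g \<and> mtgt f = mtgt g"
  "wfm (r *\<^sub>m f) \<longleftrightarrow> wfm f" "wfm (mzero X Y) \<longleftrightarrow> 0 \<notin> set X \<and> 0 \<notin> set Y" "wfm (ident X) \<longleftrightarrow> 0 \<notin> set X"
  "wfm (mg a b)" "wfm (sp a b)" "wfm (cr a b)" "wfm (cu a)" "wfm (ca a)" "wfm (dt a)"
  by (transfer; simp)+

lemma wfm_msrc: "wfm f \<Longrightarrow> 0 \<notin> set (msrc f)" and wfm_mtgt: "wfm f \<Longrightarrow> 0 \<notin> set (mtgt f)"
  by (transfer; simp add: wf_web_positive)+

lemma comp_assoc: "(f \<bullet> g) \<bullet> h = f \<bullet> g \<bullet> h"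
  by transfer (auto simp: same_web_def intro: web_eq.comp_assoc)

lemma tens_assoc: "(f \<otimes>\<^sub>m g) \<otimes>\<^sub>m h = f \<otimes>\<^sub>m g \<otimes>\<^sub>m h"
  by transfer (auto simp: same_web_def intro: web_eq.tens_assoc)

lemma ident_comp [simp]: "mtgt f = X \<Longrightarrow> ident X \<bullet> f = f"
  by transfer (auto simp: same_web_def wf_web_positive intro: web_eq.comp_id_left)

lemma comp_ident [simp]: "msrc f = X \<Longrightarrow> f \<bullet> ident X = f"
  by transfer (auto simp: same_web_def wf_web_positive intro: web_eq.comp_id_right)

lemma unit_tens [simp]: "ident [] \<otimes>\<^sub>m f = f"
  by transfer (auto simp: same_web_def intro: web_eq.tens_unit_left)

lemma tens_unit [simp]: "f \<otimes>\<^sub>m ident [] = f"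
  by transfer (auto simp: same_web_def intro: web_eq.tens_unit_right)

lemma ident_tens: "ident X \<otimes>\<^sub>m ident Y = ident (X @ Y)"
  by transfer (auto simp: same_web_def intro: web_eq.tens_id)

lemma interchange:
  "\<lbrakk>msrc f = mtgt g; msrc f' = mtgt g'\<rbrakk> \<Longrightarrow> (f \<bullet> g) \<otimes>\<^sub>m (f' \<bullet> g') = (f \<otimes>\<^sub>m f') \<bullet> (g \<otimes>\<^sub>m g')"
  by transfer (auto simp: same_web_def intro: web_eq.interchange)

text \<open>
  Rewriting every tensor product as a composition of layers turns the monoidal structure into associativity of
  composition and the commutation of layers that act on disjoint strands.
\<close>

definition lay :: "nat list \<Rightarrow> mor \<Rightarrow> nat list \<Rightarrow> mor" where
  "lay X f Y = ident X \<otimes>\<^sub>m f \<otimes>\<^sub>m ident Y"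

lemma msrc_lay [simp]: "msrc (lay X f Y) = X @ msrc f @ Y"
  and mtgt_lay [simp]: "mtgt (lay X f Y) = X @ mtgt f @ Y"
  and wfm_lay: "wfm (lay X f Y) \<longleftrightarrow> 0 \<notin> set X \<and> wfm f \<and> 0 \<notin> set Y"
  by (auto simp: lay_def)

lemma lay_Nil [simp]: "lay [] f [] = f"
  by (simp add: lay_def)

lemma lay_lay [simp]: "lay X (lay X' f Y') Y = lay (X @ X') f (Y' @ Y)"
  by (simp add: lay_def tens_assoc flip: ident_tens)

lemma lay_ident [simp]: "lay X (ident Y) Z = ident (X @ Y @ Z)"
  by (simp add: lay_def ident_tens)

lemma ill_formed_eq: "\<lbrakk>msrc f = msrc g; mtgt f = mtgt g; \<not> wfm f; \<not> wfm g\<rbrakk> \<Longrightarrow> f = g"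
  by transfer (simp add: same_web_def)

lemma lay_comp: "lay X (f \<bullet> g) Y = lay X f Y \<bullet> lay X g Y"
proof (cases "msrc f = mtgt g")
  case True
  then have "(ident X \<bullet> ident X) \<otimes>\<^sub>m (f \<bullet> g) \<otimes>\<^sub>m (ident Y \<bullet> ident Y) = lay X f Y \<bullet> lay X g Y"
    by (simp only: lay_def interchange msrc_simps mtgt_simps)
  then show ?thesis by (simp add: lay_def)
next
  case False
  then show ?thesis by (intro ill_formed_eq) (auto simp: wfm_lay)
qed

lemma tens_lay: "f \<otimes>\<^sub>m g = lay [] f (mtgt g) \<bullet> lay (msrc f) g []"
  using interchange[of f "ident (msrc f)" "ident (mtgt g)" g] by (simp add: lay_def)

lemma tens_lay': "f \<otimes>\<^sub>m g = lay (mtgt f) g [] \<bullet> lay [] f (msrc g)"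
  using interchange[of "ident (mtgt f)" f g "ident (msrc g)"] by (simp add: lay_def)

lemma lay_commute:
  "lay X f (Z @ mtgt g @ Y) \<bullet> lay (X @ msrc f @ Z) g Y = lay (X @ mtgt f @ Z) g Y \<bullet> lay X f (Z @ msrc g @ Y)"
proof -
  have "lay [] f (Z @ mtgt g) \<bullet> lay (msrc f @ Z) g [] = lay (mtgt f @ Z) g [] \<bullet> lay [] f (Z @ msrc g)"
    using tens_lay[of f "lay Z g []"] tens_lay'[of f "lay Z g []"] by simp
  from arg_cong[OF this, of "\<lambda>h. lay X h Y"] show ?thesis by (simp add: lay_comp)
qed

lemma lay_commute_comp:
  "lay X f (Z @ mtgt g @ Y) \<bullet> lay (X @ msrc f @ Z) g Y \<bullet> h
    = lay (X @ mtgt f @ Z) g Y \<bullet> lay X f (Z @ msrc g @ Y) \<bullet> h"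
  by (simp add: lay_commute flip: comp_assoc)

section \<open>Linear structure on morphisms\<close>

lemma plus_assoc: "(f +\<^sub>m g) +\<^sub>m h = f +\<^sub>m g +\<^sub>m h"
  by transfer (auto simp: same_web_def intro: web_eq.add_assoc)

lemma plus_comm: "\<lbrakk>msrc f = msrc g; mtgt f = mtgt g\<rbrakk> \<Longrightarrow> f +\<^sub>m g = g +\<^sub>m f"
  by transfer (auto simp: same_web_def intro: web_eq.add_comm)

lemma zero_plus: "\<lbrakk>msrc f = X; mtgt f = Y\<rbrakk> \<Longrightarrow> mzero X Y +\<^sub>m f = f"
  by transfer (auto simp: same_web_def wf_web_positive intro: web_eq.add_zero)

lemma plus_inverse: "wfm f \<Longrightarrow> (-1) *\<^sub>m f +\<^sub>m f = mzero (msrc f) (mtgt f)"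
  by transfer (auto simp: same_web_def wf_web_positive intro: web_eq.add_inverse)

lemma scl_one [simp]: "1 *\<^sub>m f = f"
  by transfer (auto simp: same_web_def intro: web_eq.scale_one)

lemma scl_scl [simp]: "r *\<^sub>m r' *\<^sub>m f = (r * r') *\<^sub>m f"
  by transfer (auto simp: same_web_def intro: web_eq.scale_scale)

lemma scl_plus: "r *\<^sub>m (f +\<^sub>m g) = r *\<^sub>m f +\<^sub>m r *\<^sub>m g"
  by transfer (auto simp: same_web_def intro: web_eq.scale_add)

lemma plus_scl: "(r + r') *\<^sub>m f = r *\<^sub>m f +\<^sub>m r' *\<^sub>m f"
  by transfer (auto simp: same_web_def intro: web_eq.add_scale)

lemma comp_plus_left: "msrc f = msrc g \<Longrightarrow> (f +\<^sub>m g) \<bullet> h = f \<bullet> h +\<^sub>m g \<bullet> h"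
  by transfer (auto simp: same_web_def intro: web_eq.comp_add_left)

lemma comp_plus_right: "mtgt f = mtgt g \<Longrightarrow> h \<bullet> (f +\<^sub>m g) = h \<bullet> f +\<^sub>m h \<bullet> g"
  by transfer (auto simp: same_web_def intro: web_eq.comp_add_right)

lemma comp_scl_left [simp]: "(r *\<^sub>m f) \<bullet> g = r *\<^sub>m (f \<bullet> g)"
  by transfer (auto simp: same_web_def intro: web_eq.comp_scale_left)

lemma comp_scl_right [simp]: "f \<bullet> (r *\<^sub>m g) = r *\<^sub>m (f \<bullet> g)"
  by transfer (auto simp: same_web_def intro: web_eq.comp_scale_right)

lemma tens_plus_left: "(f +\<^sub>m g) \<otimes>\<^sub>m h = f \<otimes>\<^sub>m h +\<^sub>m g \<otimes>\<^sub>m h"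
  by transfer (auto simp: same_web_def intro: web_eq.tens_add_left)

lemma tens_plus_right: "h \<otimes>\<^sub>m (f +\<^sub>m g) = h \<otimes>\<^sub>m f +\<^sub>m h \<otimes>\<^sub>m g"
  by transfer (auto simp: same_web_def intro: web_eq.tens_add_right)

lemma tens_scl_left [simp]: "(r *\<^sub>m f) \<otimes>\<^sub>m g = r *\<^sub>m (f \<otimes>\<^sub>m g)"
  by transfer (auto simp: same_web_def intro: web_eq.tens_scale_left)

lemma tens_scl_right [simp]: "f \<otimes>\<^sub>m (r *\<^sub>m g) = r *\<^sub>m (f \<otimes>\<^sub>m g)"
  by transfer (auto simp: same_web_def intro: web_eq.tens_scale_right)

abbreviation hom :: "nat list \<Rightarrow> nat list \<Rightarrow> mor \<Rightarrow> bool" where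
  "hom X Y f \<equiv> wfm f \<and> msrc f = X \<and> mtgt f = Y"

lemma scl_zero: "wfm f \<Longrightarrow> 0 *\<^sub>m f = mzero (msrc f) (mtgt f)"
  using plus_scl[of "-1" 1 f] plus_inverse[of f] by simp

lemma scl_mzero [simp]: "0 \<notin> set X \<Longrightarrow> 0 \<notin> set Y \<Longrightarrow> r *\<^sub>m mzero X Y = mzero X Y"
  using scl_zero[of "mzero X Y"] scl_scl[of r 0 "mzero X Y"] by simp

lemma plus_mzero [simp]: "hom X Y f \<Longrightarrow> f +\<^sub>m mzero X Y = f"
  using plus_comm[of f "mzero X Y"] zero_plus[of f X Y] by simp

lemma comp_zero:
  assumes "wfm h" "msrc h = Y" "0 \<notin> set X"
  shows "h \<bullet> mzero X Y = mzero X (mtgt h)"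
proof -
  have "0 \<notin> set Y" using assms wfm_msrc by blast
  then have "h \<bullet> mzero X Y = 0 *\<^sub>m (h \<bullet> mzero X Y)"
    using assms comp_scl_right[of h 0 "mzero X Y"] by simp
  then show ?thesis using assms \<open>0 \<notin> set Y\<close> scl_zero[of "h \<bullet> mzero X Y"] by simp
qed

lemma zero_comp:
  assumes "wfm h" "mtgt h = X" "0 \<notin> set Y"
  shows "mzero X Y \<bullet> h = mzero (msrc h) Y"
proof -
  have "0 \<notin> set X" using assms wfm_mtgt by blast
  then have "mzero X Y \<bullet> h = 0 *\<^sub>m (mzero X Y \<bullet> h)"
    using assms comp_scl_left[of 0 "mzero X Y" h] by simp
  then show ?thesis using assms \<open>0 \<notin> set X\<close> scl_zero[of "mzero X Y \<bullet> h"] by simp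
qed

lemma lay_plus: "lay A (f +\<^sub>m g) B = lay A f B +\<^sub>m lay A g B"
  by (simp add: lay_def tens_plus_left tens_plus_right)

lemma lay_scl [simp]: "lay A (r *\<^sub>m f) B = r *\<^sub>m lay A f B"
  by (simp add: lay_def)

lemma lay_zero:
  assumes "0 \<notin> set A" "0 \<notin> set B" "0 \<notin> set X" "0 \<notin> set Y"
  shows "lay A (mzero X Y) B = mzero (A @ X @ B) (A @ Y @ B)"
  using scl_zero[of "mzero X Y"] scl_zero[of "lay A (mzero X Y) B"] lay_scl[of A 0 "mzero X Y" B] assms
  by (simp add: wfm_lay)

section \<open>Finite sums with prescribed source and target\<close>

definition msum :: "nat list \<Rightarrow> nat list \<Rightarrow> mor list \<Rightarrow> mor" where
  "msum X Y fs = foldr (+\<^sub>m) fs (mzero X Y)"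

lemma msum_Nil [simp]: "msum X Y [] = mzero X Y"
  and msum_Cons [simp]: "msum X Y (f # fs) = f +\<^sub>m msum X Y fs"
  by (simp_all add: msum_def)

lemma abs_web_sum: "abs_mor (web_sum X Y fs) = msum X Y (map abs_mor fs)"
  by (induction fs) (auto simp: web_sum_def msum_def mzero.abs_eq mplus.abs_eq[symmetric])

lemma msrc_msum: "(\<And>f. f \<in> set fs \<Longrightarrow> msrc f = X \<and> mtgt f = Y) \<Longrightarrow> msrc (msum X Y fs) = X \<and> mtgt (msum X Y fs) = Y"
  by (cases fs) auto

lemma comp_msum:
  assumes "wfm h" "msrc h = Y" "0 \<notin> set X" "\<And>i. i \<in> set is \<Longrightarrow> msrc (f i) = X \<and> mtgt (f i) = Y"
  shows "h \<bullet> msum X Y (map f is) = msum X (mtgt h) (map (\<lambda>i. h \<bullet> f i) is)"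
  using assms(4)
proof (induction "is")
  case (Cons i "is")
  then have "mtgt (msum X Y (map f is)) = Y" using msrc_msum[of "map f is" X Y] by auto
  with Cons show ?case by (simp add: comp_plus_right)
qed (use assms in \<open>simp add: comp_zero\<close>)

lemma msum_comp:
  assumes "wfm h" "mtgt h = X" "0 \<notin> set Y" "\<And>i. i \<in> set is \<Longrightarrow> msrc (f i) = X \<and> mtgt (f i) = Y"
  shows "msum X Y (map f is) \<bullet> h = msum (msrc h) Y (map (\<lambda>i. f i \<bullet> h) is)"
  using assms(4)
proof (induction "is")
  case (Cons i "is")
  then have "msrc (msum X Y (map f is)) = X" using msrc_msum[of "map f is" X Y] by auto
  with Cons show ?case by (simp add: comp_plus_left)
qed (use assms in \<open>simp add: zero_comp\<close>)

lemma lay_msum: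
  assumes "0 \<notin> set A" "0 \<notin> set B" "0 \<notin> set X" "0 \<notin> set Y"
  shows "lay A (msum X Y (map f is)) B = msum (A @ X @ B) (A @ Y @ B) (map (\<lambda>i. lay A (f i) B) is)"
  by (induction "is") (simp_all add: lay_plus lay_zero assms)

lemma msum_scl:
  assumes "hom X Y K" "distinct is" "\<And>i. i \<in> set is \<Longrightarrow> f i = q i *\<^sub>m K"
  shows "msum X Y (map f is) = (\<Sum>i\<in>set is. q i) *\<^sub>m K"
  using assms(2,3) by (induction "is") (use assms(1) in \<open>auto simp: scl_zero plus_scl\<close>)

text \<open>All hom spaces share the type \<open>mor\<close>, which therefore is not a group;
  cancellation takes place inside one hom space.\<close>

lemma plus_right_cancel:
  assumes "hom X Y f" "hom X Y g" "hom X Y h" "f +\<^sub>m h = g +\<^sub>m h"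
  shows "f = g"
proof -
  have *: "(v +\<^sub>m h) +\<^sub>m (-1) *\<^sub>m h = v" if "hom X Y v" for v
  proof -
    have "(v +\<^sub>m h) +\<^sub>m (-1) *\<^sub>m h = v +\<^sub>m (-1) *\<^sub>m h +\<^sub>m h"
      unfolding plus_assoc using plus_comm[of h "(-1) *\<^sub>m h"] by simp
    also have "\<dots> = v +\<^sub>m mzero X Y" using plus_inverse[of h] assms(3) by simp
    also have "\<dots> = v" using that by simp
    finally show ?thesis .
  qed
  show ?thesis using *[OF assms(1)] *[OF assms(2)] assms(4) by metis
qed

text \<open>In the inductions on crossings, \<open>i0\<close> indexes the summand with the crossing
  under study; the others are multiples of \<open>K\<close> by induction.\<close>

lemma msum_solve:
  assumes K: "hom X Y K" and dist: "distinct is" and i0: "i0 \<in> set is" and f0: "hom X Y (f i0)"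
    and f: "\<And>i. i \<in> set is \<Longrightarrow> i \<noteq> i0 \<Longrightarrow> f i = q i *\<^sub>m K"
    and total: "msum X Y (map f is) = r *\<^sub>m K"
  shows "f i0 = (r - (\<Sum>i\<in>set is - {i0}. q i)) *\<^sub>m K"
proof -
  have "msum X Y (map f is) = f i0 +\<^sub>m (\<Sum>i\<in>set is - {i0}. q i) *\<^sub>m K"
    using dist i0 f
  proof (induction "is")
    case (Cons i "is")
    show ?case
    proof (cases "i = i0")
      case True
      with Cons.prems have "msum X Y (map f is) = (\<Sum>i\<in>set is. q i) *\<^sub>m K"
        by (intro msum_scl K) auto
      moreover have "set (i # is) - {i0} = set is" using True Cons.prems by auto
      ultimately show ?thesis using True by simp
    next
      case False
      then have IH: "msum X Y (map f is) = f i0 +\<^sub>m (\<Sum>i\<in>set is - {i0}. q i) *\<^sub>m K"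
        using Cons by auto
      have "set (i # is) - {i0} = insert i (set is - {i0})" using False by auto
      then have "(\<Sum>i\<in>set (i # is) - {i0}. q i) = q i + (\<Sum>i\<in>set is - {i0}. q i)"
        using Cons.prems by simp
      moreover have "f i = q i *\<^sub>m K" using Cons.prems False by simp
      moreover have "q i *\<^sub>m K +\<^sub>m f i0 = f i0 +\<^sub>m q i *\<^sub>m K"
        using f0 K by (intro plus_comm) auto
      ultimately show ?thesis by (simp only: list.map msum_Cons IH plus_scl plus_assoc[symmetric])
    qed
  qed simp
  then have "f i0 +\<^sub>m (\<Sum>i\<in>set is - {i0}. q i) *\<^sub>m K
      = (r - (\<Sum>i\<in>set is - {i0}. q i)) *\<^sub>m K +\<^sub>m (\<Sum>i\<in>set is - {i0}. q i) *\<^sub>m K"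
    using total by (simp only: plus_scl[symmetric] diff_add_cancel)
  then show ?thesis by (rule plus_right_cancel[rotated 3]) (use K f0 in auto)
qed


section \<open>The defining relations with labels in the natural numbers\<close>

lemma abs_rel: "bweb_rel f g \<Longrightarrow> abs_mor f = abs_mor g"
  using bweb_rel_typed[of f g] by (auto simp: mor.abs_eq_iff same_web_def intro: web_eq.rel)

lemmas abs_simps = mcomp.abs_eq[symmetric] mtens.abs_eq[symmetric] mscale.abs_eq[symmetric] mzero.abs_eq[symmetric]
  ident.abs_eq[symmetric] mg.abs_eq[symmetric] sp.abs_eq[symmetric] cr.abs_eq[symmetric]
  cu.abs_eq[symmetric] ca.abs_eq[symmetric] dt.abs_eq[symmetric] abs_web_sum

lemma strand_0 [simp]: "strand 0 = []" by (simp add: strand_def)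

text \<open>Since strands of thickness zero disappear, most relations extend to all natural labels,
  and the boundary terms of later sums and inductions are instances of them.\<close>

lemma web_zero_labels [simp]:
  "mg 0 a = \<one> a" "mg a 0 = \<one> a" "sp 0 a = \<one> a" "sp a 0 = \<one> a" "cr 0 a = \<one> a" "cr a 0 = \<one> a"
  "cu 0 = ident []" "ca 0 = ident []" "dt 0 = ident []"
  by (transfer; simp add: small_web_defs same_web_def web_eq.refl)+

lemma abs_idn: "abs_mor (idn a) = \<one> a"
  by (simp add: idn_def ident.abs_eq)

lemma merge_assoc: "mg (a + b) c \<bullet> (mg a b \<otimes>\<^sub>m \<one> c) = mg a (b + c) \<bullet> (\<one> a \<otimes>\<^sub>m mg b c)"
  using abs_rel[OF bweb_rel.merge_assoc, of a b c] 
  by (cases "a = 0"; cases "b = 0"; cases "c = 0") (simp_all add: abs_simps abs_idn ident_tens)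

lemma split_coassoc: "(sp a b \<otimes>\<^sub>m \<one> c) \<bullet> sp (a + b) c = (\<one> a \<otimes>\<^sub>m sp b c) \<bullet> sp a (b + c)"
  using abs_rel[OF bweb_rel.split_coassoc, of a b c] 
  by (cases "a = 0"; cases "b = 0"; cases "c = 0") (simp_all add: abs_simps abs_idn ident_tens)

lemma merge_split: "mg a b \<bullet> sp a b = of_nat ((a + b) choose a) *\<^sub>m \<one> (a + b)"
  using abs_rel[OF bweb_rel.merge_split, of a b] 
  by (cases "a = 0"; cases "b = 0") (simp_all add: abs_simps abs_idn ident_tens)

lemma zigzag_left: "(ca a \<otimes>\<^sub>m \<one> a) \<bullet> (\<one> a \<otimes>\<^sub>m cu a) = \<one> a"
  using abs_rel[OF bweb_rel.zigzag_left, of a] by (cases "a = 0") (simp_all add: abs_simps abs_idn)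

lemma zigzag_right: "(\<one> a \<otimes>\<^sub>m ca a) \<bullet> (cu a \<otimes>\<^sub>m \<one> a) = \<one> a"
  using abs_rel[OF bweb_rel.zigzag_right, of a] by (cases "a = 0") (simp_all add: abs_simps abs_idn)

lemma cap_slide: "(ca a \<otimes>\<^sub>m \<one> b) \<bullet> (\<one> a \<otimes>\<^sub>m cr b a) = (\<one> b \<otimes>\<^sub>m ca a) \<bullet> (cr a b \<otimes>\<^sub>m \<one> a)"
  using abs_rel[OF bweb_rel.cap_slide, of a b] 
  by (cases "a = 0"; cases "b = 0") (simp_all add: abs_simps abs_idn ident_tens)

lemma cup_slide: "(cr b a \<otimes>\<^sub>m \<one> a) \<bullet> (\<one> b \<otimes>\<^sub>m cu a) = (\<one> a \<otimes>\<^sub>m cr a b) \<bullet> (cu a \<otimes>\<^sub>m \<one> b)"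
  using abs_rel[OF bweb_rel.cup_slide, of a b] 
  by (cases "a = 0"; cases "b = 0") (simp_all add: abs_simps abs_idn ident_tens)

lemma cap_split_left:
  "ca b \<bullet> (\<one> b \<otimes>\<^sub>m ca a \<otimes>\<^sub>m \<one> b) \<bullet> (sp b a \<otimes>\<^sub>m \<one> a \<otimes>\<^sub>m \<one> b) = ca (a + b) \<bullet> (\<one> (a + b) \<otimes>\<^sub>m mg a b)"
  using abs_rel[OF bweb_rel.cap_split_left, of a b] 
  by (cases "a = 0"; cases "b = 0") (simp_all add: abs_simps abs_idn ident_tens)

lemma cap_split_right:
  "ca a \<bullet> (\<one> a \<otimes>\<^sub>m ca b \<otimes>\<^sub>m \<one> a) \<bullet> (\<one> a \<otimes>\<^sub>m \<one> b \<otimes>\<^sub>m sp b a) = ca (a + b) \<bullet> (mg a b \<otimes>\<^sub>m \<one> (a + b))"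
  using abs_rel[OF bweb_rel.cap_split_right, of a b] 
  by (cases "a = 0"; cases "b = 0") (simp_all add: abs_simps abs_idn ident_tens)

lemma xbinom_0 [simp]: "xbinom c 0 = 1"
  by transfer simp

lemma circle: "ca a \<bullet> cu a = xbinom 0 a *\<^sub>m ident []"
  using abs_rel[OF bweb_rel.circle, of a] by (cases "a = 0") (simp_all add: abs_simps abs_idn)

lemma cap_split: "a > 0 \<Longrightarrow> ca a \<bullet> sp a a = mzero [2 * a] []"
  using abs_rel[OF bweb_rel.cap_split, of a] by (simp add: abs_simps abs_idn)

lemma cap_dot: "ca a \<bullet> (dt a \<otimes>\<^sub>m \<one> a) = (-1) ^ a *\<^sub>m (ca a \<bullet> (\<one> a \<otimes>\<^sub>m dt a))"
  using abs_rel[OF bweb_rel.cap_dot, of a] by (cases "a = 0") (simp_all add: abs_simps abs_idn)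

lemma dot_cross:
  "msum (strand a @ strand b) (strand b @ strand a) (map (\<lambda>t. of_nat (fact t) *\<^sub>m
      ((mg (b - t) t \<otimes>\<^sub>m mg t (a - t)) \<bullet> (\<one> (b - t) \<otimes>\<^sub>m cu t \<otimes>\<^sub>m \<one> (a - t))
       \<bullet> (dt (b - t) \<otimes>\<^sub>m \<one> (a - t)) \<bullet> cr (a - t) (b - t)
       \<bullet> (\<one> (a - t) \<otimes>\<^sub>m ca t \<otimes>\<^sub>m \<one> (b - t)) \<bullet> (sp (a - t) t \<otimes>\<^sub>m sp t (b - t)))) [0..<Suc (min a b)])
   = msum (strand a @ strand b) (strand b @ strand a) (map (\<lambda>t. of_nat (fact t) *\<^sub>m
      ((mg t (b - t) \<otimes>\<^sub>m mg (a - t) t) \<bullet> (\<one> t \<otimes>\<^sub>m cr (a - t) (b - t) \<otimes>\<^sub>m \<one> t)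
       \<bullet> (\<one> t \<otimes>\<^sub>m \<one> (a - t) \<otimes>\<^sub>m dt (b - t) \<otimes>\<^sub>m \<one> t) \<bullet> (sp t (a - t) \<otimes>\<^sub>m sp (b - t) t))) [0..<Suc (min a b)])"
proof (cases "a > 0 \<and> b > 0")
  case True
  then show ?thesis
    using abs_rel[OF bweb_rel.dot_cross, of a b]
    by (simp add: abs_simps abs_idn strand_pos o_def del: upt_Suc)
next
  case False
  then consider "a = 0" | "b = 0" by blast
  then show ?thesis by cases (simp_all add: ident_tens)
qed

lemma concat_single:
  "distinct xs \<Longrightarrow> concat (map (\<lambda>t. if t = t0 then [f t] else []) xs) = (if t0 \<in> set xs then [f t0] else [])"
  by (induction xs) auto

text \<open>The condition on \<open>t\<close> is left in the form in which
  \<open>bweb_rel.split_merge\<close> with labels \<open>a, b, b, a\<close> produces it, so that the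
  equation works as a rewrite rule.\<close>

lemma concat_diagonal:
  "concat (map (\<lambda>s. concat (map (\<lambda>t. if int t - int s = int a - int a then [f s t] else []) [0..<n])) [0..<n])
    = map (\<lambda>s. f s s) [0..<n]"
proof -
  have "concat (map (\<lambda>t. if int t - int s = int a - int a then [f s t] else []) [0..<n]) = [f s s]"
    if "s \<in> set [0..<n]" for s
    using that concat_single[of "[0..<n]" s "f s"] by auto
  then have "map (\<lambda>s. concat (map (\<lambda>t. if int t - int s = int a - int a then [f s t] else []) [0..<n])) [0..<n]
      = map (\<lambda>s. [f s s]) [0..<n]"
    by (intro map_cong) auto
  then show ?thesis by (simp only: concat_map_singleton)
qed

lemma concat_tail:
  "l \<le> n \<Longrightarrow> concat (map (\<lambda>s. if l \<le> s then [g s] else []) [0..<n]) = map g [l..<n]"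
  by (induction n) (auto simp: le_Suc_eq)

text \<open>The condition forces t = s + b - a, which is a natural number only for s at least a - b;
  this gives the lower end of the range.\<close>

lemma concat_shifted_diagonal:
  "concat (map (\<lambda>s. concat (map (\<lambda>t. if int t - int s = int b - int a then [f s t] else []) [0..<Suc b])) [0..<Suc a])
    = map (\<lambda>s. f s (s + b - a)) [a - b..<Suc a]"
proof -
  have "concat (map (\<lambda>t. if int t - int s = int b - int a then [f s t] else []) [0..<Suc b])
      = (if a - b \<le> s then [f s (s + b - a)] else [])" if "s \<in> set [0..<Suc a]" for s
  proof (cases "a - b \<le> s")
    case True
    then have "(int t - int s = int b - int a) = (t = s + b - a)" for t by auto
    then show ?thesis
      using that True concat_single[of "[0..<Suc b]" "s + b - a" "f s"] by (auto simp del: upt_Suc)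
  next
    case False
    then have "(int t - int s = int b - int a) = False" for t by auto
    then show ?thesis using False by (simp del: upt_Suc)
  qed
  then have "map (\<lambda>s. concat (map (\<lambda>t. if int t - int s = int b - int a then [f s t] else []) [0..<Suc b])) [0..<Suc a]
      = map (\<lambda>s. if a - b \<le> s then [f s (s + b - a)] else []) [0..<Suc a]"
    by (intro map_cong[OF HOL.refl])
  then show ?thesis by (simp only: concat_tail[OF le_SucI[OF diff_le_self]])
qed

lemma split_merge_cross:
  "sp b a \<bullet> mg a b = msum (strand a @ strand b) (strand b @ strand a)
    (map (\<lambda>s. (mg s (b - s) \<otimes>\<^sub>m mg (a - s) s) \<bullet> (\<one> s \<otimes>\<^sub>m cr (a - s) (b - s) \<otimes>\<^sub>m \<one> s)
      \<bullet> (sp s (a - s) \<otimes>\<^sub>m sp (b - s) s)) [0..<Suc (min a b)])"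
proof (cases "a > 0 \<and> b > 0")
  case True
  have "bweb_rel (spl b a \<cdot> mrg a b) (web_sum [a, b] [b, a]
        (map (\<lambda>s. (mrg s (b - s) \<otimes> mrg (a - s) s) \<cdot> (idn s \<otimes> crs (a - s) (b - s) \<otimes> idn s)
            \<cdot> (spl s (a - s) \<otimes> spl (b - s) s)) [0..<Suc (min a b)]))"
    using bweb_rel.split_merge[of a b b a] True
    unfolding min.commute[of b a] concat_diagonal by simp
  from abs_rel[OF this] show ?thesis
    using True by (simp add: abs_simps abs_idn strand_pos o_def del: upt_Suc)
next
  case False
  then consider "a = 0" | "b = 0" by blast
  then show ?thesis by cases (simp_all add: ident_tens)
qed

lemma split_merge_straight:
  "sp a b \<bullet> mg a b = msum (strand a @ strand b) (strand a @ strand b)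
    (map (\<lambda>s. (mg s (a - s) \<otimes>\<^sub>m mg (a - s) (s + b - a)) \<bullet> (\<one> s \<otimes>\<^sub>m cr (a - s) (a - s) \<otimes>\<^sub>m \<one> (s + b - a))
      \<bullet> (sp s (a - s) \<otimes>\<^sub>m sp (a - s) (s + b - a))) [a - b..<Suc a])"
proof (cases "a > 0 \<and> b > 0")
  case True
  have "bweb_rel (spl a b \<cdot> mrg a b) (web_sum [a, b] [a, b]
    (map (\<lambda>s. (mrg s (b - (s + b - a)) \<otimes> mrg (a - s) (s + b - a)) \<cdot> (idn s \<otimes> crs (a - s) (b - (s + b - a)) \<otimes> idn (s + b - a))
            \<cdot> (spl s (a - s) \<otimes> spl (b - (s + b - a)) (s + b - a))) [a - b..<Suc a]))"
    using bweb_rel.split_merge[of a a b b] True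
    unfolding min.idem concat_shifted_diagonal by simp
  note r = abs_rel[OF this]
  \<comment> \<open>In this range b - (s + b - a) = a - s holds for natural numbers, so the two
    crossing strands have equal thickness. This is what allows a cap to act on the crossing
    later.\<close>
  have eq: "map (\<lambda>s. (mrg s (b - (s + b - a)) \<otimes> mrg (a - s) (s + b - a)) \<cdot> (idn s \<otimes> crs (a - s) (b - (s + b - a)) \<otimes> idn (s + b - a))
            \<cdot> (spl s (a - s) \<otimes> spl (b - (s + b - a)) (s + b - a))) [a - b..<Suc a]
      = map (\<lambda>s. (mrg s (a - s) \<otimes> mrg (a - s) (s + b - a)) \<cdot> (idn s \<otimes> crs (a - s) (a - s) \<otimes> idn (s + b - a))
            \<cdot> (spl s (a - s) \<otimes> spl (a - s) (s + b - a))) [a - b..<Suc a]"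
  proof (intro map_cong[OF HOL.refl])
    fix s assume "s \<in> set [a - b..<Suc a]"
    then have "b - (s + b - a) = a - s" by auto
    then show "(mrg s (b - (s + b - a)) \<otimes> mrg (a - s) (s + b - a)) \<cdot> (idn s \<otimes> crs (a - s) (b - (s + b - a)) \<otimes> idn (s + b - a))
            \<cdot> (spl s (a - s) \<otimes> spl (b - (s + b - a)) (s + b - a))
        = (mrg s (a - s) \<otimes> mrg (a - s) (s + b - a)) \<cdot> (idn s \<otimes> crs (a - s) (a - s) \<otimes> idn (s + b - a))
            \<cdot> (spl s (a - s) \<otimes> spl (a - s) (s + b - a))"
      by (simp only:)
  qed
  show ?thesis using r[unfolded eq] True
    by (simp add: abs_simps abs_idn strand_pos o_def del: upt_Suc)
next
  case False
  then consider "a = 0" | "b = 0" by blast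
  then show ?thesis by cases (simp_all add: ident_tens)
qed


section \<open>Absorbing crossings\<close>

lemmas diagram = tens_lay lay_comp comp_assoc

text \<open>The tail \<open>h\<close> allows a relation to be applied in the middle of a
  right-nested composite of layers.\<close>

lemma lay_cong: "u = v \<Longrightarrow> lay X u Y \<bullet> h = lay X v Y \<bullet> h"
  by simp

lemma merge_assoc_lay:
  "lay X (mg (a + b) c) Y \<bullet> lay X (mg a b) (strand c @ Y) \<bullet> h
    = lay X (mg a (b + c)) Y \<bullet> lay (X @ strand a) (mg b c) Y \<bullet> h"
  using lay_cong[OF merge_assoc, of X a b c Y h] by (simp add: diagram)

lemma split_coassoc_lay:
  "lay X (sp a b) (strand c @ Y) \<bullet> lay X (sp (a + b) c) Y \<bullet> h
    = lay (X @ strand a) (sp b c) Y \<bullet> lay X (sp a (b + c)) Y \<bullet> h"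
  using lay_cong[OF split_coassoc, of X a b c Y h] by (simp add: diagram)

lemma merge_split_lay:
  "mtgt h = X @ strand (a + b) @ Y \<Longrightarrow> 
  lay X (mg a b) Y \<bullet> lay X (sp a b) Y \<bullet> h = of_nat ((a + b) choose a) *\<^sub>m h"
  using lay_cong[OF merge_split, of X a b Y h] by (simp add: diagram)

lemma cap_split_left_lay:
  "lay X (ca (a + b)) Y \<bullet> lay (X @ strand (a + b)) (mg a b) Y \<bullet> h
   = lay X (ca b) Y \<bullet> lay (X @ strand b) (ca a) (strand b @ Y) \<bullet> lay X (sp b a) (strand a @ strand b @ Y) \<bullet> h"
  using lay_cong[OF cap_split_left, of X b a Y h] by (simp add: diagram)

lemma cap_split_right_lay:
  "lay X (ca (a + b)) Y \<bullet> lay X (mg a b) (strand (a + b) @ Y) \<bullet> h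
   = lay X (ca a) Y \<bullet> lay (X @ strand a) (ca b) (strand a @ Y) \<bullet> lay (X @ strand a @ strand b) (sp b a) Y \<bullet> h"
  using lay_cong[OF cap_split_right, of X a b Y h] by (simp add: diagram)

text \<open>By associativity the two middle strands may be merged before the others, and their merge
  absorbs the crossing. Absorption is a hypothesis because the lemma serves the induction that
  establishes it.\<close>

lemma merge_merge_cross:
  assumes "mg q p \<bullet> cr p q = mg p q"
  shows "mg (s + q) (p + r) \<bullet> (mg s q \<otimes>\<^sub>m mg p r) \<bullet> (\<one> s \<otimes>\<^sub>m cr p q \<otimes>\<^sub>m \<one> r) \<bullet> h
    = mg (s + p) (q + r) \<bullet> (mg s p \<otimes>\<^sub>m mg q r) \<bullet> h"
proof -
  have c: "lay X (mg q p) Y \<bullet> lay X (cr p q) Y \<bullet> h = lay X (mg p q) Y \<bullet> h" for X Y h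
    using lay_cong[OF assms, of X Y h] by (simp add: diagram)
  have *: "mg (s + q) (p + r) \<bullet> (mg s q \<otimes>\<^sub>m mg p r) \<bullet> h
     = mg s (q + p + r) \<bullet> lay (strand s) (mg (q + p) r) [] \<bullet> lay (strand s) (mg q p) (strand r) \<bullet> h" for s q p r h
    using merge_assoc_lay[of "[]" s q "p + r" "[]"] merge_assoc_lay[of "strand s" q p r "[]" h]
    by (simp add: diagram add.assoc)
  show ?thesis
    using c[of "strand s" "strand r" h] unfolding * by (simp add: diagram add_ac)
qed

lemma split_split_cross:
  assumes "cr p q \<bullet> sp p q = sp q p"
  shows "(\<one> s \<otimes>\<^sub>m cr p q \<otimes>\<^sub>m \<one> r) \<bullet> (sp s p \<otimes>\<^sub>m sp q r) \<bullet> sp (s + p) (q + r)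
    = (sp s q \<otimes>\<^sub>m sp p r) \<bullet> sp (s + q) (p + r)"
proof -
  have c: "lay X (cr p q) Y \<bullet> lay X (sp p q) Y \<bullet> h = lay X (sp q p) Y \<bullet> h" for X Y h
    using lay_cong[OF assms, of X Y h] by (simp add: diagram)
  have *: "(sp s p \<otimes>\<^sub>m sp q r) \<bullet> sp (s + p) (q + r)
     = lay (strand s) (sp p q) (strand r) \<bullet> lay (strand s) (sp (p + q) r) [] \<bullet> sp s (p + q + r)" for s q p r
    using split_coassoc_lay[of "[]" s p "q + r" "[]" "ident (strand (s + p + (q + r)))"]
      split_coassoc_lay[of "strand s" p q r "[]" "sp s (p + q + r)"]
      lay_commute_comp[of "[]" "sp s p" "[]" "sp q r" "[]" "sp (s + p) (q + r)"]
    by (simp add: diagram add.assoc)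
  show ?thesis
    using c[of "strand s" "strand r"] unfolding * by (simp add: diagram add_ac)
qed

text \<open>Vandermonde's convolution has the value 1 at s = 0. In the next two proofs that summand
  belongs to the crossing itself, which therefore acts with coefficient 1.\<close>

lemma vandermonde_rest:
  "of_nat ((a + b) choose b) - (\<Sum>s\<in>{0..<Suc (min a b)} - {0}. of_nat (a choose s) * of_nat (b choose s)) = (1 :: jring)"
proof -
  have "(a + b) choose b = (\<Sum>s\<le>b. (a choose s) * (b choose (b - s)))"
    by (simp add: vandermonde)
  also have "\<dots> = (\<Sum>s\<in>{0..<Suc (min a b)}. (a choose s) * (b choose s))"
    by (intro sum.mono_neutral_cong_right) (auto simp: binomial_symmetric[symmetric])
  also have "\<dots> = 1 + (\<Sum>s\<in>{0..<Suc (min a b)} - {0}. (a choose s) * (b choose s))"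
    by (subst sum.remove[of _ 0]) auto
  finally show ?thesis by simp
qed

text \<open>Compose \<open>split_merge_cross\<close> with \<open>mg b a\<close>. The summand for s =
  0 is the unknown; every other one has a smaller crossing, absorbed by induction, and then two
  merge-split pairs, each worth a binomial coefficient.\<close>

lemma merge_cross: "mg b a \<bullet> cr a b = mg a b"
proof (induction "a + b" arbitrary: a b rule: less_induct)
  case less
  let ?f = "\<lambda>s. (mg s (b - s) \<otimes>\<^sub>m mg (a - s) s) \<bullet> (\<one> s \<otimes>\<^sub>m cr (a - s) (b - s) \<otimes>\<^sub>m \<one> s)
      \<bullet> (sp s (a - s) \<otimes>\<^sub>m sp (b - s) s)"
  have ft: "msrc (?f s) = strand a @ strand b \<and> mtgt (?f s) = strand b @ strand a"
    if "s \<in> set [0..<Suc (min a b)]" for s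
    using that by auto
  have "mg b a \<bullet> ?f 0 = (of_nat ((a + b) choose b)
     - (\<Sum>s\<in>set [0..<Suc (min a b)] - {0}. of_nat (a choose s) * of_nat (b choose s))) *\<^sub>m mg a b"
  proof (rule msum_solve)
    show "mg b a \<bullet> ?f s = (of_nat (a choose s) * of_nat (b choose s)) *\<^sub>m mg a b"
      if "s \<in> set [0..<Suc (min a b)]" "s \<noteq> 0" for s
    proof -
      have s: "s + (a - s) = a" "s + (b - s) = b" "a - s + s = a" "b - s + s = b" "s \<le> b" using that by auto
      have "mg (b - s) (a - s) \<bullet> cr (a - s) (b - s) = mg (a - s) (b - s)"
        by (rule less) (use that in auto)
      from merge_merge_cross[OF this, of s s "sp s (a - s) \<otimes>\<^sub>m sp (b - s) s"]
      have "mg b a \<bullet> ?f s = mg a b \<bullet> ((mg s (a - s) \<bullet> sp s (a - s)) \<otimes>\<^sub>m (mg (b - s) s \<bullet> sp (b - s) s))"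
        by (simp add: s interchange)
      also have "\<dots> = (of_nat (a choose s) * of_nat (b choose s)) *\<^sub>m mg a b"
        using s by (simp add: merge_split s ident_tens binomial_symmetric[of s b] mult.commute)
      finally show ?thesis .
    qed
    have "mg b a \<bullet> sp b a \<bullet> mg a b = of_nat ((a + b) choose b) *\<^sub>m mg a b"
      using merge_split_lay[of "mg a b" "[]" b a "[]"] by (simp add: add.commute)
    then show "msum (strand a @ strand b) (strand (a + b)) (map (\<lambda>s. mg b a \<bullet> ?f s) [0..<Suc (min a b)])
        = of_nat ((a + b) choose b) *\<^sub>m mg a b"
      unfolding split_merge_cross
      by (subst (asm) comp_msum) (use ft in \<open>auto simp: add.commute simp del: upt_Suc\<close>)
  qed (auto simp: add.commute)
  then show ?case by (simp add: vandermonde_rest ident_tens flip: atLeastLessThan_upt del: upt_Suc)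
qed

lemma cross_split: "cr a b \<bullet> sp a b = sp b a"
proof (induction "a + b" arbitrary: a b rule: less_induct)
  case less
  let ?f = "\<lambda>s. (mg s (b - s) \<otimes>\<^sub>m mg (a - s) s) \<bullet> (\<one> s \<otimes>\<^sub>m cr (a - s) (b - s) \<otimes>\<^sub>m \<one> s)
      \<bullet> (sp s (a - s) \<otimes>\<^sub>m sp (b - s) s)"
  have ft: "msrc (?f s) = strand a @ strand b \<and> mtgt (?f s) = strand b @ strand a"
    if "s \<in> set [0..<Suc (min a b)]" for s
    using that by auto
  have "?f 0 \<bullet> sp a b = (of_nat ((a + b) choose b)
     - (\<Sum>s\<in>set [0..<Suc (min a b)] - {0}. of_nat (a choose s) * of_nat (b choose s))) *\<^sub>m sp b a"
  proof (rule msum_solve)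
    show "?f s \<bullet> sp a b = (of_nat (a choose s) * of_nat (b choose s)) *\<^sub>m sp b a"
      if "s \<in> set [0..<Suc (min a b)]" "s \<noteq> 0" for s
    proof -
      have s: "s + (a - s) = a" "s + (b - s) = b" "a - s + s = a" "b - s + s = b" "s \<le> b" "s \<le> a" using that by auto
      have "cr (a - s) (b - s) \<bullet> sp (a - s) (b - s) = sp (b - s) (a - s)"
        by (rule less) (use that in auto)
      from split_split_cross[OF this, of s s]
      have "?f s \<bullet> sp a b = ((mg s (b - s) \<bullet> sp s (b - s)) \<otimes>\<^sub>m (mg (a - s) s \<bullet> sp (a - s) s)) \<bullet> sp b a"
        by (simp add: s interchange comp_assoc)
      also have "\<dots> = (of_nat (a choose s) * of_nat (b choose s)) *\<^sub>m sp b a"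
        using s by (simp add: merge_split s ident_tens binomial_symmetric[of s a])
      finally show ?thesis .
    qed
    have "(sp b a \<bullet> mg a b) \<bullet> sp a b = of_nat ((a + b) choose b) *\<^sub>m sp b a"
      using merge_split[of a b] by (simp add: comp_assoc add.commute binomial_symmetric[of b "a + b"])
    then show "msum (strand (a + b)) (strand b @ strand a) (map (\<lambda>s. ?f s \<bullet> sp a b) [0..<Suc (min a b)])
        = of_nat ((a + b) choose b) *\<^sub>m sp b a"
      unfolding split_merge_cross
      by (subst (asm) msum_comp) (use ft in \<open>auto simp: add.commute simp del: upt_Suc\<close>)
  qed (auto simp: add.commute)
  then show ?case by (simp add: vandermonde_rest ident_tens flip: atLeastLessThan_upt del: upt_Suc)
qed

text \<open>Part of a thick strand is capped off against a second strand. The remainder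
  \<open>t\<close> is what makes the induction on crossings possible: capping off a merged strand
  means capping off its pieces in turn, with a thicker remainder for the first piece. For t = 0 this
  is the ordinary cap.\<close>

definition kcap :: "nat \<Rightarrow> nat \<Rightarrow> mor" where
  "kcap t b = (\<one> t \<otimes>\<^sub>m ca b) \<bullet> (sp t b \<otimes>\<^sub>m \<one> b)"

lemma kcap_typed [simp]: "msrc (kcap t b) = strand (t + b) @ strand b" "mtgt (kcap t b) = strand t" "wfm (kcap t b)"
  by (auto simp: kcap_def)

lemma kcap_merge:
  "kcap t (j + k) \<bullet> (\<one> (t + (j + k)) \<otimes>\<^sub>m mg j k) = kcap t k \<bullet> (kcap (t + k) j \<otimes>\<^sub>m \<one> k)"
proof -
  have "kcap t (j + k) \<bullet> (\<one> (t + (j + k)) \<otimes>\<^sub>m mg j k)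
      = lay (strand t) (ca (j + k)) [] \<bullet> lay (strand t @ strand (j + k)) (mg j k) [] \<bullet> lay [] (sp t (j + k)) (strand j @ strand k)"
    using lay_commute[of "[]" "sp t (j + k)" "[]" "mg j k" "[]"] by (simp add: diagram kcap_def)
  also have "\<dots> = lay (strand t) (ca k) [] \<bullet> lay (strand t @ strand k) (ca j) (strand k)
      \<bullet> lay (strand t) (sp k j) (strand j @ strand k) \<bullet> lay [] (sp t (k + j)) (strand j @ strand k)"
    using cap_split_left_lay[of "strand t" j k "[]"] by (simp add: add_ac)
  also have "\<dots> = lay (strand t) (ca k) [] \<bullet> lay (strand t @ strand k) (ca j) (strand k)
      \<bullet> lay [] (sp t k) (strand j @ strand j @ strand k) \<bullet> lay [] (sp (t + k) j) (strand j @ strand k)"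
    using split_coassoc_lay[of "[]" t k j "strand j @ strand k" "ident (strand (t + k + j) @ strand j @ strand k)"]
    by (simp add: add_ac)
  also have "\<dots> = kcap t k \<bullet> (kcap (t + k) j \<otimes>\<^sub>m \<one> k)"
    using lay_commute_comp[of "[]" "sp t k" "[]" "ca j" "strand k"] by (simp add: diagram kcap_def)
  finally show ?thesis .
qed

text \<open>By coassociativity the two pieces of thickness \<open>b\<close> can be split off
  together, and then a cap meets a split.\<close>

lemma kcap_split: "b > 0 \<Longrightarrow> kcap t b \<bullet> sp (t + b) b = mzero (strand (t + b + b)) (strand t)"
proof -
  assume b: "b > 0"
  have "kcap t b \<bullet> sp (t + b) b = lay (strand t) (ca b \<bullet> sp b b) [] \<bullet> sp t (b + b)"
    using split_coassoc_lay[of "[]" t b b "[]" "ident (strand (t + b + b))"]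
    by (simp add: kcap_def diagram add.assoc)
  also have "\<dots> = mzero (strand t @ strand (2 * b)) (strand t) \<bullet> sp t (b + b)"
    using b by (simp add: cap_split lay_zero strand_pos)
  also have "\<dots> = mzero (strand (t + b + b)) (strand t)"
    using zero_comp[of "sp t (b + b)"] by (simp add: mult_2 add.assoc)
  finally show ?thesis .
qed

text \<open>This is the summand of \<open>split_merge_straight\<close> in which strands of thickness
  \<open>j\<close> cross and \<open>k\<close> stays on its side. \<open>kcap_merge\<close> peels off
  \<open>j\<close>, the hypothesis removes the crossing, and merging \<open>j\<close> and
  \<open>k\<close> right after splitting them gives the binomial coefficient.\<close>

lemma kcap_exchange:
  assumes "kcap (t + k) j \<bullet> (mg (t + k) j \<otimes>\<^sub>m \<one> j) \<bullet> (\<one> (t + k) \<otimes>\<^sub>m cr j j) \<bullet> (sp (t + k) j \<otimes>\<^sub>m \<one> j)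
    = r *\<^sub>m kcap (t + k) j"
  shows "kcap t (j + k) \<bullet> (mg (t + k) j \<otimes>\<^sub>m mg j k) \<bullet> (\<one> (t + k) \<otimes>\<^sub>m cr j j \<otimes>\<^sub>m \<one> k)
      \<bullet> (sp (t + k) j \<otimes>\<^sub>m sp j k) = (r * of_nat ((j + k) choose j)) *\<^sub>m kcap t (j + k)"
proof -
  have m: "kcap t (j + k) \<bullet> lay (strand (t + k + j)) (mg j k) [] \<bullet> h
      = kcap t k \<bullet> lay [] (kcap (t + k) j) (strand k) \<bullet> h" for h
    using lay_cong[OF kcap_merge[of t j k], of "[]" "[]" h] by (simp add: diagram add_ac)
  have a: "lay [] (kcap (t + k) j) Y \<bullet> lay [] (mg (t + k) j) (strand j @ Y) \<bullet> lay (strand (t + k)) (cr j j) Y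
      \<bullet> lay [] (sp (t + k) j) (strand j @ Y) \<bullet> h = r *\<^sub>m lay [] (kcap (t + k) j) Y \<bullet> h" for Y h
    using lay_cong[OF assms, of "[]" Y h] by (simp add: diagram)
  have "kcap t (j + k) \<bullet> (mg (t + k) j \<otimes>\<^sub>m mg j k) \<bullet> (\<one> (t + k) \<otimes>\<^sub>m cr j j \<otimes>\<^sub>m \<one> k)
      \<bullet> (sp (t + k) j \<otimes>\<^sub>m sp j k) 
    = kcap t (j + k) \<bullet> lay (strand (t + k + j)) (mg j k) [] \<bullet> lay [] (mg (t + k) j) (strand j @ strand k) \<bullet>
       lay (strand (t + k)) (cr j j) (strand k) \<bullet> lay [] (sp (t + k) j) (strand j @ strand k) \<bullet>
       lay (strand (t + k + j)) (sp j k) []"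
    \<comment> \<open>This order of layers puts the right-hand merge directly below
      \<open>kcap\<close>, where \<open>kcap_merge\<close> applies.\<close>
    unfolding tens_lay'[of "mg (t + k) j"] by (simp add: diagram)
  also have "\<dots> = r *\<^sub>m (kcap t (j + k) \<bullet> lay (strand (t + k + j)) (mg j k) [] \<bullet> lay (strand (t + k + j)) (sp j k) [])"
    unfolding m a by simp
  also have "lay (strand (t + k + j)) (mg j k) [] \<bullet> lay (strand (t + k + j)) (sp j k) []
      = of_nat ((j + k) choose j) *\<^sub>m ident (strand (t + k + j) @ strand (j + k))"
    by (simp add: merge_split flip: lay_comp)
  finally show ?thesis by (simp add: add_ac)
qed

lemma alternating_rest:
  "b > 0 \<Longrightarrow> 0 - (\<Sum>s\<in>set [t..<Suc (t + b)] - {t}. (-1) ^ (t + b - s) * of_nat (b choose (t + b - s)))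
    = ((-1) ^ b :: jring)"
proof -
  assume b: "b > 0"
  have "(\<Sum>s\<in>set [t..<Suc (t + b)] - {t}. (-1) ^ (t + b - s) * of_nat (b choose (t + b - s)))
      = (\<Sum>j<b. (-1) ^ j * of_nat (b choose j) :: jring)"
    by (rule sum.reindex_bij_witness[of _ "\<lambda>j. t + b - j" "\<lambda>s. t + b - s"]) auto
  also have "\<dots> = (\<Sum>j\<le>b. (-1) ^ j * of_nat (b choose j)) - (-1) ^ b"
    by (simp flip: lessThan_Suc_atMost)
  finally show ?thesis using choose_alternating_sum[OF b, where 'a = jring] by simp
qed

text \<open>
  Since a cap annihilates a split, \<open>kcap t b\<close> annihilates both sides of \<open>split_merge_straight\<close>. One summand
  gives the left-hand side below, and by induction the others are multiples of \<open>kcap t b\<close>.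
\<close>

lemma kcap_cross:
  "kcap t b \<bullet> (mg t b \<otimes>\<^sub>m \<one> b) \<bullet> (\<one> t \<otimes>\<^sub>m cr b b) \<bullet> (sp t b \<otimes>\<^sub>m \<one> b) = (-1) ^ b *\<^sub>m kcap t b"
proof (induction b arbitrary: t rule: less_induct)
  case (less b)
  show ?case
  proof (cases "b = 0")
    case True
    then show ?thesis by (simp add: kcap_def)
  next
    case False
    then have b: "b > 0" by simp
    define a where "a = t + b"
    let ?f = "\<lambda>s. (mg s (a - s) \<otimes>\<^sub>m mg (a - s) (s + b - a)) \<bullet> (\<one> s \<otimes>\<^sub>m cr (a - s) (a - s) \<otimes>\<^sub>m \<one> (s + b - a))
      \<bullet> (sp s (a - s) \<otimes>\<^sub>m sp (a - s) (s + b - a))"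
    have ft: "msrc (?f s) = strand a @ strand b \<and> mtgt (?f s) = strand a @ strand b"
      if "s \<in> set [t..<Suc a]" for s
    proof -
      have "s + (a - s) = a" "a - s + (s + b - a) = b" using that a_def by auto
      then show ?thesis by simp
    qed
    have "kcap t b \<bullet> ?f t = (0 - (\<Sum>s\<in>set [t..<Suc a] - {t}. (-1) ^ (a - s) * of_nat (b choose (a - s)))) *\<^sub>m kcap t b"
    proof (rule msum_solve[where f = "\<lambda>s. kcap t b \<bullet> ?f s"])
      show "kcap t b \<bullet> ?f s = ((-1) ^ (a - s) * of_nat (b choose (a - s))) *\<^sub>m kcap t b"
        if "s \<in> set [t..<Suc a]" "s \<noteq> t" for s
      proof -
        \<comment> \<open>Here \<open>j\<close> is the thickness of the crossing strands and
          \<open>k\<close> that of the rest of \<open>b\<close>; s > t gives j < b, so the induction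
          hypothesis applies with remainder \<open>t + k\<close>.\<close>
        define j k where "j = a - s" and "k = s - t"
        have jk: "b = j + k" "s = t + k" "s + b - a = k" "a - s = j" "j < b"
          using that by (auto simp: j_def k_def a_def)
        show ?thesis
          using kcap_exchange[OF less[OF jk(5)], of t k]
          unfolding jk(3,4) unfolding jk(2) jk(1) .
      qed
      have "msum (strand a @ strand b) (strand t) (map (\<lambda>s. kcap t b \<bullet> ?f s) [t..<Suc a])
          = kcap t b \<bullet> (sp a b \<bullet> mg a b)"
        unfolding split_merge_straight using comp_msum[of "kcap t b" "strand a @ strand b" "strand a @ strand b" "[t..<Suc a]" ?f] ft
        by (simp add: a_def del: upt_Suc)
      also have "\<dots> = mzero (strand (a + b)) (strand t) \<bullet> mg a b"
        using kcap_split[OF b, of t] by (simp add: a_def flip: comp_assoc)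
      also have "\<dots> = 0 *\<^sub>m kcap t b"
        using zero_comp[of "mg a b"] scl_zero[of "kcap t b"] by (simp add: a_def)
      finally show "msum (strand a @ strand b) (strand t) (map (\<lambda>s. kcap t b \<bullet> ?f s) [t..<Suc a])
        = 0 *\<^sub>m kcap t b" .
    qed (auto simp: a_def)
    also have "0 - (\<Sum>s\<in>set [t..<Suc a] - {t}. (-1) ^ (a - s) * of_nat (b choose (a - s))) = ((-1) ^ b :: jring)"
      using alternating_rest[OF b] unfolding a_def .
    finally show ?thesis by (simp add: a_def)
  qed
qed

lemma cap_cross: "ca b \<bullet> cr b b = (-1) ^ b *\<^sub>m ca b"
  using kcap_cross[of 0 b] by (simp add: kcap_def ident_tens)

section \<open>Duality: cups from caps\<close>

lemma zigzag_left_lay: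
  "mtgt h = X @ strand a @ Y \<Longrightarrow> lay X (ca a) (strand a @ Y) \<bullet> lay (X @ strand a) (cu a) Y \<bullet> h = h"
  using lay_cong[OF zigzag_left, of X a Y h] by (simp add: diagram)

lemma zigzag_right_lay:
  "mtgt h = X @ strand a @ Y \<Longrightarrow> lay (X @ strand a) (ca a) Y \<bullet> lay X (cu a) (strand a @ Y) \<bullet> h = h"
  using lay_cong[OF zigzag_right, of X a Y h] by (simp add: diagram)

text \<open>The dual of \<open>cap_split_right\<close>. Insert a zigzag on the strand leaving the
  merge: the merge then reaches a cap, passes to the other side as a split, and the nested cups
  \<open>N\<close> straighten out against the nested caps. What remains is the left-hand side
  \<open>S\<close>.\<close>

lemma cup_split:
  "(sp b a \<otimes>\<^sub>m \<one> (b + a)) \<bullet> cu (b + a) = (\<one> b \<otimes>\<^sub>m \<one> a \<otimes>\<^sub>m mg a b) \<bullet> (\<one> b \<otimes>\<^sub>m cu a \<otimes>\<^sub>m \<one> b) \<bullet> cu b"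
proof -
  define N where "N = lay (strand b) (cu a) (strand b) \<bullet> cu b"
  define S where "S = lay [] (sp b a) (strand (a + b)) \<bullet> cu (a + b)"
  have N: "msrc N = []" "mtgt N = strand b @ strand a @ strand a @ strand b"
    and S: "msrc S = []" "mtgt S = strand b @ strand a @ strand (a + b)"
    by (simp_all add: N_def S_def add.commute)
  have "lay (strand b @ strand a) (mg a b) [] \<bullet> N
      = lay (strand b @ strand a) (ca (a + b)) (strand (a + b)) \<bullet> lay (strand b @ strand a @ strand (a + b)) (cu (a + b)) []
        \<bullet> lay (strand b @ strand a) (mg a b) [] \<bullet> N"
    using zigzag_left_lay[of "lay (strand b @ strand a) (mg a b) [] \<bullet> N" "strand b @ strand a" "a + b" "[]"] by simp
  also have "\<dots> = lay (strand b @ strand a) (ca (a + b)) (strand (a + b)) \<bullet>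
      lay (strand b @ strand a) (mg a b) (strand (a + b) @ strand (a + b)) \<bullet>
      lay (strand b @ strand a @ strand a @ strand b) (cu (a + b)) [] \<bullet> N"
    using lay_commute_comp[of "strand b @ strand a" "mg a b" "[]" "cu (a + b)" "[]" N] by simp
  also have "\<dots> = lay (strand b @ strand a) (ca a) (strand (a + b)) \<bullet>
      lay (strand b @ strand a @ strand a) (ca b) (strand a @ strand (a + b)) \<bullet> 
      lay (strand b @ strand a @ strand a @ strand b) S [] \<bullet> N"
    using cap_split_right_lay[of "strand b @ strand a" a b "strand (a + b)"] by (simp add: S_def diagram)
  also have "lay (strand b @ strand a @ strand a @ strand b) S [] \<bullet> N = lay [] N (mtgt S) \<bullet> S"
    using lay_commute[of "[]" N "[]" S "[]"] by (simp add: N S)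
  also have "lay (strand b @ strand a) (ca a) (strand (a + b)) \<bullet>
      lay (strand b @ strand a @ strand a) (ca b) (strand a @ strand (a + b)) \<bullet> lay [] N (mtgt S) \<bullet> S = S"
    using lay_commute_comp[of "strand b" "cu a" "[]" "ca b" "strand a @ strand (a + b)" 
          "lay [] (cu b) (strand b @ strand a @ strand (a + b)) \<bullet> S"]
        zigzag_right_lay[of S "[]" b "strand a @ strand (a + b)"]
        zigzag_right_lay[of S "strand b" a "strand (a + b)"]
    by (simp add: S N_def diagram)
  finally show ?thesis by (simp add: N_def S_def diagram add.commute)
qed

text \<open>Bend one leg of \<open>u\<close> down, slide the crossing under a cap, where it becomes
  a sign, straighten, and bend back.\<close>

lemma cross_cup: "cr b b \<bullet> cu b = (-1) ^ b *\<^sub>m cu b"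
proof -
  define u where "u = cr b b \<bullet> cu b"
  have u: "msrc u = []" "mtgt u = strand b @ strand b" by (simp_all add: u_def)
  have "(ca b \<otimes>\<^sub>m \<one> b) \<bullet> (\<one> b \<otimes>\<^sub>m u) = lay [] (ca b) (strand b) \<bullet> lay (strand b) (cr b b) [] \<bullet> lay (strand b) (cu b) []"
    by (simp add: u_def diagram)
  also have "\<dots> = lay (strand b) (ca b) [] \<bullet> lay [] (cr b b) (strand b) \<bullet> lay (strand b) (cu b) []"
    using lay_cong[OF cap_slide[of b b], of "[]" "[]"] by (simp add: diagram)
  also have "\<dots> = lay (strand b) (ca b \<bullet> cr b b) [] \<bullet> lay [] (cu b) (strand b)"
    using cup_slide[of b b] by (simp add: diagram)
  also have "\<dots> = (-1) ^ b *\<^sub>m \<one> b"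
    using zigzag_right[of b] by (simp add: cap_cross diagram)
  finally have *: "(ca b \<otimes>\<^sub>m \<one> b) \<bullet> (\<one> b \<otimes>\<^sub>m u) = (-1) ^ b *\<^sub>m \<one> b" .
  have "u = lay (strand b) (ca b) (strand b) \<bullet> lay [] (cu b) (strand b @ strand b) \<bullet> u"
    using zigzag_right_lay[of u "[]" b "strand b"] by (simp add: u)
  also have "lay [] (cu b) (strand b @ strand b) \<bullet> u = lay (strand b @ strand b) u [] \<bullet> cu b"
    using lay_commute[of "[]" "cu b" "[]" u "[]"] by (simp add: u)
  also have "lay (strand b) (ca b) (strand b) \<bullet> lay (strand b @ strand b) u [] \<bullet> cu b = (-1) ^ b *\<^sub>m cu b"
    using lay_cong[OF *, of "strand b" "[]" "cu b"] by (simp add: diagram u)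
  finally show ?thesis by (simp add: u_def)
qed

text \<open>\<open>cup_split\<close> exposes a partial trace between the legs of the smaller cup.
  Its scalar \<open>r\<close> is left open because the lemma is used within the induction that
  computes it.\<close>

lemma cap_splits_cup:
  assumes "(ca t \<otimes>\<^sub>m \<one> b) \<bullet> (\<one> t \<otimes>\<^sub>m (sp t b \<bullet> mg t b)) \<bullet> (cu t \<otimes>\<^sub>m \<one> b) = r *\<^sub>m \<one> b"
  shows "(\<one> b \<otimes>\<^sub>m ca t \<otimes>\<^sub>m \<one> b) \<bullet> (sp b t \<otimes>\<^sub>m sp t b) \<bullet> cu (b + t) = r *\<^sub>m cu b"
proof -
  have "(\<one> b \<otimes>\<^sub>m ca t \<otimes>\<^sub>m \<one> b) \<bullet> (sp b t \<otimes>\<^sub>m sp t b) \<bullet> cu (b + t)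
      = (\<one> b \<otimes>\<^sub>m ca t \<otimes>\<^sub>m \<one> b) \<bullet> lay (strand b @ strand t) (sp t b) [] \<bullet> (sp b t \<otimes>\<^sub>m \<one> (b + t)) \<bullet> cu (b + t)"
    unfolding tens_lay'[of "sp b t" "sp t b"] by (simp add: diagram add.commute)
  also have "\<dots> = lay (strand b) ((ca t \<otimes>\<^sub>m \<one> b) \<bullet> (\<one> t \<otimes>\<^sub>m (sp t b \<bullet> mg t b)) \<bullet> (cu t \<otimes>\<^sub>m \<one> b)) [] \<bullet> cu b"
    unfolding cup_split by (simp add: diagram)
  finally show ?thesis by (simp add: assms)
qed

text \<open>The cap over \<open>p + j\<close> breaks up into an inner cap over \<open>p\<close> and
  an outer one over \<open>j\<close>. Closing \<open>p\<close> yields \<open>r\<close>, the curl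
  left on \<open>j\<close> yields the sign, and the merge and split of \<open>j\<close> and
  \<open>q\<close> yield the binomial coefficient.\<close>

lemma partial_trace_exchange:
  assumes "(ca p \<otimes>\<^sub>m \<one> j) \<bullet> (\<one> p \<otimes>\<^sub>m (sp p j \<bullet> mg p j)) \<bullet> (cu p \<otimes>\<^sub>m \<one> j) = r *\<^sub>m \<one> j"
  shows "(ca (p + j) \<otimes>\<^sub>m \<one> (j + q)) \<bullet> (\<one> (p + j) \<otimes>\<^sub>m ((mg p j \<otimes>\<^sub>m mg j q) \<bullet> (\<one> p \<otimes>\<^sub>m cr j j \<otimes>\<^sub>m \<one> q)
      \<bullet> (sp p j \<otimes>\<^sub>m sp j q))) \<bullet> (cu (p + j) \<otimes>\<^sub>m \<one> (j + q))
    = (r * (-1) ^ j * of_nat ((j + q) choose j)) *\<^sub>m \<one> (j + q)"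
proof -
  define t where "t = p + j"
  note y = cap_splits_cup[OF assms]
  define R where "R = lay [] (ca t) (strand j) \<bullet> lay (strand t) (mg p j) (strand j) \<bullet> lay (strand t @ strand p) (cr j j) []
    \<bullet> lay (strand t) (sp p j) (strand j) \<bullet> lay [] (cu t) (strand j)"
  have "R = lay [] (ca j) (strand j) \<bullet> lay (strand j) (ca p) (strand j @ strand j)
      \<bullet> lay [] (sp j p) (strand p @ strand j @ strand j) \<bullet> lay (strand t @ strand p) (cr j j) []
    \<bullet> lay (strand t) (sp p j) (strand j) \<bullet> lay [] (cu t) (strand j)"
    using cap_split_left_lay[of "[]" p j "strand j"] by (simp add: R_def t_def)
  also have "\<dots> = lay [] (ca j) (strand j) \<bullet> lay (strand j) (ca p) (strand j @ strand j)
      \<bullet> lay (strand j @ strand p @ strand p) (cr j j) [] \<bullet> lay [] (sp j p) (strand p @ strand j @ strand j)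
    \<bullet> lay (strand t) (sp p j) (strand j) \<bullet> lay [] (cu t) (strand j)"
    using lay_commute_comp[of "[]" "sp j p" "strand p" "cr j j" "[]"] by (simp add: t_def add.commute)
  also have "\<dots> = lay [] (ca j) (strand j) \<bullet> lay (strand j) (cr j j) [] \<bullet> lay (strand j) (ca p) (strand j @ strand j)
      \<bullet> lay [] (sp j p) (strand p @ strand j @ strand j)
    \<bullet> lay (strand t) (sp p j) (strand j) \<bullet> lay [] (cu t) (strand j)"
    using lay_commute_comp[of "strand j" "ca p" "[]" "cr j j" "[]"] by simp
  also have "\<dots> = r *\<^sub>m (lay [] (ca j) (strand j) \<bullet> lay (strand j) (cr j j) [] \<bullet> lay [] (cu j) (strand j))"
    using lay_cong[OF y, of "[]" "strand j" "\<one> j"] by (simp add: diagram t_def add.commute)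
  \<comment> \<open>What remains is a curl; \<open>cup_slide\<close> brings its crossing onto the
    two legs of the cap, where it is the sign of \<open>cap_cross\<close>.\<close>
  also have "lay (strand j) (cr j j) [] \<bullet> lay [] (cu j) (strand j) = lay [] (cr j j) (strand j) \<bullet> lay (strand j) (cu j) []"
    using cup_slide[of j j] by (simp add: diagram)
  also have "lay [] (ca j) (strand j) \<bullet> lay [] (cr j j) (strand j) \<bullet> lay (strand j) (cu j) [] = (-1) ^ j *\<^sub>m \<one> j"
    using lay_cong[OF cap_cross[of j], of "[]" "strand j"] zigzag_left[of j] by (simp add: diagram)
  finally have R: "R = (r * (-1) ^ j) *\<^sub>m \<one> j" by simp
  have "(ca t \<otimes>\<^sub>m \<one> (j + q)) \<bullet> (\<one> t \<otimes>\<^sub>m ((mg p j \<otimes>\<^sub>m mg j q) \<bullet> (\<one> p \<otimes>\<^sub>m cr j j \<otimes>\<^sub>m \<one> q)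
      \<bullet> (sp p j \<otimes>\<^sub>m sp j q))) \<bullet> (cu t \<otimes>\<^sub>m \<one> (j + q))
    = lay [] (ca t) (strand (j + q)) \<bullet> lay (strand t @ strand t) (mg j q) [] \<bullet> lay (strand t) (mg p j) (strand j @ strand q) \<bullet>
      lay (strand t @ strand p) (cr j j) (strand q) \<bullet> lay (strand t) (sp p j) (strand j @ strand q) \<bullet>
      lay (strand t @ strand t) (sp j q) [] \<bullet> lay [] (cu t) (strand (j + q))"
    unfolding tens_lay'[of "mg p j"] by (simp add: diagram t_def)
  also have "\<dots> = mg j q \<bullet> lay [] R (strand q) \<bullet> sp j q"
    using lay_commute_comp[of "[]" "ca t" "[]" "mg j q" "[]"] lay_commute[of "[]" "cu t" "[]" "sp j q" "[]"]
    by (simp add: R_def diagram)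
  finally show ?thesis by (simp add: R merge_split ident_tens flip: t_def)
qed

text \<open>For natural z at least b both sides count the t-subsets of a z-set that avoid b marked
  elements, by inclusion and exclusion over the j marked elements that are forced in. Induction on b
  with Pascal's rule covers rational z.\<close>

lemma gbinomial_inclusion_exclusion:
  fixes z :: rat
  shows "(\<Sum>j\<le>t. (-1) ^ j * of_nat (b choose j) * ((z - of_nat j) gchoose (t - j))) = (z - of_nat b) gchoose t"
proof (induction b arbitrary: t z)
  case 0
  have "(\<Sum>j\<le>t. (-1) ^ j * of_nat (0 choose j) * ((z - of_nat j) gchoose (t - j)))
      = (\<Sum>j\<in>{0}. (-1) ^ j * of_nat (0 choose j) * ((z - of_nat j) gchoose (t - j)))"
    by (intro sum.mono_neutral_right) auto
  then show ?case by simp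
next
  case (Suc b)
  show ?case
  proof (cases t)
    case (Suc t')
    have "(\<Sum>j\<le>t. (-1) ^ j * of_nat (Suc b choose j) * ((z - of_nat j) gchoose (t - j)))
      = (\<Sum>j\<le>t. (-1) ^ j * of_nat (b choose j) * ((z - of_nat j) gchoose (t - j)))
        - (\<Sum>j\<le>t'. (-1) ^ j * of_nat (b choose j) * ((z - 1 - of_nat j) gchoose (t' - j)))"
      unfolding Suc sum.atMost_Suc_shift by (simp add: algebra_simps sum.distrib sum_subtractf sum_negf)
    also have "\<dots> = ((z - of_nat b) gchoose Suc t') - ((z - 1 - of_nat b) gchoose t')"
      by (simp only: Suc.IH Suc)
    also have "\<dots> = (z - of_nat (Suc b)) gchoose Suc t'"
      using gbinomial_Suc_Suc[of "z - of_nat (Suc b)" t'] by (simp add: algebra_simps)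
    finally show ?thesis by (simp add: Suc)
  qed simp
qed

lemma xbinom_inclusion_exclusion:
  "(\<Sum>s\<in>set [t - b..<Suc t]. xbinom (- int (t - s)) s * (-1) ^ (t - s) * of_nat (b choose (t - s)))
    = xbinom (- int b) t"
proof (rule jring_eqI)
  fix z
  have "(\<Sum>s\<in>set [t - b..<Suc t]. jev (xbinom (- int (t - s)) s * (-1) ^ (t - s) * of_nat (b choose (t - s))) z)
    = (\<Sum>s\<le>t. jev (xbinom (- int (t - s)) s * (-1) ^ (t - s) * of_nat (b choose (t - s))) z)"
    by (rule sum.mono_neutral_left) (auto simp del: upt_Suc)
  also have "\<dots> = (\<Sum>j\<le>t. (-1) ^ j * of_nat (b choose j) * ((z - of_nat j) gchoose (t - j)))"
    by (rule sum.reindex_bij_witness[of _ "\<lambda>j. t - j" "\<lambda>s. t - s"]) (auto simp: of_nat_diff algebra_simps)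
  also have "\<dots> = jev (xbinom (- int b) t) z"
    by (simp add: gbinomial_inclusion_exclusion)
  finally show "jev (\<Sum>s\<in>set [t - b..<Suc t]. xbinom (- int (t - s)) s * (-1) ^ (t - s) * of_nat (b choose (t - s))) z
    = jev (xbinom (- int b) t) z"
    by (simp only: jev_sum)
qed

lemma partial_trace_msum:
  assumes "\<And>i. i \<in> set is \<Longrightarrow> msrc (f i) = strand t @ strand b \<and> mtgt (f i) = strand t @ strand b"
  shows "(ca t \<otimes>\<^sub>m \<one> b) \<bullet> (\<one> t \<otimes>\<^sub>m msum (strand t @ strand b) (strand t @ strand b) (map f is)) \<bullet> (cu t \<otimes>\<^sub>m \<one> b)
    = msum (strand b) (strand b) (map (\<lambda>i. (ca t \<otimes>\<^sub>m \<one> b) \<bullet> (\<one> t \<otimes>\<^sub>m f i) \<bullet> (cu t \<otimes>\<^sub>m \<one> b)) is)"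
proof -
  have l: "\<one> t \<otimes>\<^sub>m f = lay (strand t) f []" for f by (simp add: lay_def)
  show ?thesis unfolding l using assms by (simp add: lay_msum msum_comp comp_msum)
qed

text \<open>
  In each summand of \<open>split_merge_straight\<close> the cap slides through the crossing, which leaves a partial
  trace over a strand of smaller thickness.
\<close>

lemma partial_trace:
  "(ca t \<otimes>\<^sub>m \<one> b) \<bullet> (\<one> t \<otimes>\<^sub>m (sp t b \<bullet> mg t b)) \<bullet> (cu t \<otimes>\<^sub>m \<one> b) = xbinom (- int b) t *\<^sub>m \<one> b"
proof (induction t arbitrary: b rule: less_induct)
  case (less t)
  show ?case
  proof (cases "b = 0")
    case True
    then show ?thesis by (simp add: circle ident_tens)
  next
    case False
    let ?f = "\<lambda>s. (mg s (t - s) \<otimes>\<^sub>m mg (t - s) (s + b - t)) \<bullet> (\<one> s \<otimes>\<^sub>m cr (t - s) (t - s) \<otimes>\<^sub>m \<one> (s + b - t))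
      \<bullet> (sp s (t - s) \<otimes>\<^sub>m sp (t - s) (s + b - t))"
    let ?g = "\<lambda>s. (ca t \<otimes>\<^sub>m \<one> b) \<bullet> (\<one> t \<otimes>\<^sub>m ?f s) \<bullet> (cu t \<otimes>\<^sub>m \<one> b)"
    have ft: "msrc (?f s) = strand t @ strand b \<and> mtgt (?f s) = strand t @ strand b"
      if "s \<in> set [t - b..<Suc t]" for s
    proof -
      have "s + (t - s) = t" "t - s + (s + b - t) = b" using that by auto
      then show ?thesis by simp
    qed
    have "(ca t \<otimes>\<^sub>m \<one> b) \<bullet> (\<one> t \<otimes>\<^sub>m (sp t b \<bullet> mg t b)) \<bullet> (cu t \<otimes>\<^sub>m \<one> b)
        = msum (strand b) (strand b) (map ?g [t - b..<Suc t])"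
      unfolding split_merge_straight by (rule partial_trace_msum[OF ft])
    also have "\<dots> = (\<Sum>s\<in>set [t - b..<Suc t]. xbinom (- int (t - s)) s * (-1) ^ (t - s) * of_nat (b choose (t - s))) *\<^sub>m \<one> b"
    proof (rule msum_scl)
      fix s assume s: "s \<in> set [t - b..<Suc t]"
      define j q where "j = t - s" and "q = s + b - t"
      have jq: "b = j + q" "t = s + j" "t - s = j" "s + b - t = q" using s by (auto simp: j_def q_def)
      have "(ca s \<otimes>\<^sub>m \<one> j) \<bullet> (\<one> s \<otimes>\<^sub>m (sp s j \<bullet> mg s j)) \<bullet> (cu s \<otimes>\<^sub>m \<one> j) = xbinom (- int j) s *\<^sub>m \<one> j"
      \<comment> \<open>For j = 0 the index s equals t and is out of reach of the induction
        hypothesis, but then the diagram is a circle.\<close>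
      proof (cases "j = 0")
        case True then show ?thesis by (simp add: circle ident_tens)
      next
        case False then show ?thesis using less[of s j] jq by simp
      qed
      from partial_trace_exchange[OF this, of q]
      show "?g s = (xbinom (- int (t - s)) s * (-1) ^ (t - s) * of_nat (b choose (t - s))) *\<^sub>m \<one> b"
        unfolding jq(3,4) unfolding jq(1,2) .
    qed auto
    finally show ?thesis by (simp only: xbinom_inclusion_exclusion)
  qed
qed


section \<open>Traces of dotted strands\<close>

definition dotted :: "nat \<Rightarrow> nat \<Rightarrow> mor" where
  "dotted b t = mg b t \<bullet> (dt b \<otimes>\<^sub>m \<one> t) \<bullet> sp b t"

lemma dotted_typed [simp]:
  "msrc (dotted b t) = strand (b + t)" "mtgt (dotted b t) = strand (b + t)" "wfm (dotted b t)"
  by (auto simp: dotted_def)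

lemma dotted_0 [simp]: "dotted b 0 = dt b"
  by (simp add: dotted_def)

text \<open>Coassociativity turns the capped pair of pieces into a split directly below the cap.
  This kills every summand with r > 0 on the left of \<open>dot_cross\<close> once a split is
  attached below.\<close>

lemma cap_splits_split:
  assumes "r > 0"
  shows "(\<one> p \<otimes>\<^sub>m ca r \<otimes>\<^sub>m \<one> q) \<bullet> (sp p r \<otimes>\<^sub>m sp r q) \<bullet> sp (p + r) (r + q)
    = mzero (strand (p + r + (r + q))) (strand p @ strand q)"
proof -
  have "(\<one> p \<otimes>\<^sub>m ca r \<otimes>\<^sub>m \<one> q) \<bullet> (sp p r \<otimes>\<^sub>m sp r q) \<bullet> sp (p + r) (r + q)
      = lay [] (kcap p r \<bullet> sp (p + r) r) (strand q) \<bullet> sp (p + r + r) q"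
    using split_coassoc_lay[of "[]" "p + r" r q "[]" "ident (strand (p + r + (r + q)))"]
    by (simp add: diagram kcap_def add.assoc)
  also have "\<dots> = mzero (strand (p + r + r) @ strand q) (strand p @ strand q) \<bullet> sp (p + r + r) q"
    using kcap_split[OF assms, of p] by (simp add: lay_zero)
  also have "\<dots> = mzero (strand (p + r + (r + q))) (strand p @ strand q)"
    using zero_comp[of "sp (p + r + r) q"] by (simp add: add.assoc)
  finally show ?thesis .
qed

text \<open>Sandwich \<open>dot_cross\<close> between \<open>mg b t\<close> and
  \<open>sp t b\<close>. On the left only r = 0 survives, and \<open>cross_split\<close> makes it
  \<open>dotted b t\<close>. On the right the merge absorbs the crossing, the undotted pieces
  \<open>r\<close> and \<open>t - r\<close> recombine to \<open>t\<close> with a binomial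
  coefficient, and the dotted piece \<open>b - r\<close> stays with its partner
  \<open>r\<close>.\<close>

lemma dotted_shift:
  "dotted b t = msum (strand (t + b)) (strand (t + b)) (map (\<lambda>r. (of_nat (fact r) * of_nat (t choose r)) *\<^sub>m
     (mg t b \<bullet> (\<one> t \<otimes>\<^sub>m dotted (b - r) r) \<bullet> sp t b)) [0..<Suc (min t b)])"
proof -
  let ?L = "\<lambda>r. (mg (b - r) r \<otimes>\<^sub>m mg r (t - r)) \<bullet> (\<one> (b - r) \<otimes>\<^sub>m cu r \<otimes>\<^sub>m \<one> (t - r))
       \<bullet> (dt (b - r) \<otimes>\<^sub>m \<one> (t - r)) \<bullet> cr (t - r) (b - r)
       \<bullet> (\<one> (t - r) \<otimes>\<^sub>m ca r \<otimes>\<^sub>m \<one> (b - r)) \<bullet> (sp (t - r) r \<otimes>\<^sub>m sp r (b - r))"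
  let ?R = "\<lambda>r. (mg r (b - r) \<otimes>\<^sub>m mg (t - r) r) \<bullet> (\<one> r \<otimes>\<^sub>m cr (t - r) (b - r) \<otimes>\<^sub>m \<one> r)
       \<bullet> (\<one> r \<otimes>\<^sub>m \<one> (t - r) \<otimes>\<^sub>m dt (b - r) \<otimes>\<^sub>m \<one> r) \<bullet> (sp r (t - r) \<otimes>\<^sub>m sp (b - r) r)"
  let ?is = "[0..<Suc (min t b)]" and ?X = "strand t @ strand b" and ?Y = "strand b @ strand t"
  let ?n = "strand (t + b)"
  have close: "mg b t \<bullet> msum ?X ?Y (map (\<lambda>r. c r *\<^sub>m F r) ?is) \<bullet> sp t b
      = msum ?n ?n (map (\<lambda>r. c r *\<^sub>m (mg b t \<bullet> F r \<bullet> sp t b)) ?is)"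
    if "\<And>r. r \<in> set ?is \<Longrightarrow> msrc (F r) = ?X \<and> mtgt (F r) = ?Y" for F and c :: "nat \<Rightarrow> jring"
    using that by (simp add: msum_comp comp_msum add.commute del: upt_Suc set_upt)
  have e: "b - r + r = b" "r + (b - r) = b" "t - r + r = t" "r + (t - r) = t" if "r \<in> set ?is" for r
    using that by auto
  \<comment> \<open>The indicator coefficient expresses the vanishing of all summands but one in the
    form required by \<open>msum_scl\<close>.\<close>
  have L: "msum ?n ?n (map (\<lambda>r. of_nat (fact r) *\<^sub>m (mg b t \<bullet> ?L r \<bullet> sp t b)) ?is)
      = (\<Sum>r\<in>set ?is. if r = 0 then 1 else 0) *\<^sub>m dotted b t"
  proof (rule msum_scl)
    fix r assume r: "r \<in> set ?is"
    show "of_nat (fact r) *\<^sub>m (mg b t \<bullet> ?L r \<bullet> sp t b) = (if r = 0 then 1 else 0) *\<^sub>m dotted b t"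
    proof (cases "r = 0")
      case True
      then show ?thesis using cross_split[of t b] by (simp add: ident_tens dotted_def comp_assoc)
    next
      case False
      then have "(\<one> (t - r) \<otimes>\<^sub>m ca r \<otimes>\<^sub>m \<one> (b - r)) \<bullet> (sp (t - r) r \<otimes>\<^sub>m sp r (b - r)) \<bullet> sp t b
          = mzero ?n (strand (t - r) @ strand (b - r))"
        using cap_splits_split[of r "t - r" "b - r"] e[OF r] by simp
      then have "mg b t \<bullet> ?L r \<bullet> sp t b = (mg b t \<bullet> (mg (b - r) r \<otimes>\<^sub>m mg r (t - r)) \<bullet> (\<one> (b - r) \<otimes>\<^sub>m cu r \<otimes>\<^sub>m \<one> (t - r))
       \<bullet> (dt (b - r) \<otimes>\<^sub>m \<one> (t - r)) \<bullet> cr (t - r) (b - r)) \<bullet> mzero ?n (strand (t - r) @ strand (b - r))"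
        by (simp add: comp_assoc)
      also have "\<dots> = mzero ?n ?n"
        by (subst comp_zero) (auto simp: e[OF r] add.commute)
      also have "\<dots> = 0 *\<^sub>m dotted b t" using scl_zero[of "dotted b t"] by (simp add: add.commute)
      finally show ?thesis using False scl_zero[of "dotted b t"] by (simp add: add.commute)
    qed
  qed (auto simp: add.commute)
  have "(\<Sum>r\<in>set ?is. if r = 0 then 1 else 0 :: jring) = 1"
    by (simp add: sum.delta del: upt_Suc)
  with L have "dotted b t = msum ?n ?n (map (\<lambda>r. of_nat (fact r) *\<^sub>m (mg b t \<bullet> ?L r \<bullet> sp t b)) ?is)"
    by simp
  also have "\<dots> = mg b t \<bullet> msum ?X ?Y (map (\<lambda>r. of_nat (fact r) *\<^sub>m ?L r) ?is) \<bullet> sp t b"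
    by (rule close[symmetric]) (simp add: e)
  also have "\<dots> = mg b t \<bullet> msum ?X ?Y (map (\<lambda>r. of_nat (fact r) *\<^sub>m ?R r) ?is) \<bullet> sp t b"
    by (simp only: dot_cross)
  also have "\<dots> = msum ?n ?n (map (\<lambda>r. of_nat (fact r) *\<^sub>m (mg b t \<bullet> ?R r \<bullet> sp t b)) ?is)"
    by (rule close) (simp add: e)
  also have "map (\<lambda>r. of_nat (fact r) *\<^sub>m (mg b t \<bullet> ?R r \<bullet> sp t b)) ?is
     = map (\<lambda>r. (of_nat (fact r) * of_nat (t choose r)) *\<^sub>m
     (mg t b \<bullet> (\<one> t \<otimes>\<^sub>m dotted (b - r) r) \<bullet> sp t b)) ?is"
  proof (rule map_cong[OF HOL.refl])
    fix r assume r: "r \<in> set ?is"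
    have "mg b t \<bullet> ?R r \<bullet> sp t b = mg t b \<bullet> (mg r (t - r) \<otimes>\<^sub>m mg (b - r) r)
        \<bullet> (\<one> r \<otimes>\<^sub>m \<one> (t - r) \<otimes>\<^sub>m dt (b - r) \<otimes>\<^sub>m \<one> r) \<bullet> (sp r (t - r) \<otimes>\<^sub>m sp (b - r) r) \<bullet> sp t b"
      using merge_merge_cross[OF merge_cross, of r "b - r" "t - r" r] by (simp add: comp_assoc e[OF r])
    also have "(mg r (t - r) \<otimes>\<^sub>m mg (b - r) r)
        \<bullet> (\<one> r \<otimes>\<^sub>m \<one> (t - r) \<otimes>\<^sub>m dt (b - r) \<otimes>\<^sub>m \<one> r) \<bullet> (sp r (t - r) \<otimes>\<^sub>m sp (b - r) r) \<bullet> sp t b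
        = ((mg r (t - r) \<bullet> ident (strand r @ strand (t - r)) \<bullet> sp r (t - r)) \<otimes>\<^sub>m dotted (b - r) r) \<bullet> sp t b"
      by (simp add: dotted_def interchange comp_assoc flip: ident_tens tens_assoc)
    also have "\<dots> = of_nat (t choose r) *\<^sub>m ((\<one> t \<otimes>\<^sub>m dotted (b - r) r) \<bullet> sp t b)"
      by (simp add: merge_split e[OF r])
    finally show "of_nat (fact r) *\<^sub>m (mg b t \<bullet> ?R r \<bullet> sp t b) = (of_nat (fact r) * of_nat (t choose r)) *\<^sub>m
     (mg t b \<bullet> (\<one> t \<otimes>\<^sub>m dotted (b - r) r) \<bullet> sp t b)"
      by simp
  qed
  finally show ?thesis .
qed

section \<open>Closing up diagrams\<close>

definition trace :: "nat \<Rightarrow> mor \<Rightarrow> mor" where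
  "trace a f = ca a \<bullet> (\<one> a \<otimes>\<^sub>m f) \<bullet> cu a"

definition mbubble :: "nat \<Rightarrow> mor" where
  "mbubble a = ca a \<bullet> (dt a \<otimes>\<^sub>m \<one> a) \<bullet> cu a"

lemma mbubble_typed [simp]: "msrc (mbubble a) = []" "mtgt (mbubble a) = []" "wfm (mbubble a)"
  by (auto simp: mbubble_def)

lemma trace_typed [simp]: "msrc (trace a f) = []" "mtgt (trace a f) = []" 
   "wfm f \<Longrightarrow> msrc f = strand a \<Longrightarrow> mtgt f = strand a \<Longrightarrow> wfm (trace a f)"
  by (auto simp: trace_def)

text \<open>The sign appears because \<open>trace\<close> has the dot on the right leg and
  \<open>mbubble\<close> on the left one.\<close>

lemma trace_dot: "trace b (dt b) = (-1) ^ b *\<^sub>m mbubble b"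
proof -
  have "(-1) ^ b *\<^sub>m mbubble b = (-1) ^ b *\<^sub>m ((ca b \<bullet> (dt b \<otimes>\<^sub>m \<one> b)) \<bullet> cu b)"
    by (simp add: mbubble_def comp_assoc)
  also have "\<dots> = trace b (dt b)"
    unfolding cap_dot by (simp add: trace_def comp_assoc flip: power_mult_distrib)
  finally show ?thesis by simp
qed

lemma cap_dot_cross_cup: "ca b \<bullet> (dt b \<otimes>\<^sub>m \<one> b) \<bullet> cr b b \<bullet> cu b = (-1) ^ b *\<^sub>m mbubble b"
  by (simp add: cross_cup mbubble_def)

lemmas cap_splits_cup_scalar = cap_splits_cup[OF partial_trace]

text \<open>The undotted strand \<open>t\<close> is innermost, so \<open>cap_split_left\<close>
  closes it with an inner cap of its own. Layers on disjoint strands let \<open>f\<close> move above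
  that cap, and \<open>cap_splits_cup_scalar\<close> evaluates what is below.\<close>

lemma trace_sandwich:
  assumes "hom (strand b) (strand b) f"
  shows "trace (b + t) (mg t b \<bullet> (\<one> t \<otimes>\<^sub>m f) \<bullet> sp t b) = xbinom (- int b) t *\<^sub>m trace b f"
proof -
  let ?n = "strand (t + b)"
  have "trace (b + t) (mg t b \<bullet> (\<one> t \<otimes>\<^sub>m f) \<bullet> sp t b)
      = ca (t + b) \<bullet> lay ?n (mg t b) [] \<bullet> lay (?n @ strand t) f [] \<bullet> lay ?n (sp t b) [] \<bullet> cu (t + b)"
    by (simp add: trace_def diagram assms add.commute)
  also have "\<dots> = ca b \<bullet> lay (strand b) (ca t) (strand b) \<bullet> lay [] (sp b t) (strand t @ strand b) \<bullet>
      lay (?n @ strand t) f [] \<bullet> lay ?n (sp t b) [] \<bullet> cu (t + b)"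
    using cap_split_left_lay[of "[]" t b "[]"] by simp
  also have "\<dots> = ca b \<bullet> lay (strand b) (ca t) (strand b) \<bullet> lay (strand b @ strand t @ strand t) f [] \<bullet>
      lay [] (sp b t) (strand t @ strand b) \<bullet> lay ?n (sp t b) [] \<bullet> cu (t + b)"
    using lay_commute_comp[of "[]" "sp b t" "strand t" f "[]"] by (simp add: assms add.commute)
  also have "\<dots> = ca b \<bullet> lay (strand b) f [] \<bullet> lay (strand b) (ca t) (strand b) \<bullet> 
      lay [] (sp b t) (strand t @ strand b) \<bullet> lay ?n (sp t b) [] \<bullet> cu (t + b)"
    using lay_commute_comp[of "strand b" "ca t" "[]" f "[]"] by (simp add: assms)
  also have "\<dots> = xbinom (- int b) t *\<^sub>m trace b f"
    using cap_splits_cup_scalar[of b t] by (simp add: diagram add.commute trace_def assms)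
  finally show ?thesis .
qed

lemma comp_msum_comp:
  assumes "hom Y [] u" "hom [] X v" "\<And>i. i \<in> set is \<Longrightarrow> msrc (f i) = X \<and> mtgt (f i) = Y"
  shows "u \<bullet> msum X Y (map f is) \<bullet> v = msum [] [] (map (\<lambda>i. u \<bullet> f i \<bullet> v) is)"
  using assms wfm_mtgt[of v] wfm_msrc[of u] by (simp add: msum_comp comp_msum)

lemma scl_msum:
  "\<lbrakk>0 \<notin> set X; 0 \<notin> set Y\<rbrakk> \<Longrightarrow> r *\<^sub>m msum X Y (map f is) = msum X Y (map (\<lambda>i. r *\<^sub>m f i) is)"
  by (induction "is") (simp_all add: scl_plus)

lemma trace_dotted:
  "trace (b + t) (dotted b t) = xbinom (- int b) t *\<^sub>m msum [] []
    (map (\<lambda>r. (of_nat (fact r) * of_nat (t choose r)) *\<^sub>m trace b (dotted (b - r) r)) [0..<Suc (min t b)])"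
proof -
  let ?n = "strand (t + b)"
  let ?f = "\<lambda>r. (of_nat (fact r) * of_nat (t choose r) :: jring) *\<^sub>m
     (mg t b \<bullet> (\<one> t \<otimes>\<^sub>m dotted (b - r) r) \<bullet> sp t b)"
  let ?is = "[0..<Suc (min t b)]"
  have "trace (b + t) (dotted b t) = ca (t + b) \<bullet> msum (?n @ ?n) (?n @ ?n) (map (\<lambda>r. lay ?n (?f r) []) ?is) \<bullet> cu (t + b)"
  proof -
    have "\<one> (t + b) \<otimes>\<^sub>m dotted b t = lay ?n (dotted b t) []" by (simp add: lay_def)
    also have "\<dots> = msum (?n @ ?n) (?n @ ?n) (map (\<lambda>r. lay ?n (?f r) []) ?is)"
      by (subst dotted_shift, subst lay_msum) simp_all
    finally show ?thesis by (simp add: trace_def add.commute)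
  qed
  also have "\<dots> = msum [] [] (map (\<lambda>r. ca (t + b) \<bullet> lay ?n (?f r) [] \<bullet> cu (t + b)) ?is)"
    by (rule comp_msum_comp) auto
  also have "map (\<lambda>r. ca (t + b) \<bullet> lay ?n (?f r) [] \<bullet> cu (t + b)) ?is = map (\<lambda>r. xbinom (- int b) t *\<^sub>m
     ((of_nat (fact r) * of_nat (t choose r)) *\<^sub>m trace b (dotted (b - r) r))) ?is"
  proof (rule map_cong[OF HOL.refl])
    fix r assume "r \<in> set ?is"
    then have "hom (strand b) (strand b) (dotted (b - r) r)" by auto
    from trace_sandwich[OF this, of t]
    show "ca (t + b) \<bullet> lay ?n (?f r) [] \<bullet> cu (t + b) = xbinom (- int b) t *\<^sub>m
     ((of_nat (fact r) * of_nat (t choose r)) *\<^sub>m trace b (dotted (b - r) r))"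
      by (simp add: trace_def add.commute lay_def mult_ac)
  qed
  finally show ?thesis by (simp only: scl_msum list.set empty_iff not_False_eq_True)
qed

lemma cap_merges_cup:
  "ca (b + t) \<bullet> (mg b t \<otimes>\<^sub>m mg t b) \<bullet> (\<one> b \<otimes>\<^sub>m cu t \<otimes>\<^sub>m \<one> b) = xbinom (- int b) t *\<^sub>m ca b"
proof -
  have "ca (b + t) \<bullet> (mg b t \<otimes>\<^sub>m mg t b) \<bullet> (\<one> b \<otimes>\<^sub>m cu t \<otimes>\<^sub>m \<one> b)
      = ca b \<bullet> lay (strand b) ((ca t \<otimes>\<^sub>m \<one> b) \<bullet> (\<one> t \<otimes>\<^sub>m (sp t b \<bullet> mg t b)) \<bullet> (cu t \<otimes>\<^sub>m \<one> b)) []"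
    using cap_split_right_lay[of "[]" b t "[]"] by (simp add: diagram add.commute)
  then show ?thesis by (simp add: partial_trace)
qed

text \<open>The square arises from two partial traces over \<open>t\<close>, one above the dot
  closed by the outer cap and one below the crossing closed by the outer cup. The sign comes from
  the crossing on the remaining cup.\<close>

lemma dot_cross_left_closed:
  "ca (b + t) \<bullet> ((mg b t \<otimes>\<^sub>m mg t b) \<bullet> (\<one> b \<otimes>\<^sub>m cu t \<otimes>\<^sub>m \<one> b)
       \<bullet> (dt b \<otimes>\<^sub>m \<one> b) \<bullet> cr b b \<bullet> (\<one> b \<otimes>\<^sub>m ca t \<otimes>\<^sub>m \<one> b) \<bullet> (sp b t \<otimes>\<^sub>m sp t b)) \<bullet> cu (b + t)
   = ((xbinom (- int b) t)\<^sup>2 * (-1) ^ b) *\<^sub>m mbubble b" (is "?l = _")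
proof -
  have "?l = (ca (b + t) \<bullet> (mg b t \<otimes>\<^sub>m mg t b) \<bullet> (\<one> b \<otimes>\<^sub>m cu t \<otimes>\<^sub>m \<one> b)) \<bullet> (dt b \<otimes>\<^sub>m \<one> b) \<bullet> cr b b
       \<bullet> ((\<one> b \<otimes>\<^sub>m ca t \<otimes>\<^sub>m \<one> b) \<bullet> (sp b t \<otimes>\<^sub>m sp t b) \<bullet> cu (b + t))"
    by (simp only: comp_assoc)
  also have "\<dots> = ((xbinom (- int b) t)\<^sup>2 * (-1) ^ b) *\<^sub>m mbubble b"
    unfolding cap_merges_cup cap_splits_cup_scalar by (simp add: cap_dot_cross_cup power2_eq_square mult.assoc)
  finally show ?thesis .
qed

lemma dot_cross_right_closed:
  "ca (b + t) \<bullet> ((mg t b \<otimes>\<^sub>m mg b t) \<bullet> (\<one> t \<otimes>\<^sub>m cr b b \<otimes>\<^sub>m \<one> t)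
       \<bullet> (\<one> t \<otimes>\<^sub>m \<one> b \<otimes>\<^sub>m dt b \<otimes>\<^sub>m \<one> t) \<bullet> (sp t b \<otimes>\<^sub>m sp b t)) \<bullet> cu (b + t)
   = (-1) ^ b *\<^sub>m trace (b + t) (dotted b t)" (is "?l = _")
proof -
  let ?n = "strand (b + t)"
  have m: "ca (b + t) \<bullet> lay ?n (mg b t) [] \<bullet> h = ca t \<bullet> lay [] (kcap t b) (strand t) \<bullet> h" for h
    using lay_cong[OF kcap_merge[of 0 b t], of "[]" "[]" h] by (simp add: diagram kcap_def)
  have a: "lay [] (kcap t b) Y \<bullet> lay [] (mg t b) (strand b @ Y) \<bullet> lay (strand t) (cr b b) Y
      \<bullet> lay [] (sp t b) (strand b @ Y) \<bullet> h = (-1) ^ b *\<^sub>m lay [] (kcap t b) Y \<bullet> h" for Y h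
    using lay_cong[OF kcap_cross[of t b], of "[]" Y h] by (simp add: diagram)
  have "?l = ca (b + t) \<bullet> lay ?n (mg b t) [] \<bullet> lay [] (mg t b) (strand b @ strand t) \<bullet> lay (strand t) (cr b b) (strand t)
      \<bullet> lay (strand t @ strand b) (dt b) (strand t) \<bullet> lay [] (sp t b) (strand b @ strand t) \<bullet> lay ?n (sp b t) [] \<bullet> cu (b + t)"
    unfolding tens_lay'[of "mg t b"] by (simp add: diagram add.commute)
  also have "\<dots> = ca (b + t) \<bullet> lay ?n (mg b t) [] \<bullet> lay [] (mg t b) (strand b @ strand t) \<bullet> lay (strand t) (cr b b) (strand t)
      \<bullet> lay [] (sp t b) (strand b @ strand t) \<bullet> lay ?n (dt b) (strand t) \<bullet> lay ?n (sp b t) [] \<bullet> cu (b + t)"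
    using lay_commute_comp[of "[]" "sp t b" "[]" "dt b" "strand t"] by (simp add: add.commute)
  also have "\<dots> = (-1) ^ b *\<^sub>m (ca (b + t) \<bullet> lay ?n (mg b t) [] \<bullet> lay ?n (dt b) (strand t) \<bullet> lay ?n (sp b t) [] \<bullet> cu (b + t))"
    unfolding m a by simp
  also have "\<dots> = (-1) ^ b *\<^sub>m trace (b + t) (dotted b t)"
    by (simp add: trace_def dotted_def diagram)
  finally show ?thesis .
qed

lemma bubble_relation:
  "msum [] [] (map (\<lambda>t. (of_nat (fact t) * ((xbinom (- int (a - t)) t)\<^sup>2 * (-1) ^ (a - t))) *\<^sub>m mbubble (a - t)) [0..<Suc a])
   = msum [] [] (map (\<lambda>t. (of_nat (fact t) * (-1) ^ (a - t)) *\<^sub>m trace a (dotted (a - t) t)) [0..<Suc a])"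
proof -
  let ?L = "\<lambda>t. of_nat (fact t) *\<^sub>m ((mg (a - t) t \<otimes>\<^sub>m mg t (a - t)) \<bullet> (\<one> (a - t) \<otimes>\<^sub>m cu t \<otimes>\<^sub>m \<one> (a - t))
       \<bullet> (dt (a - t) \<otimes>\<^sub>m \<one> (a - t)) \<bullet> cr (a - t) (a - t)
       \<bullet> (\<one> (a - t) \<otimes>\<^sub>m ca t \<otimes>\<^sub>m \<one> (a - t)) \<bullet> (sp (a - t) t \<otimes>\<^sub>m sp t (a - t)))"
  let ?R = "\<lambda>t. of_nat (fact t) *\<^sub>m ((mg t (a - t) \<otimes>\<^sub>m mg (a - t) t) \<bullet> (\<one> t \<otimes>\<^sub>m cr (a - t) (a - t) \<otimes>\<^sub>m \<one> t)
       \<bullet> (\<one> t \<otimes>\<^sub>m \<one> (a - t) \<otimes>\<^sub>m dt (a - t) \<otimes>\<^sub>m \<one> t) \<bullet> (sp t (a - t) \<otimes>\<^sub>m sp (a - t) t))"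
  let ?is = "[0..<Suc a]"
  have e: "a - t + t = a" "t + (a - t) = a" if "t \<in> set ?is" for t using that by auto
  have "ca a \<bullet> ?L t \<bullet> cu a = (of_nat (fact t) * ((xbinom (- int (a - t)) t)\<^sup>2 * (-1) ^ (a - t))) *\<^sub>m mbubble (a - t)"
    if "t \<in> set ?is" for t
    using dot_cross_left_closed[of "a - t" t] by (simp add: e[OF that])
  then have "msum [] [] (map (\<lambda>t. (of_nat (fact t) * ((xbinom (- int (a - t)) t)\<^sup>2 * (-1) ^ (a - t))) *\<^sub>m mbubble (a - t)) ?is)
      = msum [] [] (map (\<lambda>t. ca a \<bullet> ?L t \<bullet> cu a) ?is)"
    by (metis (mono_tags, lifting) map_cong)
  also have "\<dots> = ca a \<bullet> msum (strand a @ strand a) (strand a @ strand a) (map ?L ?is) \<bullet> cu a"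
    by (rule comp_msum_comp[symmetric]) (auto simp: e)
  also have "\<dots> = ca a \<bullet> msum (strand a @ strand a) (strand a @ strand a) (map ?R ?is) \<bullet> cu a"
    using dot_cross[of a a] by (simp del: upt_Suc)
  also have "\<dots> = msum [] [] (map (\<lambda>t. ca a \<bullet> ?R t \<bullet> cu a) ?is)"
    by (rule comp_msum_comp) (auto simp: e)
  also have "map (\<lambda>t. ca a \<bullet> ?R t \<bullet> cu a) ?is = map (\<lambda>t. (of_nat (fact t) * (-1) ^ (a - t)) *\<^sub>m trace a (dotted (a - t) t)) ?is"
  proof (rule map_cong[OF HOL.refl])
    fix t assume "t \<in> set ?is"
    then show "ca a \<bullet> ?R t \<bullet> cu a = (of_nat (fact t) * (-1) ^ (a - t)) *\<^sub>m trace a (dotted (a - t) t)"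
      using dot_cross_right_closed[of "a - t" t] by (simp add: e)
  qed
  finally show ?thesis .
qed


section \<open>Bubbles\<close>

interpretation endo: module scale_endo
proof
  fix r r' :: jring and f g :: endo_unit
  show "r *\<^sub>J (f + g) = r *\<^sub>J f + r *\<^sub>J g"
    by transfer (auto simp: endo_eq_def intro!: web_eq.scale_add dest: web_eq_typed)
  show "(r + r') *\<^sub>J f = r *\<^sub>J f + r' *\<^sub>J f"
    by transfer (auto simp: endo_eq_def intro!: web_eq.add_scale dest: web_eq_typed)
  show "r *\<^sub>J r' *\<^sub>J f = (r * r') *\<^sub>J f"
    by transfer (auto simp: endo_eq_def intro!: web_eq.scale_scale dest: web_eq_typed)
  show "1 *\<^sub>J f = f"
    by transfer (auto simp: endo_eq_def intro!: web_eq.scale_one dest: web_eq_typed)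
qed

text \<open>A bridge between the two quotients of \<open>web\<close>; its value is meaningful on
  endomorphisms of the unit, where the representative chosen does not matter.\<close>

definition to_endo :: "mor \<Rightarrow> endo_unit" where
  "to_endo f = abs_endo_unit (rep_mor f)"

lemma to_endo_abs:
  assumes "wf_web w" "src w = []" "tgt w = []"
  shows "to_endo (abs_mor w) = abs_endo_unit w"
proof -
  have "same_web (rep_mor (abs_mor w)) w"
    using Quotient3_rep_abs[OF Quotient3_mor] by (simp add: same_web_def web_eq.refl assms)
  then have "endo_eq (rep_mor (abs_mor w)) w"
    using assms by (auto simp: same_web_def endo_eq_def)
  then show ?thesis unfolding to_endo_def by (rule Quotient3_rel_abs[OF Quotient3_endo_unit])
qed

lemma hom_abs:
  assumes "hom [] [] f"
  obtains w where "f = abs_mor w" "wf_web w" "src w = []" "tgt w = []" "endo_eq w w"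
proof -
  obtain w where w: "f = abs_mor w" using Quotient3_abs_rep[OF Quotient3_mor] by metis
  with assms have "wf_web w" "src w = []" "tgt w = []"
    by (simp_all add: wfm.abs_eq msrc.abs_eq mtgt.abs_eq)
  with w show ?thesis by (intro that) (auto simp: endo_eq_refl)
qed

lemma to_endo_plus:
  assumes "hom [] [] f" "hom [] [] g"
  shows "to_endo (f +\<^sub>m g) = to_endo f + to_endo g"
proof -
  obtain v w where v: "f = abs_mor v" "wf_web v" "src v = []" "tgt v = []" "endo_eq v v"
    and w: "g = abs_mor w" "wf_web w" "src w = []" "tgt w = []" "endo_eq w w"
    using assms hom_abs by metis
  then show ?thesis by (simp add: mplus.abs_eq to_endo_abs plus_endo_unit.abs_eq)
qed

lemma to_endo_scl:
  assumes "hom [] [] f"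
  shows "to_endo (r *\<^sub>m f) = r *\<^sub>J to_endo f"
  using hom_abs[OF assms] by (metis (no_types) mscale.abs_eq to_endo_abs scale_endo.abs_eq wf_web.simps(12) src.simps(12) tgt.simps(12))

lemma hom_msum:
  assumes "0 \<notin> set X" "0 \<notin> set Y" "\<And>f. f \<in> set fs \<Longrightarrow> hom X Y f"
  shows "hom X Y (msum X Y fs)"
  using assms(3)
proof (induction fs)
  case (Cons f fs)
  then have "hom X Y (msum X Y fs)" "hom X Y f" by auto
  then show ?case by simp
qed (use assms in simp)

lemma to_endo_msum:
  assumes "\<And>i. i \<in> set is \<Longrightarrow> hom [] [] (f i)" "distinct is"
  shows "to_endo (msum [] [] (map f is)) = (\<Sum>i\<in>set is. to_endo (f i))"
  using assms
proof (induction "is")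
  case Nil
  then show ?case by (simp add: mzero.abs_eq to_endo_abs zero_endo_unit.abs_eq)
next
  case (Cons i "is")
  then have "hom [] [] (msum [] [] (map f is))" by (intro hom_msum) auto
  then show ?case using Cons to_endo_plus[of "f i" "msum [] [] (map f is)"] by simp
qed

lemma to_endo_mbubble: "to_endo (mbubble a) = bubble a"
proof (cases "a = 0")
  case True
  then have "mbubble a = abs_mor (Ident [])" by (simp add: mbubble_def flip: ident.abs_eq)
  then show ?thesis using True by (simp add: bubble_def to_endo_abs)
next
  case False
  have "mbubble a = abs_mor (cap a \<cdot> (dot a \<otimes> idn a) \<cdot> cup a)"
    by (simp add: mbubble_def idn_def ident.abs_eq mcomp.abs_eq mtens.abs_eq ca.abs_eq dt.abs_eq cu.abs_eq)
  then show ?thesis using False by (simp add: bubble_def to_endo_abs)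
qed

text \<open>The factorial absorbs the factor \<open>fact r\<close> of \<open>trace_dotted\<close>,
  so that the recursion stays within one family; it is also the weight with which these traces occur
  in \<open>bubble_relation\<close>.\<close>

definition loop :: "nat \<Rightarrow> nat \<Rightarrow> endo_unit" where
  "loop b t = of_nat (fact t) *\<^sub>J to_endo (trace (b + t) (dotted b t))"

lemma loop_0: "loop b 0 = (-1) ^ b *\<^sub>J bubble b"
  by (simp add: loop_def trace_dot to_endo_scl to_endo_mbubble)

lemma loop_rec:
  "loop b t = (\<Sum>r\<le>min t b. (of_nat (fact t) * xbinom (- int b) t * of_nat (t choose r)) *\<^sub>J loop (b - r) r)"
proof -
  have s: "set [0..<Suc (min t b)] = {..min t b}" by auto
  have "to_endo (trace (b + t) (dotted b t)) = xbinom (- int b) t *\<^sub>J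
     (\<Sum>r\<le>min t b. to_endo ((of_nat (fact r) * of_nat (t choose r)) *\<^sub>m trace b (dotted (b - r) r)))"
  proof -
    have h: "hom [] [] ((of_nat (fact r) * of_nat (t choose r)) *\<^sub>m trace b (dotted (b - r) r))"
      if "r \<in> set [0..<Suc (min t b)]" for r
      using that by auto
    then have "hom [] [] (msum [] [] (map (\<lambda>r. (of_nat (fact r) * of_nat (t choose r)) *\<^sub>m trace b (dotted (b - r) r)) [0..<Suc (min t b)]))"
      by (intro hom_msum) auto
    then show ?thesis
      unfolding trace_dotted s[symmetric] by (subst to_endo_scl) (simp_all only: to_endo_msum[OF h distinct_upt])
  qed
  then show ?thesis
    by (simp add: loop_def to_endo_scl endo.scale_sum_right mult_ac)
qed

section \<open>Iterating the recursion for loops\<close>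

lemma triangle_sum:
  fixes g :: "nat \<Rightarrow> nat \<Rightarrow> 'a :: comm_monoid_add"
  shows "(\<Sum>r\<le>b. \<Sum>s\<le>b - r. g r (r + s)) = (\<Sum>n\<le>b. \<Sum>r\<le>n. g r n)"
  unfolding sum.Sigma[OF finite_atMost ballI[OF finite_atMost]]
  by (rule sum.reindex_bij_witness[of _ "\<lambda>(n, r). (r, n - r)" "\<lambda>(r, s). (r + s, r)"]) auto

text \<open>For positive t and n, both sides count the ways to write n as an ordered sum of t
  natural numbers: choose which r summands are positive, then a composition of n into r
  parts.\<close>

lemma sum_choose_compositions: "(\<Sum>r\<le>n. (t choose r) * ((n - 1) choose (n - r))) = ((t + n - 1) choose n)"
proof (cases n)
  case (Suc n')
  then show ?thesis using vandermonde[of t "n - 1" n] by simp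
qed simp

lemma xbinom_revision:
  "xbinom (- int b) t * xbinom (int n - int b) n = of_nat ((t + n) choose n) * xbinom (int n - int b) (t + n)"
proof (rule jring_eqI)
  fix z :: rat
  have "((of_int (int n - int b) + z) gchoose (t + n)) * (of_nat (t + n) gchoose n)
      = ((of_int (int n - int b) + z) gchoose n) * ((of_int (int n - int b) + z - of_nat n) gchoose (t + n - n))"
    by (rule gbinomial_trinomial_revision) simp
  then show "jev (xbinom (- int b) t * xbinom (int n - int b) n) z
      = jev (of_nat ((t + n) choose n) * xbinom (int n - int b) (t + n)) z"
    by (simp add: binomial_gbinomial algebra_simps)
qed

text \<open>Here n is the total thickness split off the dotted strand. By
  \<open>xbinom_revision\<close> the binomial coefficients in x and the factorials telescope, so
  each composition of n contributes the same polynomial and only the number of compositions has to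
  be summed.\<close>

lemma loop_expand:
  "loop b t = (\<Sum>n\<le>b. (of_nat (fact (t + n) * ((t + n - 1) choose n)) * xbinom (int n - int b) (t + n)) *\<^sub>J loop (b - n) 0)"
proof (induction b arbitrary: t rule: less_induct)
  case (less b)
  let ?F = "\<lambda>b t. \<Sum>n\<le>b. (of_nat (fact (t + n) * ((t + n - 1) choose n)) * xbinom (int n - int b) (t + n)) *\<^sub>J loop (b - n) 0"
  \<comment> \<open>The summand r = 0 of the recursion is \<open>loop b 0\<close> with
    \<open>b\<close> unchanged, so the formula for t = 0 has to be known before the induction
    hypothesis can be used for the others.\<close>
  have F0: "loop b 0 = ?F b 0" for b
  proof -
    have "?F b 0 = (\<Sum>n\<in>{0}. (of_nat (fact (0 + n) * ((0 + n - 1) choose n)) * xbinom (int n - int b) (0 + n)) *\<^sub>J loop (b - n) 0)"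
      by (rule sum.mono_neutral_right) (auto simp: binomial_eq_0)
    then show ?thesis by simp
  qed
  have IH: "loop (b - r) r = ?F (b - r) r" if "r \<le> b" for r
  proof (cases "r = 0")
    case True
    show ?thesis unfolding True by (rule F0)
  next
    case False
    then show ?thesis using that by (intro less) simp
  qed
  let ?g = "\<lambda>r n. (of_nat (fact t) * xbinom (- int b) t * of_nat (t choose r) *
      (of_nat (fact n * ((n - 1) choose (n - r))) * xbinom (int n - int b) n)) *\<^sub>J loop (b - n) 0"
  have "loop b t = (\<Sum>r\<le>b. (of_nat (fact t) * xbinom (- int b) t * of_nat (t choose r)) *\<^sub>J loop (b - r) r)"
    unfolding loop_rec[of b t]
  proof (rule sum.mono_neutral_left)
    show "\<forall>r\<in>{..b} - {..min t b}. (of_nat (fact t) * xbinom (- int b) t * of_nat (t choose r)) *\<^sub>J loop (b - r) r = 0"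
    proof
      fix r assume "r \<in> {..b} - {..min t b}"
      then have "t choose r = 0" by (intro binomial_eq_0) auto
      then show "(of_nat (fact t) * xbinom (- int b) t * of_nat (t choose r)) *\<^sub>J loop (b - r) r = 0"
        by (simp only: of_nat_0 mult_zero_right endo.scale_zero_left)
    qed
  qed auto
  also have "\<dots> = (\<Sum>r\<le>b. \<Sum>s\<le>b - r. ?g r (r + s))"
  proof (rule sum.cong[OF HOL.refl])
    fix r assume "r \<in> {..b}"
    then have r: "r \<le> b" by simp
    have idx: "int s - int (b - r) = int (r + s) - int b" "r + s - r = s" for s using r by simp_all
    show "(of_nat (fact t) * xbinom (- int b) t * of_nat (t choose r)) *\<^sub>J loop (b - r) r = (\<Sum>s\<le>b - r. ?g r (r + s))"
      by (simp only: IH[OF r] endo.scale_sum_right endo.scale_scale idx diff_diff_add)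
  qed
  also have "\<dots> = (\<Sum>n\<le>b. \<Sum>r\<le>n. ?g r n)" by (rule triangle_sum)
  also have "\<dots> = ?F b t"
  proof (rule sum.cong[OF HOL.refl])
    fix n
    have f: "of_nat (fact t) * (of_nat (fact n) * of_nat ((t + n) choose n)) = (of_nat (fact (t + n)) :: jring)"
      using binomial_fact_lemma[of n "t + n"] by (simp add: mult_ac flip: of_nat_mult)
    have "(\<Sum>r\<le>n. of_nat (fact t) * xbinom (- int b) t * of_nat (t choose r) *
        (of_nat (fact n * ((n - 1) choose (n - r))) * xbinom (int n - int b) n))
      = (of_nat (fact t) * of_nat (fact n)) * (xbinom (- int b) t * xbinom (int n - int b) n) *
         of_nat (\<Sum>r\<le>n. (t choose r) * ((n - 1) choose (n - r)))"
      unfolding of_nat_sum sum_distrib_left by (intro sum.cong) (simp_all add: mult_ac)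
    also have "\<dots> = (of_nat (fact t) * (of_nat (fact n) * of_nat ((t + n) choose n))) * xbinom (int n - int b) (t + n) * of_nat ((t + n - 1) choose n)"
      unfolding sum_choose_compositions xbinom_revision by (simp only: mult_ac)
    also have "\<dots> = of_nat (fact (t + n) * ((t + n - 1) choose n)) * xbinom (int n - int b) (t + n)"
      unfolding f of_nat_mult by (simp only: mult_ac)
    finally show "(\<Sum>r\<le>n. ?g r n) = (of_nat (fact (t + n) * ((t + n - 1) choose n)) * xbinom (int n - int b) (t + n)) *\<^sub>J loop (b - n) 0"
      by (simp only: endo.scale_sum_left[symmetric])
  qed
  finally show ?case .
qed

text \<open>After reversal this is the alternating sum of row n - 1 of Pascal's triangle, which
  vanishes since n - 1 > 0.\<close>

lemma alternating_compositions:
  "n \<ge> 2 \<Longrightarrow> (\<Sum>t\<le>n. (-1) ^ t * of_nat ((n - 1) choose (n - t))) = (0 :: jring)"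
proof -
  assume n: "n \<ge> 2"
  have "(\<Sum>t\<le>n. (-1) ^ t * of_nat ((n - 1) choose (n - t))) = (\<Sum>s\<le>n. (-1) ^ (n - s) * of_nat ((n - 1) choose s) :: jring)"
    by (rule sum.reindex_bij_witness[of _ "\<lambda>s. n - s" "\<lambda>s. n - s"]) auto
  also have "\<dots> = (\<Sum>s\<le>n. (-1) ^ n * ((-1) ^ s * of_nat ((n - 1) choose s)))"
    by (rule sum.cong) (auto simp: minus_one_power_iff)
  also have "\<dots> = (-1) ^ n * (\<Sum>s\<le>n - 1. (-1) ^ s * of_nat ((n - 1) choose s))"
  proof -
    have "{..n} - {..n - 1} = {n}" using n by auto
    then show ?thesis unfolding sum_distrib_left[symmetric]
      by (intro arg_cong2[where f = "(*)"] HOL.refl sum.mono_neutral_right) (use n in \<open>auto simp: binomial_eq_0\<close>)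
  qed
  finally show ?thesis using choose_alternating_sum[of "n - 1", where 'a = jring] n by simp
qed

lemma bubble_sum:
  assumes "a > 0"
  shows "(\<Sum>t\<le>a. (of_nat (fact t) * (xbinom (int t - int a) t)\<^sup>2 * (-1) ^ (a - t)) *\<^sub>J bubble (a - t))
    = bubble a + xbinom (1 - int a) 1 *\<^sub>J bubble (a - 1)"
proof -
  have s: "set [0..<Suc a] = {..a}" by auto
  have sq: "(-1) ^ k *\<^sub>J loop k 0 = bubble k" for k
    by (simp add: loop_0 flip: power_mult_distrib)
  have "(\<Sum>t\<le>a. (of_nat (fact t) * (xbinom (int t - int a) t)\<^sup>2 * (-1) ^ (a - t)) *\<^sub>J bubble (a - t))
      = (\<Sum>t\<le>a. to_endo ((of_nat (fact t) * ((xbinom (- int (a - t)) t)\<^sup>2 * (-1) ^ (a - t))) *\<^sub>m mbubble (a - t)))"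
    by (rule sum.cong) (auto simp: to_endo_scl to_endo_mbubble of_nat_diff mult.assoc)
  also have "\<dots> = to_endo (msum [] [] (map (\<lambda>t. (of_nat (fact t) * ((xbinom (- int (a - t)) t)\<^sup>2 * (-1) ^ (a - t))) *\<^sub>m mbubble (a - t)) [0..<Suc a]))"
    unfolding s[symmetric] by (rule to_endo_msum[symmetric]) auto
  also have "\<dots> = (\<Sum>t\<le>a. to_endo ((of_nat (fact t) * (-1) ^ (a - t)) *\<^sub>m trace a (dotted (a - t) t)))"
    unfolding bubble_relation s[symmetric] by (rule to_endo_msum) auto
  also have "\<dots> = (\<Sum>t\<le>a. (-1) ^ (a - t) *\<^sub>J loop (a - t) t)"
    by (rule sum.cong) (auto simp: to_endo_scl loop_def mult.commute)
  also have "\<dots> = (\<Sum>t\<le>a. \<Sum>s\<le>a - t. ((-1) ^ (a - t) * (of_nat (fact (t + s) * ((t + s - 1) choose (t + s - t)))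
       * xbinom (int (t + s) - int a) (t + s))) *\<^sub>J loop (a - (t + s)) 0)"
  proof (rule sum.cong[OF HOL.refl])
    fix t assume "t \<in> {..a}"
    then have idx: "int s - int (a - t) = int (t + s) - int a" "t + s - t = s" for s by simp_all
    show "(-1) ^ (a - t) *\<^sub>J loop (a - t) t = (\<Sum>s\<le>a - t. ((-1) ^ (a - t) * (of_nat (fact (t + s) * ((t + s - 1) choose (t + s - t)))
       * xbinom (int (t + s) - int a) (t + s))) *\<^sub>J loop (a - (t + s)) 0)"
      by (simp only: loop_expand[of "a - t" t] endo.scale_sum_right endo.scale_scale idx diff_diff_add)
  qed
  also have "\<dots> = (\<Sum>n\<le>a. \<Sum>t\<le>n. ((-1) ^ (a - t) * (of_nat (fact n * ((n - 1) choose (n - t)))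
       * xbinom (int n - int a) n)) *\<^sub>J loop (a - n) 0)"
    by (rule triangle_sum)
  also have "\<dots> = (\<Sum>n\<le>a. ((\<Sum>t\<le>n. (-1) ^ t * of_nat ((n - 1) choose (n - t))) * ((-1) ^ a * of_nat (fact n) * xbinom (int n - int a) n)) *\<^sub>J loop (a - n) 0)"
  proof (rule sum.cong[OF HOL.refl])
    fix n assume "n \<in> {..a}"
    then have "(-1) ^ (a - t) = ((-1) ^ a * (-1) ^ t :: jring)" if "t \<le> n" for t
      using that by (auto simp: minus_one_power_iff)
    then show "(\<Sum>t\<le>n. ((-1) ^ (a - t) * (of_nat (fact n * ((n - 1) choose (n - t)))
       * xbinom (int n - int a) n)) *\<^sub>J loop (a - n) 0)
      = ((\<Sum>t\<le>n. (-1) ^ t * of_nat ((n - 1) choose (n - t))) * ((-1) ^ a * of_nat (fact n) * xbinom (int n - int a) n)) *\<^sub>J loop (a - n) 0"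
      unfolding endo.scale_sum_left[symmetric] sum_distrib_right
      by (intro arg_cong2[where f = scale_endo] sum.cong) (simp_all add: mult_ac)
  qed
  \<comment> \<open>The alternating count is 1 for n = 0, where \<open>n - 1\<close> is truncated to
    0, and -1 for n = 1; this last sign turns the power a of -1 into the power a - 1.\<close>
  also have "\<dots> = (\<Sum>n\<in>{0, 1}. ((\<Sum>t\<le>n. (-1) ^ t * of_nat ((n - 1) choose (n - t))) * ((-1) ^ a * of_nat (fact n) * xbinom (int n - int a) n)) *\<^sub>J loop (a - n) 0)"
    by (rule sum.mono_neutral_right) (use assms alternating_compositions in \<open>auto simp: not_less_eq_eq numeral_2_eq_2\<close>)
  also have "\<dots> = (-1) ^ a *\<^sub>J loop a 0 + xbinom (1 - int a) 1 *\<^sub>J (-1) ^ (a - 1) *\<^sub>J loop (a - 1) 0"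
    using assms by (cases a) (simp_all add: mult.commute)
  finally show ?thesis by (simp add: sq)
qed

text \<open>The coefficient of the bubble of thickness 2j in that of thickness 2(j + k) + 1.
  Indexing by j instead of m keeps the argument x - 2j fixed throughout the recursion.\<close>

definition bubble_coef :: "nat \<Rightarrow> nat \<Rightarrow> jring" where
  "bubble_coef j k = (-1) ^ k * of_nat (fact (2 * k)) * of_int (genocchi (2 * k + 2))
    * xbinom (- 2 * int j) (2 * k + 2) * xbinom (- 2 * int j - 1) (2 * k)"

lemma jev_bubble_coef: "jev (bubble_coef j k) z = coef_rat (z - of_nat (2 * j)) k"
  by (simp add: bubble_coef_def coef_rat_def sgenocchi_def algebra_simps del: fact_Suc)

lemma bubble_coef_recursion:
  assumes "j \<le> m"
  shows "of_nat (fact (2 * m + 1 - 2 * j)) * (xbinom (- int (2 * j)) (2 * m + 1 - 2 * j))\<^sup>2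
    - (\<Sum>i\<in>{j..<m}. of_nat (fact (2 * m + 1 - (2 * i + 1))) * (xbinom (- int (2 * i + 1)) (2 * m + 1 - (2 * i + 1)))\<^sup>2 * bubble_coef j (i - j))
    - (if j = m then xbinom (- int (2 * m)) 1 else 0) = 2 * bubble_coef j (m - j)"
proof (rule jring_eqI)
  fix z :: rat
  define n where "n = m - j"
  define y where "y = z - of_nat (2 * j)"
  have m: "m = j + n" using assms by (simp add: n_def)
  have 1: "2 * m + 1 - 2 * j = 2 * n + 1" "m - j = n" "of_int (- int (2 * j)) + z = y" "j = m \<longleftrightarrow> n = 0"
    by (auto simp: m y_def)
  have 2: "2 * m + 1 - (2 * (j + k) + 1) = 2 * n - 2 * k" "of_int (- int (2 * (j + k) + 1)) + z = y - of_nat (2 * k + 1)" for k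
    by (auto simp: m y_def)
  have "(\<Sum>i\<in>{j..<m}. jev (of_nat (fact (2 * m + 1 - (2 * i + 1))) * (xbinom (- int (2 * i + 1)) (2 * m + 1 - (2 * i + 1)))\<^sup>2 * bubble_coef j (i - j)) z)
      = (\<Sum>k<n. fact (2 * n - 2 * k) * ((y - of_nat (2 * k + 1)) gchoose (2 * n - 2 * k))\<^sup>2 * coef_rat y k)"
  proof (rule sum.reindex_bij_witness[of _ "\<lambda>k. j + k" "\<lambda>i. i - j"])
    fix i assume "i \<in> {j..<m}"
    then obtain k where i: "i = j + k" by (auto simp: le_iff_add)
    show "fact (2 * n - 2 * (i - j)) * ((y - of_nat (2 * (i - j) + 1)) gchoose (2 * n - 2 * (i - j)))\<^sup>2 * coef_rat y (i - j)
      = jev (of_nat (fact (2 * m + 1 - (2 * i + 1))) * (xbinom (- int (2 * i + 1)) (2 * m + 1 - (2 * i + 1)))\<^sup>2 * bubble_coef j (i - j)) z"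
      unfolding i 2(1) by (simp only: jev_simps jev_power jev_of_nat jev_xbinom jev_bubble_coef 2(2) y_def[symmetric] diff_add_inverse of_nat_fact)
  qed (auto simp: m)
  moreover have "jev (of_nat (fact (2 * m + 1 - 2 * j)) * (xbinom (- int (2 * j)) (2 * m + 1 - 2 * j))\<^sup>2) z
      = fact (2 * n + 1) * (y gchoose (2 * n + 1))\<^sup>2"
    by (simp only: jev_simps jev_power jev_of_nat jev_xbinom 1 of_nat_fact)
  moreover have "jev (if j = m then xbinom (- int (2 * m)) 1 else 0) z = (if n = 0 then y else 0)"
    by (simp add: m y_def)
  moreover have "jev (2 * bubble_coef j (m - j)) z = 2 * coef_rat y n"
    by (simp only: 1 jev_simps jev_numeral jev_bubble_coef y_def[symmetric])
  ultimately show "jev (of_nat (fact (2 * m + 1 - 2 * j)) * (xbinom (- int (2 * j)) (2 * m + 1 - 2 * j))\<^sup>2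
    - (\<Sum>i\<in>{j..<m}. of_nat (fact (2 * m + 1 - (2 * i + 1))) * (xbinom (- int (2 * i + 1)) (2 * m + 1 - (2 * i + 1)))\<^sup>2 * bubble_coef j (i - j))
    - (if j = m then xbinom (- int (2 * m)) 1 else 0)) z = jev (2 * bubble_coef j (m - j)) z"
    using coef_rat_recursion[of n y] by (simp only: jev_simps(4) jev_sum)
qed

lemma sum_parity:
  fixes f :: "nat \<Rightarrow> 'a :: comm_monoid_add"
  shows "(\<Sum>b\<le>2 * m + 1. f b) = (\<Sum>j\<le>m. f (2 * j)) + (\<Sum>i\<le>m. f (2 * i + 1))"
  by (induction m) (simp_all add: add_ac)

lemma half_twice [simp]: "half * 2 = 1"
  by (rule jring_eqI) (use jev_of_int[of 2] in simp)

theorem theoremG: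
  fixes m :: nat
  shows "bubble (2 * m + 1) =
    (\<Sum>k=0..m. ((-1) ^ k * of_nat (fact (2 * k)) * of_int (genocchi (2 * k + 2))
        * xbinom (2 * int k - 2 * int m) (2 * k + 2)
        * xbinom (2 * int k - 2 * int m - 1) (2 * k)) *\<^sub>J bubble (2 * m - 2 * k))"
proof -
  have "bubble (2 * m + 1) = (\<Sum>j\<le>m. bubble_coef j (m - j) *\<^sub>J bubble (2 * j))"
  proof (induction m rule: less_induct)
    case (less m)
    define a where "a = 2 * m + 1"
    let ?c = "\<lambda>b. of_nat (fact (a - b)) * (xbinom (- int b) (a - b))\<^sup>2"
    let ?f = "\<lambda>b. (?c b * (-1) ^ b) *\<^sub>J bubble b"
    have "(\<Sum>b\<le>a. ?f b) = (\<Sum>t\<le>a. (of_nat (fact t) * (xbinom (int t - int a) t)\<^sup>2 * (-1) ^ (a - t)) *\<^sub>J bubble (a - t))"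
      by (rule sum.reindex_bij_witness[of _ "\<lambda>t. a - t" "\<lambda>b. a - b"]) (auto simp: of_nat_diff)
    also have "\<dots> = bubble a + xbinom (- int (2 * m)) 1 *\<^sub>J bubble (2 * m)"
      by (subst bubble_sum) (simp_all add: a_def)
    finally have eq: "(\<Sum>b\<le>a. ?f b) = bubble a + xbinom (- int (2 * m)) 1 *\<^sub>J bubble (2 * m)" .
    \<comment> \<open>By the induction hypothesis the smaller odd bubbles are combinations of even
      ones; exchanging the sums collects the coefficient of \<open>bubble (2 * j)\<close>.\<close>
    have odd: "(\<Sum>i<m. ?c (2 * i + 1) *\<^sub>J bubble (2 * i + 1))
        = (\<Sum>j\<le>m. (\<Sum>i\<in>{j..<m}. ?c (2 * i + 1) * bubble_coef j (i - j)) *\<^sub>J bubble (2 * j))"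
    proof -
      have "(\<Sum>i<m. ?c (2 * i + 1) *\<^sub>J bubble (2 * i + 1))
          = (\<Sum>i<m. \<Sum>j\<le>i. (?c (2 * i + 1) * bubble_coef j (i - j)) *\<^sub>J bubble (2 * j))"
        by (rule sum.cong) (simp_all only: less lessThan_iff endo.scale_sum_right endo.scale_scale)
      also have "\<dots> = (\<Sum>j\<le>m. \<Sum>i\<in>{j..<m}. (?c (2 * i + 1) * bubble_coef j (i - j)) *\<^sub>J bubble (2 * j))"
        unfolding sum.Sigma[OF finite_lessThan ballI[OF finite_atMost]] sum.Sigma[OF finite_atMost ballI[OF finite_atLeastLessThan]]
        by (rule sum.reindex_bij_witness[of _ "\<lambda>(j, i). (i, j)" "\<lambda>(i, j). (j, i)"]) auto
      finally show ?thesis by (simp only: endo.scale_sum_left)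
    qed
    have "(\<Sum>b\<le>a. ?f b) = (\<Sum>j\<le>m. ?c (2 * j) *\<^sub>J bubble (2 * j)) - (\<Sum>i\<le>m. ?c (2 * i + 1) *\<^sub>J bubble (2 * i + 1))"
      unfolding a_def sum_parity by (simp add: sum_negf)
    \<comment> \<open>The term i = m is \<open>bubble a\<close> with coefficient 1. As
      \<open>a\<close> is odd it enters with a minus sign, so moving it across doubles the
      \<open>bubble a\<close> already there.\<close>
    also have "(\<Sum>i\<le>m. ?c (2 * i + 1) *\<^sub>J bubble (2 * i + 1)) = (\<Sum>i<m. ?c (2 * i + 1) *\<^sub>J bubble (2 * i + 1)) + bubble a"
      by (simp add: a_def flip: lessThan_Suc_atMost)
    finally have "bubble a + bubble a = (\<Sum>j\<le>m. ?c (2 * j) *\<^sub>J bubble (2 * j))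
        - (\<Sum>j\<le>m. (\<Sum>i\<in>{j..<m}. ?c (2 * i + 1) * bubble_coef j (i - j)) *\<^sub>J bubble (2 * j))
        - xbinom (- int (2 * m)) 1 *\<^sub>J bubble (2 * m)"
      using eq unfolding odd by (simp add: algebra_simps)
    also have "xbinom (- int (2 * m)) 1 *\<^sub>J bubble (2 * m)
        = (\<Sum>j\<le>m. (if j = m then xbinom (- int (2 * m)) 1 else 0) *\<^sub>J bubble (2 * j))"
      by (simp add: if_distrib[of "\<lambda>r. r *\<^sub>J _"] cong: if_cong)
    finally have "bubble a + bubble a = (\<Sum>j\<le>m. (?c (2 * j) - (\<Sum>i\<in>{j..<m}. ?c (2 * i + 1) * bubble_coef j (i - j))
        - (if j = m then xbinom (- int (2 * m)) 1 else 0)) *\<^sub>J bubble (2 * j))"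
      by (simp only: sum_subtractf endo.scale_left_diff_distrib)
    also have "\<dots> = (\<Sum>j\<le>m. (2 * bubble_coef j (m - j)) *\<^sub>J bubble (2 * j))"
      by (rule sum.cong[OF HOL.refl]) (simp only: a_def bubble_coef_recursion atMost_iff)
    also have "\<dots> = 2 *\<^sub>J (\<Sum>j\<le>m. bubble_coef j (m - j) *\<^sub>J bubble (2 * j))"
      by (simp add: endo.scale_sum_right)
    also have "bubble a + bubble a = 2 *\<^sub>J bubble a"
      using endo.scale_left_distrib[of 1 1 "bubble a"] by simp
    \<comment> \<open>The factor 2 is cancelled by multiplication with \<open>half\<close>; the
      module itself need not be free of 2-torsion a priori.\<close>
    finally have "half *\<^sub>J 2 *\<^sub>J bubble a = half *\<^sub>J 2 *\<^sub>J (\<Sum>j\<le>m. bubble_coef j (m - j) *\<^sub>J bubble (2 * j))"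
      by simp
    then show ?case by (simp add: a_def)
  qed
  also have "\<dots> = (\<Sum>k=0..m. bubble_coef (m - k) k *\<^sub>J bubble (2 * m - 2 * k))"
    by (rule sum.reindex_bij_witness[of _ "\<lambda>k. m - k" "\<lambda>j. m - j"]) (auto simp: diff_mult_distrib2)
  also have "\<dots> = (\<Sum>k=0..m. ((-1) ^ k * of_nat (fact (2 * k)) * of_int (genocchi (2 * k + 2))
        * xbinom (2 * int k - 2 * int m) (2 * k + 2)
        * xbinom (2 * int k - 2 * int m - 1) (2 * k)) *\<^sub>J bubble (2 * m - 2 * k))"
    by (rule sum.cong) (simp_all add: bubble_coef_def of_nat_diff algebra_simps)
  finally show ?thesis .
qed

end
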